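(* Let $Q>1$, and let $Z=(Z,d,\mu)$ be an Ahlfors $Q$-regular compact metric measure space with $\operatorname{diam}(Z)=1$ that supports a $Q$-Poincaré inequality. Let $X=(V,E)$ be a hyperbolic filling of $Z$, used to define $\dot A^Q(Z)$. Then $\dot A^{Q}(Z)=\dot M^{1,Q}(Z)$, with comparability of semi-norms; that is, there is a constant $C\ge1$ such that $C^{-1}\|f\|_{\dot M^{1,Q}}\le\|f\|_{\dot A^Q}\le C\|f\|_{\dot M^{1,Q}}$ for all $f$ in this common space.
   Context: Ahlfors regularity: a metric space $(Z,d)$ with a Borel measure $\mu$ is Ahlfors $Q$-regular (with $\operatorname{diam}(Z)=1$) if there is a constant $c\ge 1$ with $c^{-1}r^Q\le\mu(B)\le c\,r^Q$ for every open ball $B$ of radius $0<r\le 1$. Write $|A|=\mu(A)$ and $f_B=\frac1{|B|}\int_Bf\,d\mu$; $\Lambda B$ is the ball with the same center as $B$ and $\Lambda$ times its radius. Poincaré inequality: for Lipschitz $f\colon Z\to\mathbb{R}$ let $(\operatorname{Lip} f)(x)=\limsup_{r\to0^+}\sup_{y\in B(x,r)}|f(y)-f(x)|/r$. For $p\ge1$, $Z$ supports a $p$-Poincaré inequality if there are $C\ge0$, $\Lambda\ge1$ such that $\frac1{|B|}\int_B|f-f_B|\,d\mu\le CR\big(\frac1{|\Lambda B|}\int_{\Lambda B}(\operatorname{Lip}f)^p\,d\mu\big)^{1/p}$ for every Lipschitz $f\colon Z\to\mathbb{R}$ and every ball $B\subset Z$, where $R$ is the radius of $B$. Hyperbolic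 filling: for each $n\in\mathbb{N}=\{1,2,\dots\}$ choose a maximal $2^{-n}$-separated set $Z_n\subset Z$. Let $V_n$ be the collection of balls $B(z,2^{1-n})$, $z\in Z_n$ (level $n$), and $V_0=\{Z\}$ (level $0$). The vertex set $V$ is the disjoint union of the $V_n$, $n\ge 0$. Two distinct vertices $B,B'$ are joined by an (unoriented, unique) edge if their levels differ by at most $1$ and $B\cap B'\ne\emptyset$; $E$ is the set of edges. For each edge $e$ one fixes a choice of initial vertex $e_-$ and terminal vertex $e_+$ among its two endpoints. For $f\in L^1(Z)$ (real-valued), the Poisson extension $Pf\colon V\to\mathbb{R}$ is $Pf(B)=f_B$; for $u\colon V\to\mathbb{R}$, $du(e)=u(e_+)-u(e_-)$, $e\in E$. For a countable set $M$ and $p>1$, $\ell^{p,\infty}(M)$ is the space of all $s\colon M\to\mathbb{R}$ for which there is $C\ge0$ with $\#\{m\in M:|s(m)|>\lambda\}\le (C/\lambda)^p$ for all $\lambda>0$, with norm $\|s\|_{\ell^{p,\infty}}=\sup\{n^{-1+1/p}\sum_{j\in F}|s(j)|: n\in\mathbb{N},\ F\subset M,\ \#F=n\}$. For $p>1$, $\dot A^p(Z)$ is the space of all $f\in L^1(Z)$ with $d(Pf)\in\ell^{p,\infty}(E)$, with semi-norm $\|f\|_{\dot A^p}=\|d(Pf)\|_{\ell^{p,\infty}}$. Hajłasz–Sobolev space: for $\alpha>0$ and $f\in L^1(Z)$, $\mathcal D_\alpha(f)$ is the set of all measurable $g\ge0$ on $Z$ for which there is $N\subset Z$ with $|N|=0$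 and $|f(x)-f(y)|\le d(x,y)^\alpha(g(x)+g(y))$ for all $x,y\in Z\setminus N$. For $p\ge1$, $\dot M^{\alpha,p}(Z)$ is the space of all $f\in L^1(Z)$ such that $\mathcal D_\alpha(f)\cap L^p(Z)\neq\emptyset$, with semi-norm $\|f\|_{\dot M^{\alpha,p}}=\inf\{\|g\|_{L^p}:g\in\mathcal D_\alpha(f)\}$. *)

theory Defs
  imports "HOL-Analysis.Analysis"
begin

text \<open>
  The metric space is the universe of a type of class \<open>metric_space\<close>. Elements of \<open>L\<^sup>1\<close> are
  represented by integrable functions rather than by classes modulo null sets.
\<close>

definition ahlfors_regular :: "'a::metric_space measure \<Rightarrow> real \<Rightarrow> bool" where
  "ahlfors_regular \<mu> Q \<longleftrightarrow>
     (\<exists>c\<ge>1. \<forall>z r. 0 < r \<and> r \<le> 1 \<longrightarrow>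
        ennreal (inverse c * r powr Q) \<le> emeasure \<mu> (ball z r) \<and>
        emeasure \<mu> (ball z r) \<le> ennreal (c * r powr Q))"

definition average :: "'a measure \<Rightarrow> 'a set \<Rightarrow> ('a \<Rightarrow> real) \<Rightarrow> real" where
  "average \<mu> B f = (LINT x:B|\<mu>. f x) / measure \<mu> B"

text \<open>The upper limit is taken in \<open>[0, \<infinity>]\<close>; it is finite whenever \<open>f\<close> is Lipschitz.\<close>

definition Lip :: "('a::metric_space \<Rightarrow> real) \<Rightarrow> 'a \<Rightarrow> real" where
  "Lip f x =
     enn2real (Limsup (at_right 0) (\<lambda>r. SUP y\<in>ball x r. ennreal (\<bar>f y - f x\<bar> / r)))"

definition supports_poincare :: "'a::metric_space measure \<Rightarrow> real \<Rightarrow> bool" where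
  "supports_poincare \<mu> p \<longleftrightarrow>
     (\<exists>C\<ge>0. \<exists>\<Lambda>\<ge>1. \<forall>f. (\<exists>L. L-lipschitz_on UNIV f) \<longrightarrow> (\<forall>z. \<forall>R>0.
        average \<mu> (ball z R) (\<lambda>x. \<bar>f x - average \<mu> (ball z R) f\<bar>)
          \<le> C * R * average \<mu> (ball z (\<Lambda> * R)) (\<lambda>x. Lip f x powr p) powr (1 / p)))"

definition separated :: "real \<Rightarrow> 'a::metric_space set \<Rightarrow> bool" where
  "separated \<epsilon> S \<longleftrightarrow> (\<forall>x\<in>S. \<forall>y\<in>S. x \<noteq> y \<longrightarrow> \<epsilon> \<le> dist x y)"

definition maximal_separated :: "real \<Rightarrow> 'a::metric_space set \<Rightarrow> bool" where
  "maximal_separated \<epsilon> S \<longleftrightarrow> separated \<epsilon> S \<and> (\<forall>T. separated \<epsilon> T \<and> S \<subseteq> T \<longrightarrow> T = S)"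

text \<open>
  A ball comes with its centre and radius, which the underlying set need not determine.
  \<open>Vertex n z\<close> is the ball with centre \<open>z\<close> and radius \<open>2\<^bsup>1-n\<^esup>\<close>, at level \<open>n \<ge> 1\<close>;
  \<open>Root\<close> is the whole space, at level 0.
\<close>

datatype 'a vertex = Root | Vertex nat 'a

fun level :: "'a vertex \<Rightarrow> nat" where
  "level Root = 0"
| "level (Vertex n z) = n"

fun vball :: "'a::metric_space vertex \<Rightarrow> 'a set" where
  "vball Root = UNIV"
| "vball (Vertex n z) = ball z (2 powr (1 - real n))"

definition filling_vertices :: "(nat \<Rightarrow> 'a set) \<Rightarrow> 'a vertex set" where
  "filling_vertices N = {Root} \<union> {Vertex n z | n z. 1 \<le> n \<and> z \<in> N n}"

definition filling_edges :: "(nat \<Rightarrow> 'a::metric_space set) \<Rightarrow> 'a vertex set set" where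
  "filling_edges N =
     {{v, w} | v w. v \<in> filling_vertices N \<and> w \<in> filling_vertices N \<and> v \<noteq> w \<and>
        level v \<le> level w + 1 \<and> level w \<le> level v + 1 \<and> vball v \<inter> vball w \<noteq> {}}"

definition poisson_ext :: "'a::metric_space measure \<Rightarrow> ('a \<Rightarrow> real) \<Rightarrow> 'a vertex \<Rightarrow> real" where
  "poisson_ext \<mu> f v = average \<mu> (vball v) f"

text \<open>\<open>ini e\<close> and \<open>ter e\<close> are the chosen initial and terminal vertex of the edge \<open>e\<close>.\<close>

definition edge_diff ::
    "('v set \<Rightarrow> 'v) \<Rightarrow> ('v set \<Rightarrow> 'v) \<Rightarrow> ('v \<Rightarrow> real) \<Rightarrow> 'v set \<Rightarrow> real" where
  "edge_diff ini ter u e = u (ter e) - u (ini e)"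

definition weak_lp :: "real \<Rightarrow> 'b set \<Rightarrow> ('b \<Rightarrow> real) set" where
  "weak_lp p M =
     {s. \<exists>C\<ge>0. \<forall>t>0. finite {m\<in>M. t < \<bar>s m\<bar>} \<and>
           real (card {m\<in>M. t < \<bar>s m\<bar>}) \<le> (C / t) powr p}"

text \<open>For \<open>p > 1\<close> the set below is bounded above if \<open>s \<in> weak_lp p M\<close>; the value
  is meaningful only for such \<open>s\<close> (and \<open>M \<noteq> {}\<close>).\<close>

definition weak_lp_norm :: "real \<Rightarrow> 'b set \<Rightarrow> ('b \<Rightarrow> real) \<Rightarrow> real" where
  "weak_lp_norm p M s =
     Sup {real n powr (- 1 + 1 / p) * (\<Sum>j\<in>F. \<bar>s j\<bar>) | n F.
            1 \<le> n \<and> F \<subseteq> M \<and> finite F \<and> card F = n}"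

definition A_space ::
    "'a::metric_space measure \<Rightarrow> (nat \<Rightarrow> 'a set) \<Rightarrow> ('a vertex set \<Rightarrow> 'a vertex) \<Rightarrow>
     ('a vertex set \<Rightarrow> 'a vertex) \<Rightarrow> real \<Rightarrow> ('a \<Rightarrow> real) set" where
  "A_space \<mu> N ini ter p =
     {f. integrable \<mu> f \<and> edge_diff ini ter (poisson_ext \<mu> f) \<in> weak_lp p (filling_edges N)}"

definition A_seminorm ::
    "'a::metric_space measure \<Rightarrow> (nat \<Rightarrow> 'a set) \<Rightarrow> ('a vertex set \<Rightarrow> 'a vertex) \<Rightarrow>
     ('a vertex set \<Rightarrow> 'a vertex) \<Rightarrow> real \<Rightarrow> ('a \<Rightarrow> real) \<Rightarrow> real" where
  "A_seminorm \<mu> N ini ter p f =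
     weak_lp_norm p (filling_edges N) (edge_diff ini ter (poisson_ext \<mu> f))"

definition Lp_space :: "'a measure \<Rightarrow> real \<Rightarrow> ('a \<Rightarrow> real) set" where
  "Lp_space \<mu> p = {g. g \<in> borel_measurable \<mu> \<and> integrable \<mu> (\<lambda>x. \<bar>g x\<bar> powr p)}"

definition Lp_norm :: "'a measure \<Rightarrow> real \<Rightarrow> ('a \<Rightarrow> real) \<Rightarrow> real" where
  "Lp_norm \<mu> p g = (LINT x|\<mu>. \<bar>g x\<bar> powr p) powr (1 / p)"

definition hajlasz_gradients ::
    "'a::metric_space measure \<Rightarrow> real \<Rightarrow> ('a \<Rightarrow> real) \<Rightarrow> ('a \<Rightarrow> real) set" where
  "hajlasz_gradients \<mu> \<alpha> f =
     {g. g \<in> borel_measurable \<mu> \<and> (\<forall>x. 0 \<le> g x) \<and>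
         (\<exists>N\<in>null_sets \<mu>. \<forall>x\<in>UNIV - N. \<forall>y\<in>UNIV - N.
            \<bar>f x - f y\<bar> \<le> dist x y powr \<alpha> * (g x + g y))}"

definition M_space :: "'a::metric_space measure \<Rightarrow> real \<Rightarrow> real \<Rightarrow> ('a \<Rightarrow> real) set" where
  "M_space \<mu> \<alpha> p = {f. integrable \<mu> f \<and> hajlasz_gradients \<mu> \<alpha> f \<inter> Lp_space \<mu> p \<noteq> {}}"

text \<open>Gradients outside \<open>L\<^sup>p\<close> have infinite norm and do not affect the infimum.\<close>

definition M_seminorm ::
    "'a::metric_space measure \<Rightarrow> real \<Rightarrow> real \<Rightarrow> ('a \<Rightarrow> real) \<Rightarrow> real" where
  "M_seminorm \<mu> \<alpha> p f = (INF g\<in>hajlasz_gradients \<mu> \<alpha> f \<inter> Lp_space \<mu> p. Lp_norm \<mu> p g)"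

end

theory Submission
  imports Defs
begin

text \<open>
  If \<open>g\<close> is a Hajlasz gradient of \<open>f\<close>, the gradient of the Poisson extension on an edge at level
  \<open>n\<close> is at most a constant times \<open>2\<^sup>-\<^sup>n\<close> times an average of \<open>g\<close>. Keeping only the part of \<open>g\<close> above
  a fixed fraction of \<open>2\<^sup>n t\<close> and summing over the vertices gives the weak-type bound directly.

  For the converse, let \<open>f\<^sub>n\<close> be a Lipschitz discretization of \<open>f\<close> at level \<open>n\<close>. The integral of
  \<open>Lip f\<^sub>n\<close> to the power \<open>Q\<close> is controlled by the sum \<open>a\<^sub>n\<close> of the \<open>Q\<close>-th powers of the gradient
  over the edges inside level \<open>n\<close>. A weak-type bound makes the sum of the \<open>Q\<close>-th powers over a set of edges
  grow at most logarithmically in its cardinality. The first \<open>n\<close> levels contain exponentially many such edges,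
  so \<open>a\<^sub>1 + \<dots> + a\<^sub>n\<close> is \<open>O(n)\<close>, and \<open>a\<^sub>n\<close> is bounded along a subsequence. It remains to bound the
  sharp maximal function \<open>sup (1/r) avg |u - u\<^sub>B|\<close> of a Lipschitz function \<open>u\<close> in \<open>L\<^sup>Q\<close> by \<open>Lip u\<close>;
  Fatou's lemma then yields a Hajlasz gradient of \<open>f\<close>.

  The \<open>Q\<close>-Poincare inequality gives this bound only in weak \<open>L\<^sup>Q\<close>. The endpoint is reached by the idea of Keith
  and Zhong: \<open>u\<close> is replaced by the average of \<open>k\<close> Lipschitz truncations at heights
  \<open>T\<beta>, 2T\<beta>, 4T\<beta>, \<dots>\<close> of the sharp function. On a ball where the oscillation of \<open>u\<close> exceeds \<open>\<beta>\<close> either the sharp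
  function has a large part above \<open>T\<beta>\<close>, or the average reproduces the oscillation of \<open>u\<close> while
  its gradient is at most \<open>Lip u\<close> plus \<open>1/k\<close> times the sharp function. Summed over dyadic
  \<open>\<beta>\<close>, the sharp function appears on the right with a factor comparable to \<open>T\<^bsup>1-Q\<^esup> + k\<^bsup>1-Q\<^esup>\<close>, which is
  absorbed because \<open>Q > 1\<close>.
\<close>

section \<open>Ahlfors regular spaces and a covering lemma\<close>

text \<open>The exponent Q is critical: a jump across an edge at level n, divided by a radius of
  order 2^(-n) and raised to the power Q, is integrated over a ball of measure of order 2^(-nQ). The
  powers of 2 cancel, so the energy of a level is a plain sum over edges. Weak summability makes
  such sums grow logarithmically and gives no bound uniform in n; a subsequence is enough because
  the discretizations converge to \<open>f\<close> in L1 and Fatou's lemma asks only for a bounded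
  subsequence. \<open>Lip\<close> does not pass to an L1 limit, whereas the mean oscillation over a
  fixed ball does. The sharp function, a supremum of such oscillations, is therefore lower
  semicontinuous, and it also yields the Hajlasz inequality by chaining averages. A weak-type bound
  would only place the gradient in weak L^Q, so the endpoint cannot be avoided. The passage from
  balls to measures, both for level sets of the sharp function and for porous points, goes through
  one covering lemma. The values of \<open>f\<close> are recovered from almost everywhere
  convergence of the discretizations along a further subsequence.\<close>

lemma finite_disjoint_subfamily_balls:
  fixes z :: "'i \<Rightarrow> 'a::metric_space" and r :: "'i \<Rightarrow> real"
  assumes "finite I"
  shows "\<exists>J\<subseteq>I. disjoint_family_on (\<lambda>i. ball (z i) (r i)) J \<and>
           (\<Union>i\<in>I. ball (z i) (r i)) \<subseteq> (\<Union>i\<in>J. ball (z i) (3 * r i))"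
  using assms
proof (induction "card I" arbitrary: I rule: less_induct)
  case less
  show ?case
  proof (cases "I = {}")
    case True
    then show ?thesis by (auto simp: disjoint_family_on_def)
  next
    case False
    have "finite (r ` I)" "r ` I \<noteq> {}" using less.prems False by auto
    then have "Max (r ` I) \<in> r ` I" by (rule Max_in)
    then obtain m where m': "m \<in> I" "r m = Max (r ` I)" by auto
    then have m: "m \<in> I" "\<And>i. i \<in> I \<Longrightarrow> r i \<le> r m" using less.prems by auto
    \<comment> \<open>Greedy choice: a ball that meets the largest one lies in its triple, and the
      induction continues with the balls that miss it. \<open>m\<close> is removed explicitly
      because a ball of non-positive radius is empty and misses itself.\<close>
    define I' where "I' = {i\<in>I. ball (z i) (r i) \<inter> ball (z m) (r m) = {}} - {m}"
    have "card I' < card I"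
      by (rule psubset_card_mono) (use less.prems m in \<open>auto simp: I'_def\<close>)
    moreover have "finite I'" using less.prems by (auto simp: I'_def)
    ultimately obtain J where J: "J \<subseteq> I'" "disjoint_family_on (\<lambda>i. ball (z i) (r i)) J"
      "(\<Union>i\<in>I'. ball (z i) (r i)) \<subseteq> (\<Union>i\<in>J. ball (z i) (3 * r i))"
      using less.hyps by blast
    show ?thesis
    proof (intro exI[of _ "insert m J"] conjI)
      show "insert m J \<subseteq> I" using J(1) m by (auto simp: I'_def)
      show "disjoint_family_on (\<lambda>i. ball (z i) (r i)) (insert m J)"
        using J(1,2) unfolding disjoint_family_on_def I'_def by blast
      show "(\<Union>i\<in>I. ball (z i) (r i)) \<subseteq> (\<Union>i\<in>insert m J. ball (z i) (3 * r i))"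
      proof
        fix x assume "x \<in> (\<Union>i\<in>I. ball (z i) (r i))"
        then obtain i where i: "i \<in> I" "dist (z i) x < r i" by auto
        show "x \<in> (\<Union>i\<in>insert m J. ball (z i) (3 * r i))"
        proof (cases "i \<in> I'")
          case True
          then have "x \<in> (\<Union>i\<in>I'. ball (z i) (r i))" using i by auto
          then show ?thesis using J(3) by blast
        next
          case False
          have "dist (z m) x < 3 * r m"
          proof (cases "i = m")
            case True
            then have "dist (z m) x < r m" using i(2) by simp
            with zero_le_dist[of "z m" x] have "dist (z m) x < 3 * r m" by linarith
            then show ?thesis .
          next
            case neq: False
            then obtain y where y: "dist (z i) y < r i" "dist (z m) y < r m"
              using False i by (auto simp: I'_def)
            have "dist (z m) x \<le> dist (z m) y + dist (z i) y + dist (z i) x"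
              by (smt (verit) dist_commute dist_triangle)
            then show ?thesis using y i m(2)[OF i(1)] by linarith
          qed
          then show ?thesis by auto
        qed
      qed
    qed
  qed
qed

text \<open>A non-integrable function has integral 0 by default, so the comparison persists when
  only the majorant is known to be integrable. This is the situation for powers of
  \<open>Lip\<close>.\<close>

lemma integral_mono_AE_nonneg:
  fixes f g :: "'a \<Rightarrow> real"
  assumes "integrable M g" "AE x in M. f x \<le> g x" "AE x in M. 0 \<le> g x"
  shows "(LINT x|M. f x) \<le> (LINT x|M. g x)"
proof (cases "integrable M f")
  case True
  then show ?thesis using assms by (intro integral_mono_AE)
next
  case False
  then show ?thesis using assms by (simp add: not_integrable_integral_eq integral_nonneg_AE)
qed

text \<open>One constant \<open>K\<close> replaces both Ahlfors constants. The lower bound reaches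
  radius 2 because the whole space is a ball of radius 2 = 2 * (1/2)^0 about any point, so the root
  fits the scale of the other vertices. The upper bound for all radii allows balls to be enlarged in
  coverings.\<close>

locale ahlfors = finite_measure \<mu> for \<mu> :: "'a::metric_space measure" +
  fixes Q K :: real
  assumes Q: "Q > 1" and K: "K \<ge> 1"
    and cpt: "compact (UNIV :: 'a set)"
    and sets_mu [measurable_cong]: "sets \<mu> = sets borel"
    and dist_le: "\<And>x y :: 'a. dist x y \<le> 1"
    and lower: "\<And>z r. 0 < r \<Longrightarrow> r \<le> 2 \<Longrightarrow> r powr Q \<le> K * measure \<mu> (ball z r)"
    and upper: "\<And>z r. 0 < r \<Longrightarrow> measure \<mu> (ball z r) \<le> K * r powr Q"
begin

lemma space_mu [simp]: "space \<mu> = UNIV"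
  using sets_eq_imp_space_eq[OF sets_mu] by simp

lemma ball_meas [measurable, simp]: "ball z r \<in> sets \<mu>"
  by (simp add: sets_mu)

lemma open_meas: "open S \<Longrightarrow> S \<in> sets \<mu>"
  by (simp add: sets_mu)

lemma closed_meas: "closed S \<Longrightarrow> S \<in> sets \<mu>"
  by (simp add: sets_mu)

lemma ball_pos: "0 < r \<Longrightarrow> 0 < measure \<mu> (ball z r)"
proof -
  assume r: "0 < r"
  have "0 < (min r 2) powr Q" using r by simp
  also have "\<dots> \<le> K * measure \<mu> (ball z (min r 2))" using r by (intro lower) auto
  also have "\<dots> \<le> K * measure \<mu> (ball z r)"
    using K by (intro mult_left_mono finite_measure_mono) auto
  finally show ?thesis using K by (simp add: zero_less_mult_iff)
qed

lemma sint: "integrable \<mu> f \<Longrightarrow> A \<in> sets \<mu> \<Longrightarrow> set_integrable \<mu> A (f :: 'a \<Rightarrow> real)"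
  unfolding set_integrable_def by (intro integrable_mult_indicator)

text \<open>The union is open and is exhausted by the compact sets \<open>F n\<close>, each covered
  by finitely many balls. The disjoint selection is made among the \<open>\<Lambda>\<close>-fold
  balls, on which the integrals live, so their sum is one integral; only the radius of the covering
  balls pays for the enlargement.\<close>

lemma measure_covering:
  assumes \<B>: "\<And>z r. (z, r) \<in> \<B> \<Longrightarrow> 0 < r \<and> r powr Q \<le> (LINT x:ball z (\<Lambda> * r)|\<mu>. \<phi> x)"
    and L: "\<Lambda> \<ge> 1" and phi: "integrable \<mu> \<phi>" "\<And>x. 0 \<le> \<phi> x"
  shows "measure \<mu> (\<Union>(z, r)\<in>\<B>. ball z r) \<le> K * (3 * \<Lambda>) powr Q * (LINT x|\<mu>. \<phi> x)"
proof -
  define U where "U = (\<Union>(z, r)\<in>\<B>. ball z r)"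
  have oU: "open U" unfolding U_def by auto
  define F where "F = (\<lambda>n. \<Inter>y\<in>-U. {x. inverse (real (Suc n)) \<le> dist x y})"
  have clF: "closed (F n)" for n unfolding F_def
    by (intro closed_INT ballI closed_Collect_le continuous_intros)
  have inc: "incseq F" unfolding F_def
  proof (rule incseq_SucI, clarsimp)
    fix n x y
    assume "\<forall>y\<in>- U. inverse (1 + real n) \<le> dist x y" "y \<notin> U"
    then have "inverse (1 + real n) \<le> dist x y" by auto
    moreover have "inverse (2 + real n) \<le> inverse (1 + real n)" by (simp add: field_simps)
    ultimately show "inverse (2 + real n) \<le> dist x y" by linarith
  qed
  have UF: "(\<Union>n. F n) = U"
  proof
    show "(\<Union>n. F n) \<subseteq> U"
    proof
      fix x assume "x \<in> (\<Union>n. F n)"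
      then obtain n where n: "\<And>y. y \<notin> U \<Longrightarrow> inverse (real (Suc n)) \<le> dist x y" by (auto simp: F_def)
      show "x \<in> U" using n[of x] by (rule_tac ccontr) (simp del: of_nat_Suc)
    qed
    show "U \<subseteq> (\<Union>n. F n)"
    proof
      fix x assume "x \<in> U"
      then obtain e where e: "e > 0" "ball x e \<subseteq> U" using oU open_contains_ball by blast
      obtain n where n: "inverse (real (Suc n)) < e" using reals_Archimedean e by blast
      have "x \<in> F n" unfolding F_def
      proof (clarsimp simp del: of_nat_Suc)
        fix y assume "y \<notin> U"
        then have "y \<notin> ball x e" using e by blast
        then show "inverse (real (Suc n)) \<le> dist x y" using n by (simp del: of_nat_Suc)
      qed
      then show "x \<in> (\<Union>n. F n)" by blast
    qed
  qed
  have lim: "(\<lambda>n. measure \<mu> (F n)) \<longlonglongrightarrow> measure \<mu> U"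
    using finite_Lim_measure_incseq[of F] inc UF closed_meas[OF clF] by auto
  have "measure \<mu> (F n) \<le> K * (3 * \<Lambda>) powr Q * (LINT x|\<mu>. \<phi> x)" for n
  proof -
    have cF: "compact (F n)" using cpt clF[of n] closed_Int_compact[of "F n" UNIV] by simp
    have FB: "F n \<subseteq> (\<Union>p\<in>\<B>. ball (fst p) (snd p))"
    proof -
      have "F n \<subseteq> U" using UF by blast
      also have "U = (\<Union>p\<in>\<B>. ball (fst p) (snd p))" unfolding U_def by (simp add: split_beta)
      finally show ?thesis .
    qed
    obtain I where I: "I \<subseteq> \<B>" "finite I" "F n \<subseteq> (\<Union>p\<in>I. ball (fst p) (snd p))"
      by (rule compactE_image[OF cF _ FB]) auto
    have FI: "F n \<subseteq> (\<Union>p\<in>I. ball (fst p) (\<Lambda> * snd p))"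
    proof
      fix x assume "x \<in> F n"
      then obtain p where p: "p \<in> I" "dist (fst p) x < snd p" using I by auto
      then have "0 < snd p" using \<B>[of "fst p" "snd p"] I by auto
      then have "snd p \<le> \<Lambda> * snd p" using L by simp
      then have "x \<in> ball (fst p) (\<Lambda> * snd p)" using p(2) by simp
      then show "x \<in> (\<Union>p\<in>I. ball (fst p) (\<Lambda> * snd p))" using p(1) by blast
    qed
    obtain J where J: "J \<subseteq> I" "disjoint_family_on (\<lambda>p. ball (fst p) (\<Lambda> * snd p)) J"
      "(\<Union>p\<in>I. ball (fst p) (\<Lambda> * snd p)) \<subseteq> (\<Union>p\<in>J. ball (fst p) (3 * (\<Lambda> * snd p)))"
      using finite_disjoint_subfamily_balls[OF I(2), of fst "\<lambda>p. \<Lambda> * snd p"] by blast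
    have fJ: "finite J" using J I finite_subset by blast
    have Jpos: "0 < snd p" "(snd p) powr Q \<le> (LINT x:ball (fst p) (\<Lambda> * snd p)|\<mu>. \<phi> x)" if "p \<in> J" for p
      using \<B>[of "fst p" "snd p"] that J I by auto
    have "measure \<mu> (F n) \<le> measure \<mu> (\<Union>p\<in>J. ball (fst p) (3 * (\<Lambda> * snd p)))"
      using FI J(3) by (intro finite_measure_mono open_meas) auto
    also have "\<dots> \<le> (\<Sum>p\<in>J. measure \<mu> (ball (fst p) (3 * (\<Lambda> * snd p))))"
      by (intro finite_measure_subadditive_finite fJ) auto
    also have "\<dots> \<le> (\<Sum>p\<in>J. K * (3 * \<Lambda>) powr Q * (LINT x:ball (fst p) (\<Lambda> * snd p)|\<mu>. \<phi> x))"
    proof (rule sum_mono)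
      fix p assume p: "p \<in> J"
      have "measure \<mu> (ball (fst p) (3 * (\<Lambda> * snd p))) \<le> K * (3 * (\<Lambda> * snd p)) powr Q"
        using Jpos[OF p] L by (intro upper) auto
      also have "\<dots> = K * (3 * \<Lambda>) powr Q * (snd p) powr Q"
        using Jpos[OF p] L by (simp add: powr_mult)
      also have "\<dots> \<le> K * (3 * \<Lambda>) powr Q * (LINT x:ball (fst p) (\<Lambda> * snd p)|\<mu>. \<phi> x)"
        using Jpos[OF p] K by (intro mult_left_mono) auto
      finally show "measure \<mu> (ball (fst p) (3 * (\<Lambda> * snd p))) \<le> \<dots>" .
    qed
    also have "\<dots> = K * (3 * \<Lambda>) powr Q * (\<Sum>p\<in>J. (LINT x:ball (fst p) (\<Lambda> * snd p)|\<mu>. \<phi> x))"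
      by (simp add: sum_distrib_left)
    also have "(\<Sum>p\<in>J. (LINT x:ball (fst p) (\<Lambda> * snd p)|\<mu>. \<phi> x)) =
        (LINT x:(\<Union>p\<in>J. ball (fst p) (\<Lambda> * snd p))|\<mu>. \<phi> x)"
      using J(2) by (intro set_integral_finite_Union[symmetric] fJ sint phi) auto
    also have "\<dots> \<le> (LINT x|\<mu>. \<phi> x)"
      unfolding set_lebesgue_integral_def using phi
      by (intro integral_mono_AE_nonneg) (auto intro!: AE_I2 split: split_indicator)
    finally show ?thesis using K by (simp add: mult_left_mono)
  qed
  then show ?thesis using LIMSEQ_le_const2[OF lim] unfolding U_def[symmetric] by blast
qed

end

section \<open>Mean oscillation and the sharp maximal function\<close>

context ahlfors
begin

abbreviation avg :: "'a \<Rightarrow> real \<Rightarrow> ('a \<Rightarrow> real) \<Rightarrow> real" where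
  "avg z r f \<equiv> average \<mu> (ball z r) f"

definition mean_osc :: "('a \<Rightarrow> real) \<Rightarrow> 'a \<Rightarrow> real \<Rightarrow> real" where
  "mean_osc f z r = avg z r (\<lambda>x. \<bar>f x - avg z r f\<bar>)"

lemma avg_mono:
  assumes "integrable \<mu> f" "integrable \<mu> g" "\<And>x. x \<in> ball z r \<Longrightarrow> f x \<le> g x"
  shows "avg z r f \<le> avg z r g"
  unfolding average_def using assms
  by (intro divide_right_mono set_integral_mono sint) auto

lemma avg_mono_AE:
  assumes "integrable \<mu> f" "integrable \<mu> g" "AE x in \<mu>. x \<in> ball z r \<longrightarrow> f x \<le> g x"
  shows "avg z r f \<le> avg z r g"
  unfolding average_def using assms
  by (intro divide_right_mono set_integral_mono_AE sint) auto

lemma avg_add: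
  "integrable \<mu> f \<Longrightarrow> integrable \<mu> g \<Longrightarrow> avg z r (\<lambda>x. f x + g x) = avg z r f + avg z r g"
  unfolding average_def by (subst set_integral_add(2)) (auto intro!: sint simp: add_divide_distrib)

lemma avg_diff:
  "integrable \<mu> f \<Longrightarrow> integrable \<mu> g \<Longrightarrow> avg z r (\<lambda>x. f x - g x) = avg z r f - avg z r g"
  unfolding average_def by (subst set_integral_diff(2)) (auto intro!: sint simp: diff_divide_distrib)

lemma avg_cmult: "avg z r (\<lambda>x. a * f x) = a * avg z r f"
  unfolding average_def by simp

lemma avg_const: "0 < r \<Longrightarrow> avg z r (\<lambda>x. a) = a"
  unfolding average_def using ball_pos[of r z]
  by (simp add: set_lebesgue_integral_def)

lemma avg_nonneg: "(\<And>x. x \<in> ball z r \<Longrightarrow> 0 \<le> f x) \<Longrightarrow> 0 \<le> avg z r f"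
  unfolding average_def set_lebesgue_integral_def
  by (auto intro!: divide_nonneg_nonneg integral_nonneg_AE AE_I2 simp: indicator_def)

lemma avg_abs: "integrable \<mu> f \<Longrightarrow> \<bar>avg z r f\<bar> \<le> avg z r (\<lambda>x. \<bar>f x\<bar>)"
  using avg_mono[of f "\<lambda>x. \<bar>f x\<bar>" z r] avg_mono[of "\<lambda>x. - f x" "\<lambda>x. \<bar>f x\<bar>" z r] avg_cmult[of z r "-1" f]
  by (simp add: abs_le_iff)

lemma avg_diff_const:
  assumes "integrable \<mu> f" "0 < r" shows "\<bar>avg z r f - a\<bar> \<le> avg z r (\<lambda>x. \<bar>f x - a\<bar>)"
proof -
  have "avg z r f - a = avg z r (\<lambda>x. f x - a)" using assms by (subst avg_diff) (auto simp: avg_const)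
  then show ?thesis using assms by (simp add: avg_abs)
qed

lemma avg_mult_measure: "0 < r \<Longrightarrow> avg z r f * measure \<mu> (ball z r) = (LINT x:ball z r|\<mu>. f x)"
  unfolding average_def using ball_pos[of r z] by simp

lemma measure_ball_ratio:
  assumes "0 < r1" "r1 \<le> 2" "0 < r2" "r2 \<le> 4 * r1"
  shows "measure \<mu> (ball z2 r2) \<le> K\<^sup>2 * 4 powr Q * measure \<mu> (ball z1 r1)"
proof -
  have "measure \<mu> (ball z2 r2) \<le> K * r2 powr Q" using assms by (intro upper) auto
  also have "\<dots> \<le> K * (4 * r1) powr Q" using assms K Q by (intro mult_left_mono powr_mono2) auto
  also have "\<dots> = K * 4 powr Q * r1 powr Q" using assms by (simp add: powr_mult)
  also have "\<dots> \<le> K * 4 powr Q * (K * measure \<mu> (ball z1 r1))"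
    using assms K by (intro mult_left_mono lower) auto
  finally show ?thesis by (simp add: power2_eq_square ac_simps)
qed

lemma avg_subset:
  assumes f: "integrable \<mu> f" "\<And>x. 0 \<le> f x"
    and r: "0 < r1" "r1 \<le> 2" "0 < r2" "r2 \<le> 4 * r1" and sub: "ball z1 r1 \<subseteq> ball z2 r2"
  shows "avg z1 r1 f \<le> K\<^sup>2 * 4 powr Q * avg z2 r2 f"
proof -
  have p: "0 < measure \<mu> (ball z1 r1)" "0 < measure \<mu> (ball z2 r2)" using r ball_pos by auto
  have "(LINT x:ball z1 r1|\<mu>. f x) \<le> (LINT x:ball z2 r2|\<mu>. f x)"
    unfolding set_lebesgue_integral_def
    using integrable_mult_indicator[OF _ f(1)] sub f(2)
    by (intro integral_mono_AE_nonneg) (auto intro!: AE_I2 split: split_indicator)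
  then have "avg z1 r1 f \<le> (LINT x:ball z2 r2|\<mu>. f x) / measure \<mu> (ball z1 r1)"
    unfolding average_def using p by (intro divide_right_mono) auto
  also have "\<dots> = avg z2 r2 f * (measure \<mu> (ball z2 r2) / measure \<mu> (ball z1 r1))"
    unfolding average_def using p by simp
  also have "\<dots> \<le> avg z2 r2 f * (K\<^sup>2 * 4 powr Q)"
    using measure_ball_ratio[OF r, of z2 z1] p f avg_nonneg[of z2 r2 f]
    by (intro mult_left_mono) (auto simp: field_simps)
  finally show ?thesis by (simp add: ac_simps)
qed

lemma mean_osc_le:
  assumes f: "integrable \<mu> f" "0 < r"
  shows "mean_osc f z r \<le> 2 * avg z r (\<lambda>x. \<bar>f x - a\<bar>)"
proof -
  have "mean_osc f z r \<le> avg z r (\<lambda>x. \<bar>f x - a\<bar> + \<bar>avg z r f - a\<bar>)"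
    unfolding mean_osc_def using f by (intro avg_mono) auto
  also have "\<dots> = avg z r (\<lambda>x. \<bar>f x - a\<bar>) + \<bar>avg z r f - a\<bar>"
    using f by (subst avg_add) (auto simp: avg_const)
  also have "\<dots> \<le> 2 * avg z r (\<lambda>x. \<bar>f x - a\<bar>)"
    using avg_diff_const[OF f, of z a] by simp
  finally show ?thesis .
qed

lemma mean_osc_diff_le:
  assumes f: "integrable \<mu> f" "integrable \<mu> g" "0 < r"
  shows "mean_osc f z r \<le> mean_osc g z r + 2 * avg z r (\<lambda>x. \<bar>f x - g x\<bar>)"
proof -
  have "mean_osc f z r \<le> avg z r (\<lambda>x. \<bar>g x - avg z r g\<bar> + (\<bar>f x - g x\<bar> + \<bar>avg z r f - avg z r g\<bar>))"
    unfolding mean_osc_def using f by (intro avg_mono) auto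
  also have "\<dots> = mean_osc g z r + (avg z r (\<lambda>x. \<bar>f x - g x\<bar>) + \<bar>avg z r f - avg z r g\<bar>)"
    unfolding mean_osc_def using f by (simp add: avg_add avg_const)
  also have "\<bar>avg z r f - avg z r g\<bar> \<le> avg z r (\<lambda>x. \<bar>f x - g x\<bar>)"
    using f avg_abs[of "\<lambda>x. f x - g x" z r] by (simp add: avg_diff)
  finally show ?thesis by simp
qed

text \<open>The supremum runs over all balls containing \<open>x\<close>, centred or not, which
  makes the superlevel sets open. Values are extended reals because the function is also applied to
  an integrable \<open>f\<close>, where it may be infinite.\<close>

definition sharp :: "('a \<Rightarrow> real) \<Rightarrow> 'a \<Rightarrow> ennreal" where
  "sharp f x = (SUP (z, r)\<in>{(z, r). 0 < r \<and> r \<le> 2 \<and> x \<in> ball z r}. ennreal (mean_osc f z r / r))"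

lemma sharp_upper: "x \<in> ball z r \<Longrightarrow> 0 < r \<Longrightarrow> r \<le> 2 \<Longrightarrow> ennreal (mean_osc f z r / r) \<le> sharp f x"
  unfolding sharp_def by (rule SUP_upper2[of "(z, r)"]) auto

lemma sharp_gt:
  assumes "t < sharp f x"
  obtains z r where "x \<in> ball z r" "0 < r" "r \<le> 2" "t < ennreal (mean_osc f z r / r)"
  using assms unfolding sharp_def less_SUP_iff by auto

lemma sharp_le: "(\<And>z r. x \<in> ball z r \<Longrightarrow> 0 < r \<Longrightarrow> r \<le> 2 \<Longrightarrow> ennreal (mean_osc f z r / r) \<le> t) \<Longrightarrow> sharp f x \<le> t"
  unfolding sharp_def by (rule SUP_least) auto

lemma open_sharp_gt: "open {x. t < sharp f x}"
proof -
  have "{x. t < sharp f x} = (\<Union>(z, r)\<in>{(z, r). 0 < r \<and> r \<le> 2 \<and> t < ennreal (mean_osc f z r / r)}. ball z r)"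
  proof (intro set_eqI iffI; clarsimp)
    fix x assume "t < sharp f x"
    then show "\<exists>z r. 0 < r \<and> r \<le> 2 \<and> t < ennreal (mean_osc f z r / r) \<and> dist z x < r"
      by (elim sharp_gt) auto
  next
    fix x z r assume "0 < r" "r \<le> 2" "t < ennreal (mean_osc f z r / r)" "dist z x < r"
    then show "t < sharp f x" using sharp_upper[of x z r f] by auto
  qed
  then show ?thesis by auto
qed

lemma sharp_measurable [measurable]: "sharp f \<in> borel_measurable \<mu>"
  by (rule borel_measurableI_greater) (use open_sharp_gt in \<open>auto simp: open_meas\<close>)

text \<open>The value \<open>top\<close> is sent to 0, so estimates that bound something by
  \<open>rsharp f x\<close> rest on \<open>sharp f x < top\<close>.\<close>

abbreviation rsharp :: "('a \<Rightarrow> real) \<Rightarrow> 'a \<Rightarrow> real" where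
  "rsharp f x \<equiv> enn2real (sharp f x)"

lemma mean_osc_le_rsharp:
  assumes "sharp f x < top" "x \<in> ball z r" "0 < r" "r \<le> 2"
  shows "mean_osc f z r \<le> r * rsharp f x"
proof -
  have "ennreal (mean_osc f z r / r) \<le> ennreal (rsharp f x)"
    using sharp_upper[OF assms(2-4), of f] assms(1) by simp
  then have "mean_osc f z r / r \<le> rsharp f x" by (subst (asm) ennreal_le_iff) auto
  then show ?thesis using assms(3) by (simp add: field_simps)
qed

section \<open>The Hajlasz inequality from the sharp function\<close>

definition H0 :: real where "H0 = K\<^sup>2 * 4 powr Q"

lemma H0_ge1: "1 \<le> H0"
proof -
  have "1 \<le> K\<^sup>2" using K by simp
  moreover have "1 \<le> 4 powr Q" using Q by (simp add: ge_one_powr_ge_zero)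
  ultimately show ?thesis unfolding H0_def using mult_mono[of 1 "K\<^sup>2" 1 "4 powr Q"] by simp
qed

lemma avg_nested:
  assumes f: "integrable \<mu> f" and r: "0 < r1" "r1 \<le> r2" "r2 \<le> 2" "r2 \<le> 4 * r1"
    and sub: "ball z1 r1 \<subseteq> ball z2 r2" and x: "x \<in> ball z2 r2" "sharp f x < top"
  shows "\<bar>avg z1 r1 f - avg z2 r2 f\<bar> \<le> H0 * r2 * rsharp f x"
proof -
  have "\<bar>avg z1 r1 f - avg z2 r2 f\<bar> \<le> avg z1 r1 (\<lambda>x. \<bar>f x - avg z2 r2 f\<bar>)"
    using f r by (intro avg_diff_const)
  also have "\<dots> \<le> H0 * mean_osc f z2 r2" unfolding mean_osc_def H0_def
    using f r sub by (intro avg_subset) auto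
  also have "\<dots> \<le> H0 * (r2 * rsharp f x)"
    using x r H0_ge1 by (intro mult_left_mono mean_osc_le_rsharp) auto
  finally show ?thesis by simp
qed

text \<open>Consecutive averages differ by at most the radius times the sharp function. Writing each
  term of this geometric series as a difference of powers makes the bound telescope along with the
  averages.\<close>

lemma avg_dyadic_chain:
  assumes f: "integrable \<mu> f" and x: "sharp f x < top" and kl: "k \<le> l"
  shows "\<bar>avg x (2 * (1/2)^k) f - avg x (2 * (1/2)^l) f\<bar> \<le> 4 * H0 * rsharp f x * ((1/2)^k - (1/2)^l)"
  using kl
proof (induction l rule: dec_induct)
  case base
  then show ?case by simp
next
  case (step l)
  have "(1/2::real)^l \<le> 1" by (simp add: power_le_one)
  then have "\<bar>avg x (2 * (1/2)^Suc l) f - avg x (2 * (1/2)^l) f\<bar> \<le> H0 * (2 * (1/2)^l) * rsharp f x"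
    by (intro avg_nested f x subset_ball) auto
  also have "\<dots> = 4 * H0 * rsharp f x * ((1/2)^l - (1/2)^Suc l)" by (simp add: algebra_simps)
  finally show ?case using step.IH by (simp add: algebra_simps)
qed

text \<open>Convergence is requested along a sequence of scales \<open>\<sigma>\<close> only, since
  for an integrable function it will be available only there; the chain controls all intermediate
  scales.\<close>

lemma avg_dyadic_limit:
  assumes f: "integrable \<mu> f" and x: "sharp f x < top"
    and lim: "(\<lambda>j. avg x (2 * (1/2)^(\<sigma> j)) f) \<longlonglongrightarrow> y" "filterlim \<sigma> at_top sequentially"
  shows "\<bar>avg x (2 * (1/2)^k) f - y\<bar> \<le> 4 * H0 * rsharp f x * (1/2)^k"
proof (rule LIMSEQ_le_const2)
  show "(\<lambda>j. \<bar>avg x (2 * (1/2)^k) f - avg x (2 * (1/2)^(\<sigma> j)) f\<bar>) \<longlonglongrightarrow> \<bar>avg x (2 * (1/2)^k) f - y\<bar>"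
    by (intro tendsto_intros lim)
  have "\<forall>\<^sub>F j in sequentially. k \<le> \<sigma> j" using lim(2) by (auto simp: filterlim_at_top)
  then have "\<forall>\<^sub>F j in sequentially. \<bar>avg x (2 * (1/2)^k) f - avg x (2 * (1/2)^(\<sigma> j)) f\<bar>
      \<le> 4 * H0 * rsharp f x * (1/2)^k"
  proof eventually_elim
    case (elim j)
    have "4 * H0 * rsharp f x * ((1/2)^k - (1/2)^\<sigma> j) \<le> 4 * H0 * rsharp f x * (1/2)^k"
      using H0_ge1 by (intro mult_left_mono) auto
    then show ?case using avg_dyadic_chain[OF f x elim] by linarith
  qed
  then show "\<exists>N. \<forall>n\<ge>N. \<bar>avg x (2 * (1/2)^k) f - avg x (2 * (1/2)^(\<sigma> n)) f\<bar>
      \<le> 4 * H0 * rsharp f x * (1/2)^k"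
    by (simp add: eventually_sequentially)
qed

definition H :: real where "H = 16 * H0"

lemma H_ge1: "1 \<le> H" using H0_ge1 unfolding H_def by simp

text \<open>The chains of averages at \<open>x\<close> and \<open>y\<close> are linked at a scale
  comparable with the distance of the two points. In \<open>H\<close> the factor 16 is 8, which
  rounds up the 6 collected along the chains, times 2 for the comparison of scales.\<close>

lemma rsharp_hajlasz:
  assumes f: "integrable \<mu> f" and x: "sharp f x < top" and y: "sharp f y < top"
    and limx: "(\<lambda>j. avg x (2 * (1/2)^(\<sigma> j)) f) \<longlonglongrightarrow> f x"
    and limy: "(\<lambda>j. avg y (2 * (1/2)^(\<sigma> j)) f) \<longlonglongrightarrow> f y"
    and \<sigma>: "filterlim \<sigma> at_top sequentially"
  shows "\<bar>f x - f y\<bar> \<le> H * dist x y * (rsharp f x + rsharp f y)"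
proof (cases "x = y")
  case True
  then show ?thesis by simp
next
  case False
  then have d: "0 < dist x y" "dist x y \<le> 1" using dist_le by auto
  obtain n where n: "(1/2::real)^n < dist x y"
    using real_arch_pow_inv[of "dist x y" "1/2"] d by auto
  \<comment> \<open>The least exponent is positive because \<open>dist x y \<le> 1\<close>. Its
    predecessor \<open>k\<close> satisfies (1/2)^(k+1) < dist x y \<le> (1/2)^k, so the ball of
    radius (1/2)^k about \<open>y\<close> lies in the ball of twice that radius about
    \<open>x\<close>.\<close>
  define k where "k = (LEAST n. (1/2::real)^n < dist x y) - 1"
  have k1: "(1/2::real)^(LEAST n. (1/2::real)^n < dist x y) < dist x y" by (rule LeastI) (rule n)
  then have "(LEAST n. (1/2::real)^n < dist x y) \<noteq> 0" using d by (intro notI) simp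
  then have k2: "(LEAST n. (1/2::real)^n < dist x y) = Suc k" unfolding k_def by simp
  then have k3: "dist x y \<le> (1/2)^k" using not_less_Least[of k "\<lambda>n. (1/2::real)^n < dist x y"] by simp
  have k4: "(1/2)^k < 2 * dist x y" using k1 k2 by simp
  have k5: "(1/2::real)^k \<le> 1" by (simp add: power_le_one)
  have "ball y (2 * (1/2)^Suc k) \<subseteq> ball x (2 * (1/2)^k)"
  proof
    fix w assume "w \<in> ball y (2 * (1/2)^Suc k)"
    then have "dist y w < (1/2)^k" by simp
    then show "w \<in> ball x (2 * (1/2)^k)" using k3 dist_triangle[of x w y] by simp
  qed
  then have 1: "\<bar>avg y (2 * (1/2)^Suc k) f - avg x (2 * (1/2)^k) f\<bar> \<le> H0 * (2 * (1/2)^k) * rsharp f x"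
    using k5 by (intro avg_nested f x) auto
  have 2: "\<bar>avg x (2 * (1/2)^k) f - f x\<bar> \<le> 4 * H0 * rsharp f x * (1/2)^k"
    by (rule avg_dyadic_limit[OF f x limx \<sigma>])
  have 3: "\<bar>avg y (2 * (1/2)^Suc k) f - f y\<bar> \<le> 4 * H0 * rsharp f y * (1/2)^Suc k"
    by (rule avg_dyadic_limit[OF f y limy \<sigma>])
  have "\<bar>f x - f y\<bar> \<le> H0 * (1/2)^k * (6 * rsharp f x + 2 * rsharp f y)"
    using 1 2 3 by (simp add: algebra_simps)
  also have "\<dots> \<le> H0 * (2 * dist x y) * (8 * (rsharp f x + rsharp f y))"
    using H0_ge1 k4 by (intro mult_mono mult_left_mono) auto
  finally show ?thesis unfolding H_def by (simp add: algebra_simps)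
qed

end

section \<open>Pointwise Lipschitz constants\<close>

lemma lipschitz_on_abs_real:
  fixes f :: "'a::metric_space \<Rightarrow> real"
  assumes "L-lipschitz_on UNIV f" shows "\<bar>f x - f y\<bar> \<le> L * dist x y"
  using lipschitz_onD[OF assms, of x y] by (simp add: dist_real_def)

lemma lipschitz_onI_abs_real:
  fixes f :: "'a::metric_space \<Rightarrow> real"
  assumes "\<And>x y. \<bar>f x - f y\<bar> \<le> L * dist x y" "0 \<le> L" shows "L-lipschitz_on UNIV f"
  using assms by (intro lipschitz_onI) (auto simp: dist_real_def)

lemma mcshane_extension:
  fixes f :: "'a::metric_space \<Rightarrow> real"
  assumes M: "0 \<le> M" and f: "\<And>x y. x \<in> G \<Longrightarrow> y \<in> G \<Longrightarrow> \<bar>f x - f y\<bar> \<le> M * dist x y"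
  shows "\<exists>v. M-lipschitz_on UNIV v \<and> (\<forall>x\<in>G. v x = f x)"
proof (cases "G = {}")
  case True
  then show ?thesis using M by (auto intro!: exI[of _ "\<lambda>x. 0"] lipschitz_onI)
next
  case False
  then obtain y0 where y0: "y0 \<in> G" by auto
  define v where "v = (\<lambda>x. INF y\<in>G. f y + M * dist x y)"
  have bdd: "bdd_below ((\<lambda>y. f y + M * dist x y) ` G)" for x
  proof (rule bdd_belowI2)
    fix y assume "y \<in> G"
    have "M * dist y0 y \<le> M * (dist x y0 + dist x y)"
      using M by (intro mult_left_mono) (metis dist_commute dist_triangle, simp)
    then show "f y0 - M * dist x y0 \<le> f y + M * dist x y"
      using f[OF y0 \<open>y \<in> G\<close>] by (simp add: algebra_simps)
  qed
  have le: "v x \<le> v x' + M * dist x x'" for x x'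
  proof -
    have "v x - M * dist x x' \<le> v x'" unfolding v_def
    proof (rule cINF_greatest[OF False])
      fix y assume y: "y \<in> G"
      have "(INF y\<in>G. f y + M * dist x y) \<le> f y + M * dist x y" by (rule cINF_lower[OF bdd y])
      also have "\<dots> \<le> f y + M * (dist x x' + dist x' y)"
        using M by (intro add_left_mono mult_left_mono dist_triangle) auto
      finally show "(INF y\<in>G. f y + M * dist x y) - M * dist x x' \<le> f y + M * dist x' y"
        by (simp add: algebra_simps)
    qed
    then show ?thesis by simp
  qed
  have "M-lipschitz_on UNIV v"
  proof (intro lipschitz_onI_abs_real M)
    show "\<bar>v x - v y\<bar> \<le> M * dist x y" for x y
      using le[of x y] le[of y x] by (simp add: abs_le_iff dist_commute)
  qed
  moreover have "v x = f x" if x: "x \<in> G" for x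
  proof (rule antisym)
    show "v x \<le> f x" unfolding v_def using cINF_lower[OF bdd x, of x] by simp
    show "f x \<le> v x" unfolding v_def
      using f[OF x] by (intro cINF_greatest[OF False]) (fastforce simp: abs_le_iff)
  qed
  ultimately show ?thesis by blast
qed

lemma Lip_nonneg: "0 \<le> Lip f x"
  unfolding Lip_def by simp

lemma Limsup_le_of_local_lipschitz:
  assumes "0 \<le> t" "0 < s" and f: "\<And>y. dist x y < s \<Longrightarrow> \<bar>f y - f x\<bar> \<le> t * dist x y"
  shows "Limsup (at_right 0) (\<lambda>r. SUP y\<in>ball x r. ennreal (\<bar>f y - f x\<bar> / r)) \<le> ennreal t"
proof (rule Limsup_bounded)
  have "\<forall>\<^sub>F r in at_right 0. 0 < r \<and> r < s"
    unfolding eventually_at_right_field using assms by blast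
  then show "\<forall>\<^sub>F r in at_right 0. (SUP y\<in>ball x r. ennreal (\<bar>f y - f x\<bar> / r)) \<le> ennreal t"
  proof eventually_elim
    case (elim r)
    show ?case
    proof (rule SUP_least)
      fix y assume "y \<in> ball x r"
      then have "\<bar>f y - f x\<bar> \<le> t * dist x y" "dist x y \<le> r" using elim by (auto intro!: f)
      then have "\<bar>f y - f x\<bar> \<le> t * r" using assms(1) by (meson mult_left_mono order_trans)
      then show "ennreal (\<bar>f y - f x\<bar> / r) \<le> ennreal t" using elim by (intro ennreal_leI) (simp add: field_simps)
    qed
  qed
qed

lemma Lip_le:
  assumes "0 \<le> t" "0 < s" "\<And>y. dist x y < s \<Longrightarrow> \<bar>f y - f x\<bar> \<le> t * dist x y"
  shows "Lip f x \<le> t"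
  using enn2real_mono[OF Limsup_le_of_local_lipschitz[OF assms]] assms(1)
  unfolding Lip_def by simp

text \<open>The Lipschitz hypothesis makes the upper limit finite, so its conversion to a real
  number loses nothing and a strict bound on it becomes a local estimate.\<close>

lemma Lip_less:
  assumes f: "L-lipschitz_on UNIV f" and t: "Lip f x < t"
  shows "\<exists>s>0. \<forall>y. dist x y < s \<longrightarrow> \<bar>f y - f x\<bar> \<le> t * dist x y"
proof -
  let ?l = "Limsup (at_right 0) (\<lambda>r. SUP y\<in>ball x r. ennreal (\<bar>f y - f x\<bar> / r))"
  have "?l \<le> ennreal L"
    using lipschitz_on_nonneg[OF f] lipschitz_on_abs_real[OF f]
    by (intro Limsup_le_of_local_lipschitz[of _ 1]) (auto simp: dist_commute)
  then have fin: "?l < top" using ennreal_less_top order.strict_trans1 by blast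
  have t0: "0 < t" using t Lip_nonneg[of f x] by simp
  have "?l = ennreal (Lip f x)" unfolding Lip_def using fin by simp
  also have "\<dots> < ennreal t" using t Lip_nonneg[of f x] by (subst ennreal_less_iff) auto
  finally have "\<forall>\<^sub>F r in at_right 0. (SUP y\<in>ball x r. ennreal (\<bar>f y - f x\<bar> / r)) < ennreal t"
    by (rule Limsup_lessD)
  then obtain s where s: "s > 0"
    "\<And>r. 0 < r \<Longrightarrow> r < s \<Longrightarrow> (SUP y\<in>ball x r. ennreal (\<bar>f y - f x\<bar> / r)) < ennreal t"
    unfolding eventually_at_right_field by auto
  have "\<bar>f y - f x\<bar> \<le> t * dist x y" if y: "dist x y < s" for y
  proof -
    have "\<bar>f y - f x\<bar> / t \<le> dist x y"
    \<comment> \<open>The balls are open, so \<open>y\<close> lies only in balls of radius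
      \<open>r\<close> above \<open>dist x y\<close>; letting \<open>r\<close> decrease to the
      distance gives the estimate.\<close>
    proof (rule dense_ge_bounded[OF y])
      fix r assume r: "dist x y < r" "r < s"
      then have r0: "0 < r" using zero_le_dist[of x y] by linarith
      have "ennreal (\<bar>f y - f x\<bar> / r) \<le> (SUP y\<in>ball x r. ennreal (\<bar>f y - f x\<bar> / r))"
        using r by (intro SUP_upper) auto
      also have "\<dots> < ennreal t" using s r r0 by blast
      finally have "\<bar>f y - f x\<bar> / r < t" using t0 r0 by (simp add: ennreal_less_iff)
      then show "\<bar>f y - f x\<bar> / t \<le> r" using t0 r0 by (simp add: field_simps)
    qed
    then show ?thesis using t0 by (simp add: field_simps)
  qed
  then show ?thesis using s(1) by blast
qed

lemma Lip_le_lipschitz: "L-lipschitz_on UNIV f \<Longrightarrow> Lip f x \<le> L"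
  using lipschitz_on_abs_real[of L f] lipschitz_on_nonneg[of L UNIV f]
  by (intro Lip_le[of _ 1]) (auto simp: dist_commute)

lemma Lip_add_le:
  assumes f: "L-lipschitz_on UNIV f" and g: "M-lipschitz_on UNIV g"
  shows "Lip (\<lambda>x. f x + g x) x \<le> Lip f x + Lip g x"
proof (rule field_le_epsilon)
  fix e :: real assume e: "0 < e"
  obtain s1 where s1: "s1 > 0" "\<And>y. dist x y < s1 \<Longrightarrow> \<bar>f y - f x\<bar> \<le> (Lip f x + e/2) * dist x y"
    using Lip_less[OF f, of x "Lip f x + e/2"] e by auto
  obtain s2 where s2: "s2 > 0" "\<And>y. dist x y < s2 \<Longrightarrow> \<bar>g y - g x\<bar> \<le> (Lip g x + e/2) * dist x y"
    using Lip_less[OF g, of x "Lip g x + e/2"] e by auto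
  show "Lip (\<lambda>x. f x + g x) x \<le> Lip f x + Lip g x + e"
  proof (rule Lip_le[of _ "min s1 s2"])
    fix y assume "dist x y < min s1 s2"
    then have "\<bar>f y - f x\<bar> \<le> (Lip f x + e/2) * dist x y" "\<bar>g y - g x\<bar> \<le> (Lip g x + e/2) * dist x y"
      using s1 s2 by auto
    then have "\<bar>f y + g y - (f x + g x)\<bar> \<le> (Lip f x + e/2) * dist x y + (Lip g x + e/2) * dist x y" by linarith
    then show "\<bar>f y + g y - (f x + g x)\<bar> \<le> (Lip f x + Lip g x + e) * dist x y" by (simp add: algebra_simps)
  qed (use s1 s2 e Lip_nonneg[of f x] Lip_nonneg[of g x] in auto)
qed

lemma Lip_cmult_le:
  assumes f: "L-lipschitz_on UNIV f" and "0 < a"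
  shows "Lip (\<lambda>x. a * f x) x \<le> a * Lip f x"
proof (rule field_le_epsilon)
  fix e :: real assume e: "0 < e"
  obtain s1 where s1: "s1 > 0" "\<And>y. dist x y < s1 \<Longrightarrow> \<bar>f y - f x\<bar> \<le> (Lip f x + e/a) * dist x y"
    using Lip_less[OF f, of x "Lip f x + e/a"] e assms(2) by auto
  show "Lip (\<lambda>x. a * f x) x \<le> a * Lip f x + e"
  proof (rule Lip_le[OF _ s1(1)])
    fix y assume "dist x y < s1"
    then have "a * \<bar>f y - f x\<bar> \<le> a * ((Lip f x + e/a) * dist x y)" using s1 assms(2) by simp
    moreover have "a * f y - a * f x = a * (f y - f x)" by (simp add: algebra_simps)
    then have "\<bar>a * f y - a * f x\<bar> = a * \<bar>f y - f x\<bar>" using assms(2) by (simp add: abs_mult)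
    moreover have "a * ((Lip f x + e / a) * dist x y) = (a * Lip f x + e) * dist x y"
      using assms(2) by (simp add: field_simps)
    ultimately show "\<bar>a * f y - a * f x\<bar> \<le> (a * Lip f x + e) * dist x y" by simp
  qed (use e assms(2) Lip_nonneg[of f x] in auto)
qed

lemma lipschitz_on_sum:
  fixes v :: "'i \<Rightarrow> 'a::metric_space \<Rightarrow> real"
  assumes "\<And>i. i \<in> I \<Longrightarrow> (L i)-lipschitz_on UNIV (v i)"
  shows "(\<Sum>i\<in>I. L i)-lipschitz_on UNIV (\<lambda>x. \<Sum>i\<in>I. v i x)"
proof (rule lipschitz_onI_abs_real)
  fix x y
  have "\<bar>(\<Sum>i\<in>I. v i x) - (\<Sum>i\<in>I. v i y)\<bar> \<le> (\<Sum>i\<in>I. \<bar>v i x - v i y\<bar>)"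
    unfolding sum_subtractf[symmetric] by (rule sum_abs)
  also have "\<dots> \<le> (\<Sum>i\<in>I. L i * dist x y)" by (intro sum_mono lipschitz_on_abs_real assms)
  finally show "\<bar>(\<Sum>i\<in>I. v i x) - (\<Sum>i\<in>I. v i y)\<bar> \<le> (\<Sum>i\<in>I. L i) * dist x y" by (simp add: sum_distrib_right)
qed (use assms in \<open>auto intro: sum_nonneg lipschitz_on_nonneg\<close>)

lemma Lip_sum_le:
  fixes v :: "'i \<Rightarrow> 'a::metric_space \<Rightarrow> real"
  assumes "finite I" "\<And>i. i \<in> I \<Longrightarrow> (L i)-lipschitz_on UNIV (v i)"
  shows "Lip (\<lambda>x. \<Sum>i\<in>I. v i x) x \<le> (\<Sum>i\<in>I. Lip (v i) x)"
  using assms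
proof (induction I)
  case empty
  show ?case by (rule Lip_le[of _ 1]) auto
next
  case (insert i I)
  have "Lip (\<lambda>x. v i x + (\<Sum>i\<in>I. v i x)) x \<le> Lip (v i) x + Lip (\<lambda>x. \<Sum>i\<in>I. v i x) x"
    using insert.prems lipschitz_on_sum[of I L v] by (intro Lip_add_le) auto
  moreover have "Lip (\<lambda>x. \<Sum>i\<in>I. v i x) x \<le> (\<Sum>i\<in>I. Lip (v i) x)"
    by (rule insert.IH) (use insert.prems in auto)
  ultimately show ?case using insert.hyps by simp
qed

lemma AE_allI_nat:
  fixes P :: "nat \<Rightarrow> 'a \<Rightarrow> bool"
  assumes "\<And>n. AE x in M. P n x" shows "AE x in M. \<forall>n. P n x"
  using assms AE_all_countable[of P M] by blast

section \<open>Almost everywhere comparison of pointwise Lipschitz constants\<close>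

context ahlfors
begin

text \<open>A point of \<open>G\<close> at which \<open>Lip v\<close> exceeds \<open>Lip w\<close> is a porosity point of \<open>G\<close>; porosity
  points form a null set by the covering lemma.\<close>

lemma AE_not_porous:
  assumes G: "closed G" and n: "(1::real) \<le> N"
  shows "AE x in \<mu>. x \<in> G \<longrightarrow>
    (\<exists>s>0. \<forall>y. 0 < dist x y \<and> dist x y < s \<longrightarrow> ball y (dist x y / N) \<inter> G \<noteq> {})"
proof -
  \<comment> \<open>Thin shells around \<open>G\<close> with \<open>G\<close> removed; they decrease
    to the empty set because \<open>G\<close> is closed.\<close>
  define U where "U = (\<lambda>n. (\<Union>x\<in>G. ball x (inverse (real (Suc n)))) - G)"
  have Um: "U n \<in> sets \<mu>" for n unfolding U_def by (intro sets.Diff open_meas closed_meas G) auto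
  have "decseq U"
  proof (rule decseq_SucI)
    fix n
    have "inverse (real (Suc (Suc n))) \<le> inverse (real (Suc n))" by (simp add: field_simps)
    then have "ball x (inverse (real (Suc (Suc n)))) \<subseteq> ball x (inverse (real (Suc n)))" for x :: 'a
      by (rule subset_ball)
    then show "U (Suc n) \<subseteq> U n" unfolding U_def by blast
  qed
  moreover have "(\<Inter>n. U n) = {}"
  proof (rule ccontr)
    assume "\<not> ?thesis"
    then obtain y where y: "\<And>n. y \<in> U n" by auto
    then have "y \<notin> G" by (auto simp: U_def)
    then obtain e where e: "e > 0" "ball y e \<subseteq> - G" using G unfolding closed_def open_contains_ball by auto
    obtain n where n: "inverse (real (Suc n)) < e" using reals_Archimedean e by blast
    obtain x where "x \<in> G" "dist x y < inverse (real (Suc n))" using y[of n] by (auto simp: U_def)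
    then have "x \<in> G" "x \<in> ball y e" using n by (auto simp: dist_commute)
    then show False using e by blast
  qed
  ultimately have limU: "(\<lambda>n. measure \<mu> (U n)) \<longlonglongrightarrow> 0"
    using finite_Lim_measure_decseq[of U] Um by auto
  \<comment> \<open>Balls about points of \<open>G\<close> that contain a hole of proportional
    radius. A hole lies in the shell \<open>U n\<close>, so the measure of the ball is at most a
    constant times the part of \<open>U n\<close> inside it, which is the input of the covering
    lemma. Porous points belong to every \<open>V n\<close>, and the measures of these tend to
    0.\<close>
  define B where "B = (\<lambda>n. {(x, r). x \<in> G \<and> 0 < r \<and> r < inverse (real (Suc n)) \<and>
      (\<exists>y. 2 * dist x y = r \<and> ball y (dist x y / N) \<inter> G = {})})"
  define V where "V = (\<lambda>n. \<Union>(x, r)\<in>B n. ball x r)"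
  have Vm: "V n \<in> sets \<mu>" for n unfolding V_def by (intro open_meas) auto
  have V: "measure \<mu> (V n) \<le> K * 3 powr Q * (K * (2 * N) powr Q * measure \<mu> (U n))" for n
  proof -
    have "measure \<mu> (V n) \<le> K * (3 * 1) powr Q * (LINT x|\<mu>. K * (2 * N) powr Q * indicator (U n) x)"
      unfolding V_def
    proof (rule measure_covering)
      fix x r assume xr: "(x, r) \<in> B n"
      then obtain y where y: "x \<in> G" "0 < r" "r < inverse (real (Suc n))" "2 * dist x y = r"
        "ball y (dist x y / N) \<inter> G = {}" by (auto simp: B_def)
      have d: "0 < dist x y" "dist x y / N \<le> dist x y" using y n by (auto simp: field_simps)
      have sub: "ball y (dist x y / N) \<subseteq> ball x r"
      proof
        fix w assume "w \<in> ball y (dist x y / N)"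
        then show "w \<in> ball x r" using d y(4) dist_triangle[of x w y] by simp
      qed
      have "(dist x y / N) powr Q \<le> K * measure \<mu> (ball y (dist x y / N))"
        using d n dist_le[of x y] by (intro lower) auto
      also have "\<dots> \<le> K * measure \<mu> (U n \<inter> ball x r)"
      proof (intro mult_left_mono finite_measure_mono)
        show "ball y (dist x y / N) \<subseteq> U n \<inter> ball x r"
        proof
          fix w assume w: "w \<in> ball y (dist x y / N)"
          then have "w \<in> ball x r" "w \<notin> G" using sub y by auto
          then show "w \<in> U n \<inter> ball x r" using y(1,3) unfolding U_def by (auto intro!: bexI[of _ x])
        qed
      qed (use K Um in auto)
      finally have 1: "(dist x y / N) powr Q \<le> K * measure \<mu> (U n \<inter> ball x r)" .
      have "r powr Q = (2 * N) powr Q * (dist x y / N) powr Q"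
        using n d y(4) by (subst powr_mult[symmetric]) auto
      also have "\<dots> \<le> (2 * N) powr Q * (K * measure \<mu> (U n \<inter> ball x r))"
        using 1 by (intro mult_left_mono) auto
      also have "\<dots> = (LINT w:ball x (1 * r)|\<mu>. K * (2 * N) powr Q * indicator (U n) w)"
        unfolding set_lebesgue_integral_def using Um
        by (simp add: mult.left_commute[of "indicator _ _"] indicator_inter_arith[symmetric] Int_commute mult.assoc)
      finally show "0 < r \<and> r powr Q \<le> (LINT w:ball x (1 * r)|\<mu>. K * (2 * N) powr Q * indicator (U n) w)"
        using y by simp
    next
      show "integrable \<mu> (\<lambda>x. K * (2 * N) powr Q * indicator (U n) x)"
        by (intro integrable_mult_right integrable_real_indicator Um) (simp add: emeasure_eq_measure)
    qed (use K in auto)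
    then show ?thesis using Um by simp
  qed
  have "(\<lambda>n. K * 3 powr Q * (K * (2 * N) powr Q * measure \<mu> (U n))) \<longlonglongrightarrow> K * 3 powr Q * (K * (2 * N) powr Q * 0)"
    by (intro tendsto_intros limU)
  then have lim0: "(\<lambda>n. K * 3 powr Q * (K * (2 * N) powr Q * measure \<mu> (U n))) \<longlonglongrightarrow> 0" by simp
  have "measure \<mu> (\<Inter>n. V n) \<le> 0"
  proof (rule LIMSEQ_le_const[OF lim0], intro exI allI impI)
    fix n :: nat
    have "measure \<mu> (\<Inter>n. V n) \<le> measure \<mu> (V n)" using Vm by (intro finite_measure_mono) auto
    then show "measure \<mu> (\<Inter>n. V n) \<le> K * 3 powr Q * (K * (2 * N) powr Q * measure \<mu> (U n))" using V[of n] by linarith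
  qed
  then have null: "(\<Inter>n. V n) \<in> null_sets \<mu>"
    using Vm by (intro null_setsI) (auto simp: emeasure_eq_measure measure_le_0_iff)
  show ?thesis
  proof (rule AE_I'[OF null], clarsimp)
    fix x n assume x: "x \<in> G"
      and por: "\<forall>s>0. \<exists>y. x \<noteq> y \<and> dist x y < s \<and> ball y (dist x y / N) \<inter> G = {}"
    have "0 < inverse (real (Suc n)) / 2" by simp
    then obtain y where y: "x \<noteq> y" "dist x y < inverse (real (Suc n)) / 2" "ball y (dist x y / N) \<inter> G = {}"
      using por by blast
    then have "(x, 2 * dist x y) \<in> B n" using x unfolding B_def by (auto intro!: exI[of _ y])
    moreover have "x \<in> ball x (2 * dist x y)" using y by simp
    ultimately show "x \<in> V n" unfolding V_def by blast
  qed
qed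

text \<open>At a non-porous point of \<open>G\<close>, each nearby \<open>y\<close> has a companion
  \<open>y'\<close> in \<open>G\<close> at distance a small fraction of \<open>dist x y\<close>.
  There \<open>v\<close> and \<open>w\<close> agree, and moving from \<open>y\<close> to
  \<open>y'\<close> costs only \<open>L\<close> times that fraction. The fraction depends on the
  tolerance, so non-porosity is needed for a countable family of ratios at once.\<close>

lemma AE_Lip_le:
  assumes v: "L-lipschitz_on UNIV v" and w: "M-lipschitz_on UNIV w"
    and G: "closed G" and eq: "\<And>x. x \<in> G \<Longrightarrow> v x = w x"
  shows "AE x in \<mu>. x \<in> G \<longrightarrow> Lip v x \<le> Lip w x"
proof -
  define P where "P = (\<lambda>(n::nat) x. x \<in> G \<longrightarrow>
    (\<exists>s>0. \<forall>y. 0 < dist x y \<and> dist x y < s \<longrightarrow> ball y (dist x y / real (Suc n)) \<inter> G \<noteq> {}))"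
  have "AE x in \<mu>. P n x" for n
    unfolding P_def by (rule AE_not_porous[OF G, of "real (Suc n)"]) simp
  then have "AE x in \<mu>. \<forall>n. P n x" by (rule AE_allI_nat)
  then show ?thesis
  proof (rule eventually_mono)
    fix x assume elim: "\<forall>n. P n x"
    show "x \<in> G \<longrightarrow> Lip v x \<le> Lip w x"
    proof (rule impI, rule field_le_epsilon)
      fix e :: real assume x: "x \<in> G" and e: "0 < e"
      define t where "t = Lip w x + e / 2"
      have t: "0 < t" "t < Lip w x + e" using e Lip_nonneg[of w x] by (auto simp: t_def)
      have "Lip w x < t" using e by (simp add: t_def)
      from Lip_less[OF w this] obtain s1 where
        s1: "s1 > 0" "\<And>y. dist x y < s1 \<Longrightarrow> \<bar>w y - w x\<bar> \<le> t * dist x y" by blast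
      have L0: "0 \<le> L" using lipschitz_on_nonneg[OF v] .
      obtain n :: nat where n: "(L + t) / (e / 2) < real (Suc n)"
      proof -
        obtain n :: nat where "(L + t) / (e / 2) < real n" using reals_Archimedean2 by blast
        then have "(L + t) / (e / 2) < real (Suc n)" by simp
        then show thesis by (rule that)
      qed
      define \<eta> where "\<eta> = 1 / real (Suc n)"
      have \<eta>: "0 < \<eta>" "\<eta> \<le> 1" unfolding \<eta>_def by auto
      have n2: "(L + t) * \<eta> \<le> e / 2" using n e unfolding \<eta>_def by (simp add: field_simps del: of_nat_Suc)
      obtain s2 where s2: "s2 > 0"
        "\<And>y. 0 < dist x y \<and> dist x y < s2 \<Longrightarrow> ball y (dist x y / real (Suc n)) \<inter> G \<noteq> {}"
        using elim x unfolding P_def by meson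
      show "Lip v x \<le> Lip w x + e"
      proof (rule Lip_le[of _ "min (s1/2) s2"])
        \<comment> \<open>Half of \<open>s1\<close>, because the companion point may be twice as far
          from \<open>x\<close> as \<open>y\<close> is.\<close>
        fix y assume y: "dist x y < min (s1/2) s2"
        show "\<bar>v y - v x\<bar> \<le> (Lip w x + e) * dist x y"
        proof (cases "x = y")
          case True
          then show ?thesis by simp
        next
          case False
          then have "0 < dist x y \<and> dist x y < s2" using y by auto
          from s2(2)[OF this] obtain y' where y': "y' \<in> G" "dist y y' < dist x y * \<eta>"
            unfolding \<eta>_def by auto
          have d: "dist x y' \<le> dist x y * (1 + \<eta>)" using y' dist_triangle[of x y' y] by (simp add: algebra_simps)
          also have "\<dots> \<le> dist x y * 2" using \<eta> by (intro mult_left_mono) auto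
          also have "\<dots> < s1" using y by simp
          finally have "\<bar>w y' - w x\<bar> \<le> t * dist x y'" by (rule s1(2))
          also have "\<dots> \<le> t * (dist x y * (1 + \<eta>))" using d t by (intro mult_left_mono) auto
          finally have 1: "\<bar>v y' - v x\<bar> \<le> t * (dist x y * (1 + \<eta>))" using eq x y' by simp
          have "\<bar>v y - v y'\<bar> \<le> L * dist y y'" by (rule lipschitz_on_abs_real[OF v])
          also have "\<dots> \<le> L * (dist x y * \<eta>)" using y' L0 by (intro mult_left_mono) auto
          finally have "\<bar>v y - v x\<bar> \<le> dist x y * (t + (L + t) * \<eta>)" using 1 by (simp add: algebra_simps)
          also have "\<dots> \<le> dist x y * (Lip w x + e)" using n2 by (intro mult_left_mono) (auto simp: t_def)
          finally show ?thesis by (simp add: mult.commute)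
        qed
      qed (use s1 s2 e Lip_nonneg[of w x] in auto)
    qed
  qed
qed

lemma lipschitz_measurable: "L-lipschitz_on UNIV (u :: 'a \<Rightarrow> real) \<Longrightarrow> u \<in> borel_measurable \<mu>"
  using borel_measurable_continuous_onI[OF lipschitz_on_continuous_on, of L u]
  by (simp add: measurable_cong_sets[OF sets_mu])

lemma lipschitz_integrable:
  assumes "L-lipschitz_on UNIV (u :: 'a \<Rightarrow> real)" shows "integrable \<mu> u"
proof -
  fix x0 :: 'a
  have "\<bar>u x\<bar> \<le> \<bar>u x0\<bar> + L" for x
  proof -
    have "\<bar>u x - u x0\<bar> \<le> L * dist x x0" by (rule lipschitz_on_abs_real[OF assms])
    also have "\<dots> \<le> L * 1" using lipschitz_on_nonneg[OF assms] dist_le by (intro mult_left_mono) auto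
    finally show ?thesis by linarith
  qed
  then show ?thesis using lipschitz_measurable[OF assms]
    by (intro integrable_const_bound[of _ "\<bar>u x0\<bar> + L"]) auto
qed

lemma avg_lipschitz_diff:
  assumes u: "L-lipschitz_on UNIV u" and r: "0 < r"
  shows "avg z r (\<lambda>x. \<bar>u x - u z\<bar>) \<le> L * r"
proof -
  have "avg z r (\<lambda>x. \<bar>u x - u z\<bar>) \<le> avg z r (\<lambda>x. L * r)"
  proof (rule avg_mono)
    fix x assume "x \<in> ball z r"
    then have "L * dist x z \<le> L * r" using lipschitz_on_nonneg[OF u] by (intro mult_left_mono) (auto simp: dist_commute)
    then show "\<bar>u x - u z\<bar> \<le> L * r" using lipschitz_on_abs_real[OF u, of x z] by linarith
  qed (use lipschitz_integrable[OF u] in auto)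
  then show ?thesis using r by (simp add: avg_const)
qed

lemma sharp_lipschitz_le:
  assumes u: "L-lipschitz_on UNIV u" shows "sharp u x \<le> ennreal (2 * L)"
proof (rule sharp_le)
  fix z r assume r: "0 < (r::real)"
  have "mean_osc u z r \<le> 2 * avg z r (\<lambda>x. \<bar>u x - u z\<bar>)" by (rule mean_osc_le[OF lipschitz_integrable[OF u] r])
  then have "mean_osc u z r \<le> 2 * (L * r)" using avg_lipschitz_diff[OF u r, of z] by linarith
  then show "ennreal (mean_osc u z r / r) \<le> ennreal (2 * L)"
    using r by (intro ennreal_leI) (simp add: field_simps)
qed

lemma sharp_lipschitz_fin: "L-lipschitz_on UNIV u \<Longrightarrow> sharp u x < top"
  using sharp_lipschitz_le ennreal_less_top order.strict_trans1 by blast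

text \<open>Averages of a Lipschitz function converge at every point, so there is no exceptional
  set; the extension from level sets of the sharp function relies on this.\<close>

lemma lipschitz_hajlasz:
  assumes u: "L-lipschitz_on UNIV u"
  shows "\<bar>u x - u y\<bar> \<le> H * dist x y * (rsharp u x + rsharp u y)"
proof (rule rsharp_hajlasz[where \<sigma> = id])
  have "(\<lambda>j. avg x (2 * (1/2)^j) u) \<longlonglongrightarrow> u x" for x
  proof (rule LIM_zero_cancel, rule Lim_null_comparison)
    have "\<bar>avg x (2 * (1/2)^j) u - u x\<bar> \<le> L * (2 * (1/2)^j)" for j
      using avg_diff_const[OF lipschitz_integrable[OF u], of "2 * (1/2)^j" x "u x"]
        avg_lipschitz_diff[OF u, of "2 * (1/2)^j" x] by simp
    then show "\<forall>\<^sub>F j in sequentially. norm (avg x (2 * (1/2)^j) u - u x) \<le> L * (2 * (1/2)^j)" by simp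
    have "(\<lambda>j. L * (2 * (1/2::real)^j)) \<longlonglongrightarrow> L * (2 * 0)"
      by (intro tendsto_intros LIMSEQ_power_zero) auto
    then show "(\<lambda>j. L * (2 * (1/2::real)^j)) \<longlonglongrightarrow> 0" by simp
  qed
  then show "(\<lambda>j. avg x (2 * (1/2)^(id j)) u) \<longlonglongrightarrow> u x" "(\<lambda>j. avg y (2 * (1/2)^(id j)) u) \<longlonglongrightarrow> u y"
    by auto
  show "filterlim id at_top sequentially" unfolding id_def by (rule filterlim_ident)
qed (use sharp_lipschitz_fin[OF u] lipschitz_integrable[OF u] in auto)

end

section \<open>The strong-type bound for the sharp maximal function\<close>

text \<open>The doubling terms below \<open>s\<close> add up to less than twice the largest
  admissible value. Divided by the number \<open>k\<close> of truncations, this produces the gain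
  1/k.\<close>

lemma sum_dyadic_le:
  fixes a s :: real
  assumes "0 < a"
  shows "(\<Sum>i<k. if a * 2^i < s then a * 2^i else 0) \<le> 2 * min s (a * 2^k) \<or> s \<le> a"
proof (cases "s \<le> a")
  case False
  have A: "(\<Sum>i<k. if a * 2^i < s then a * 2^i else 0) \<le> a * 2^k" for k
  proof (induction k)
    case (Suc k)
    have "(if a * 2^k < s then a * 2^k else 0) \<le> a * 2^k" using assms by simp
    then show ?case using Suc by simp
  qed (use assms in simp)
  have "(\<Sum>i<k. if a * 2^i < s then a * 2^i else 0) \<le> 2 * min s (a * 2^k)"
  proof (induction k)
    case 0
    then show ?case using False assms by simp
  next
    case (Suc k)
    have "0 < a * 2^k" using assms by simp
    then show ?case using Suc A[of k] by (auto simp: min_def split: if_splits)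
  qed
  then show ?thesis by blast
qed simp

lemma divide_minus_one_add: "1 < p \<Longrightarrow> y / (p - 1) + y = p * y / (p - 1)" for p y :: real
  by (simp add: field_simps)

text \<open>A geometric series is governed by its last term, which is below \<open>s powr q\<close>;
  the bound involves neither the starting height \<open>a\<close> nor the number of terms.\<close>

lemma sum_dyadic_powr_le:
  fixes a s q :: real
  assumes "0 < a" "0 \<le> s" "0 < q"
  shows "(\<Sum>m<M. if a * 2^m < s then (a * 2^m) powr q else 0) \<le> 2 powr q / (2 powr q - 1) * s powr q"
proof -
  have q1: "1 < 2 powr q" using assms by simp
  then have c0: "0 \<le> 2 powr q / (2 powr q - 1)" by (intro divide_nonneg_nonneg) linarith+
  have A: "(\<Sum>m<M. if a * 2^m < s then (a * 2^m) powr q else 0) \<le> (a * 2^M) powr q / (2 powr q - 1)" for M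
  proof (induction M)
    case (Suc M)
    have "(\<Sum>m<Suc M. if a * 2^m < s then (a * 2^m) powr q else 0)
        \<le> (a * 2^M) powr q / (2 powr q - 1) + (a * 2^M) powr q"
      unfolding sum.lessThan_Suc using Suc by (intro add_mono) auto
    also have "\<dots> = 2 powr q * (a * 2^M) powr q / (2 powr q - 1)"
      by (rule divide_minus_one_add[OF q1])
    also have "2 powr q * (a * 2^M) powr q = (a * 2^Suc M) powr q"
      using assms by (simp flip: powr_mult add: mult.left_commute)
    finally show ?case .
  qed (use q1 in simp)
  show ?thesis
  proof (induction M)
    case (Suc M)
    show ?case
    proof (cases "a * 2^M < s")
      case True
      have "(\<Sum>m<Suc M. if a * 2^m < s then (a * 2^m) powr q else 0)
          \<le> (a * 2^M) powr q / (2 powr q - 1) + (a * 2^M) powr q" using A[of M] True by simp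
      also have "\<dots> = 2 powr q / (2 powr q - 1) * (a * 2^M) powr q"
      proof -
        show ?thesis by (subst divide_minus_one_add) (use q1 in auto)
      qed
      also have "\<dots> \<le> 2 powr q / (2 powr q - 1) * s powr q"
        using True assms by (intro mult_left_mono[OF _ c0] powr_mono2) auto
      finally show ?thesis .
    qed (use Suc in simp)
  qed (use mult_nonneg_nonneg[OF c0, of "s powr q"] in simp)
qed

text \<open>The admissible exponents lie within \<open>k\<close> steps of the smallest one. This
  will count the heights at which a given point falls into the range of the truncations.\<close>

lemma card_dyadic_window_le:
  fixes a s :: real
  assumes "0 < a"
  shows "(\<Sum>m<M. if a * 2^m < s \<and> s \<le> 2^k * (a * 2^m) then 1 else 0) \<le> real k"
proof -
  define A where "A = {m. m < M \<and> a * 2^m < s \<and> s \<le> 2^k * (a * 2^m)}"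
  have fin: "finite A" unfolding A_def by simp
  have "(\<Sum>m<M. if a * 2^m < s \<and> s \<le> 2^k * (a * 2^m) then 1 else 0) = real (card A)"
    unfolding A_def by (simp add: sum.If_cases Int_def)
  also have "card A \<le> k"
  proof (cases "A = {}")
    case False
    have "A \<subseteq> {Min A..<Min A + k}"
    proof
      fix m assume m: "m \<in> A"
      have "Min A \<in> A" using False fin by simp
      then have "a * 2^m < 2^k * (a * 2^(Min A))" using m unfolding A_def by force
      then have "(2::real)^m < 2^(Min A + k)" using assms by (simp add: power_add mult.commute mult.left_commute)
      then have "m < Min A + k" by (simp add: power_strict_increasing_iff)
      then show "m \<in> {Min A..<Min A + k}" using m fin by simp
    qed
    then have "card A \<le> card {Min A..<Min A + k}" by (rule card_mono[rotated]) simp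
    then show ?thesis by simp
  qed simp
  finally show ?thesis by simp
qed

text \<open>A layer-cake formula with finitely many dyadic heights: the term with
  \<open>\<tau>\<close> pays for values below the first height, and \<open>M\<close> is large enough
  to reach \<open>s\<close>.\<close>

lemma powr_le_sum_dyadic:
  fixes s q :: real
  assumes "0 < \<tau>" "0 \<le> s" "0 < q" "s \<le> \<tau> * 2^M"
  shows "s powr q \<le> \<tau> powr q + 2 powr q * (\<Sum>m<M. if \<tau> * 2^m < s then (\<tau> * 2^m) powr q else 0)"
proof (cases "s \<le> \<tau>")
  case True
  have "s powr q \<le> \<tau> powr q" using assms True by (intro powr_mono2) auto
  moreover have "0 \<le> (\<Sum>m<M. if \<tau> * 2^m < s then (\<tau> * 2^m) powr q else 0)" by (intro sum_nonneg) auto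
  ultimately show ?thesis by (smt (verit) mult_nonneg_nonneg powr_ge_zero)
next
  case False
  define n where "n = (LEAST m. s \<le> \<tau> * 2^m)"
  have n: "s \<le> \<tau> * 2^n" "n \<le> M" unfolding n_def using assms by (auto intro: LeastI Least_le)
  have "n \<noteq> 0" using n False by (intro notI) simp
  then obtain m where m: "n = Suc m" by (cases n) auto
  have lt: "\<tau> * 2^m < s" using not_less_Least[of m "\<lambda>m. s \<le> \<tau> * 2^m"] m unfolding n_def by simp
  have "s powr q \<le> (2 * (\<tau> * 2^m)) powr q" using assms n m by (intro powr_mono2) auto
  also have "\<dots> = 2 powr q * (if \<tau> * 2^m < s then (\<tau> * 2^m) powr q else 0)" using lt assms by (simp add: powr_mult)
  also have "\<dots> \<le> 2 powr q * (\<Sum>m<M. if \<tau> * 2^m < s then (\<tau> * 2^m) powr q else 0)"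
    using n m by (intro mult_left_mono member_le_sum) auto
  finally show ?thesis by (smt (verit) powr_ge_zero)
qed

lemma add_powr_le:
  fixes a b q :: real
  assumes "0 \<le> a" "0 \<le> b" "0 < q"
  shows "(a + b) powr q \<le> 2 powr q * (a powr q + b powr q)"
proof -
  have "(a + b) powr q \<le> (2 * max a b) powr q" using assms by (intro powr_mono2) auto
  also have "\<dots> = 2 powr q * max a b powr q" using assms by (simp add: powr_mult)
  also have "\<dots> \<le> 2 powr q * (a powr q + b powr q)"
    by (intro mult_left_mono) (auto simp: max_def)
  finally show ?thesis .
qed

lemma if_nonneg: "0 \<le> (a :: real) \<Longrightarrow> 0 \<le> (if P then a else 0)"
  by simp

lemma scaled_sum:
  fixes c :: "nat \<Rightarrow> real"
  assumes "0 < k"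
  shows "(\<Sum>i<k. (1 / real k) * (a * c i + b)) = a / real k * (\<Sum>i<k. c i) + b"
proof -
  have "(\<Sum>i<k. (1 / real k) * (a * c i + b)) = (1 / real k) * (a * (\<Sum>i<k. c i) + real k * b)"
    by (simp only: sum_distrib_left[symmetric] sum.distrib sum_constant card_lessThan)
  then show ?thesis using assms by (simp add: field_simps)
qed

text \<open>The constant \<open>CP\<close> is positive because thresholds such as \<beta>/(4 CP)
  divide by it.\<close>

locale ahlfors_poincare = ahlfors \<mu> Q K for \<mu> :: "'a::metric_space measure" and Q K +
  fixes CP \<Lambda> :: real
  assumes CP: "0 < CP" and Lam: "1 \<le> \<Lambda>"
    and poincare: "\<And>f L z r. L-lipschitz_on UNIV f \<Longrightarrow> 0 < r \<Longrightarrow>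
      mean_osc f z r \<le> CP * r * avg z (\<Lambda> * r) (\<lambda>x. Lip f x powr Q) powr (1 / Q)"

section \<open>Lipschitz truncation along the sharp function\<close>

context ahlfors
begin

lemma bounded_integrable:
  assumes "f \<in> borel_measurable \<mu>" "\<And>x. \<bar>f x\<bar> \<le> B" shows "integrable \<mu> (f :: 'a \<Rightarrow> real)"
  using assms by (intro integrable_const_bound[of _ B]) auto

lemma rsharp_le: "L-lipschitz_on UNIV u \<Longrightarrow> rsharp u x \<le> 2 * L"
  using enn2real_mono[OF sharp_lipschitz_le, of L u x] lipschitz_on_nonneg[of L UNIV u] by simp

lemma closed_rsharp_le:
  assumes u: "L-lipschitz_on UNIV u" and t: "0 \<le> t" shows "closed {x. rsharp u x \<le> t}"
proof -
  have "rsharp u x \<le> t \<longleftrightarrow> \<not> (ennreal t < sharp u x)" for x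
  proof -
    have "sharp u x = ennreal (rsharp u x)" using sharp_lipschitz_fin[OF u] by simp
    then show ?thesis using t by (metis enn2real_nonneg ennreal_le_iff not_less)
  qed
  then have "{x. rsharp u x \<le> t} = - {x. ennreal t < sharp u x}" by auto
  then show ?thesis using open_sharp_gt[of "ennreal t" u] by (simp add: closed_def)
qed

text \<open>On the set where the sharp function is at most \<open>t\<close>, the Hajlasz inequality
  makes \<open>u\<close> Lipschitz with constant 2 H t, and the McShane formula extends it.\<close>

lemma lipschitz_truncation:
  assumes u: "L-lipschitz_on UNIV u" and t: "0 \<le> t"
  shows "\<exists>v. (2 * H * t)-lipschitz_on UNIV v \<and> (\<forall>x. rsharp u x \<le> t \<longrightarrow> v x = u x)"
proof -
  have "\<exists>v. (2 * H * t)-lipschitz_on UNIV v \<and> (\<forall>x\<in>{x. rsharp u x \<le> t}. v x = u x)"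
  proof (rule mcshane_extension)
    fix x y assume "x \<in> {x. rsharp u x \<le> t}" "y \<in> {x. rsharp u x \<le> t}"
    then have "H * dist x y * (rsharp u x + rsharp u y) \<le> H * dist x y * (2 * t)"
      using H_ge1 by (intro mult_left_mono) auto
    then show "\<bar>u x - u y\<bar> \<le> 2 * H * t * dist x y" using lipschitz_hajlasz[OF u, of x y] by (simp add: ac_simps)
  qed (use H_ge1 t in auto)
  then show ?thesis by auto
qed

end

section \<open>Averaged truncations and the estimate at one height\<close>

locale averaged_truncation = ahlfors_poincare \<mu> Q K CP \<Lambda>
  for \<mu> :: "'a::metric_space measure" and Q K CP \<Lambda> +
  fixes u :: "'a \<Rightarrow> real" and L :: real and \<rho> :: "'a \<Rightarrow> real" and R :: real
    and \<beta> T :: real and k :: nat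
  assumes u: "L-lipschitz_on UNIV u"
    and rho_meas [measurable]: "\<rho> \<in> borel_measurable \<mu>"
    and rho: "\<And>x. 0 \<le> \<rho> x" "\<And>x. \<rho> x \<le> R" "\<And>x. Lip u x \<le> \<rho> x"
    and lam: "0 < \<beta>" and T: "1 \<le> T" and k: "1 \<le> k"
begin

definition height :: "nat \<Rightarrow> real" where "height i = T * \<beta> * 2^i"

definition v :: "nat \<Rightarrow> 'a \<Rightarrow> real" where
  "v i = (SOME v. (2 * H * height i)-lipschitz_on UNIV v \<and> (\<forall>x. rsharp u x \<le> height i \<longrightarrow> v x = u x))"

lemma height_pos: "0 < height i" unfolding height_def using lam T by simp

lemma height_mono: "i \<le> j \<Longrightarrow> height i \<le> height j"
  unfolding height_def using lam T by (intro mult_left_mono power_increasing) auto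

lemma truncation: "(2 * H * height i)-lipschitz_on UNIV (v i)" "rsharp u x \<le> height i \<Longrightarrow> v i x = u x"
  using someI_ex[OF lipschitz_truncation[OF u less_imp_le[OF height_pos[of i]]]] unfolding v_def by auto

text \<open>At a point where the sharp function equals s, only truncations of height below s can
  have a gradient larger than that of \<open>u\<close>. Their Lipschitz constants form a geometric
  progression of total size comparable to s, and averaging divides this by \<open>k\<close>.\<close>

definition h :: "'a \<Rightarrow> real" where "h x = (\<Sum>i<k. (1 / real k) * v i x)"

lemma h_lipschitz: "\<exists>M. M-lipschitz_on UNIV h"
proof -
  have "(\<Sum>i<k. (1 / real k) * (2 * H * height i))-lipschitz_on UNIV (\<lambda>x. \<Sum>i<k. (1 / real k) * v i x)"
    by (intro lipschitz_on_sum lipschitz_on_cmult_real_nonneg truncation) auto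
  then show ?thesis unfolding h_def[abs_def] by blast
qed

text \<open>The pointwise majorant of \<open>Lip h x powr Q\<close>. Below the lowest height all
  truncations equal \<open>u\<close> and each other; above it the truncations already exceeded
  contribute the 1/k term, and the others, present only up to \<open>height k\<close>, contribute
  \<open>\<rho>\<close>.\<close>

definition \<Psi> :: "'a \<Rightarrow> real" where
  "\<Psi> x = (if rsharp u x \<le> T * \<beta> then min (\<rho> x) (2 * H * (T * \<beta>)) powr Q
     else 2 powr Q * ((4 * H / k * min (rsharp u x) (height k)) powr Q +
       (if rsharp u x \<le> height k then \<rho> x powr Q else 0)))"

text \<open>Points where \<open>\<rho>\<close> is small compared with \<open>\<beta>\<close> are
  discarded: the Poincare inequality on a good ball absorbs them, and keeping them would spoil the
  later sum over all dyadic \<open>\<beta>\<close>.\<close>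

definition \<Psi>' :: "'a \<Rightarrow> real" where
  "\<Psi>' x = (if rsharp u x \<le> T * \<beta> \<and> \<rho> x \<le> \<beta> / (4 * CP) then 0 else \<Psi> x)"

lemma Psi_meas [measurable]: "\<Psi> \<in> borel_measurable \<mu>" "\<Psi>' \<in> borel_measurable \<mu>"
  unfolding \<Psi>_def[abs_def] \<Psi>'_def[abs_def] by measurable

lemma Psi_nonneg: "0 \<le> \<Psi> x" "0 \<le> \<Psi>' x"
  unfolding \<Psi>'_def \<Psi>_def by auto

lemma Psi_le: "\<Psi> x \<le> R powr Q + 2 powr Q * ((4 * H / k * height k) powr Q + R powr Q)"
proof -
  have 1: "min (\<rho> x) (2 * H * (T * \<beta>)) powr Q \<le> R powr Q"
    using rho(1,2)[of x] Q H_ge1 T lam by (intro powr_mono2) auto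
  have 2: "\<rho> x powr Q \<le> R powr Q" using rho(1,2)[of x] Q by (intro powr_mono2) auto
  have 3: "(4 * H / k * min (rsharp u x) (height k)) powr Q \<le> (4 * H / k * height k) powr Q"
    using Q H_ge1 height_pos[of k] by (intro powr_mono2 mult_left_mono) auto
  have "2 powr Q * ((4 * H / k * min (rsharp u x) (height k)) powr Q + (if rsharp u x \<le> height k then \<rho> x powr Q else 0))
    \<le> 2 powr Q * ((4 * H / k * height k) powr Q + R powr Q)"
    using 2 3 by (intro mult_left_mono add_mono) auto
  moreover have "0 \<le> 2 powr Q * ((4 * H / k * height k) powr Q + R powr Q)" by simp
  moreover have "0 \<le> R powr Q" by simp
  ultimately show ?thesis
    unfolding \<Psi>_def using 1 by (smt (verit))
qed

lemma Psi_integrable: "integrable \<mu> \<Psi>" "integrable \<mu> \<Psi>'"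
proof -
  show "integrable \<mu> \<Psi>" using Psi_nonneg(1) Psi_le Psi_meas by (intro bounded_integrable) auto
  have "\<bar>\<Psi>' x\<bar> \<le> R powr Q + 2 powr Q * ((4 * H / k * height k) powr Q + R powr Q)" for x
    using Psi_nonneg[of x] Psi_le[of x] unfolding \<Psi>'_def by auto
  then show "integrable \<mu> \<Psi>'" using Psi_meas by (intro bounded_integrable)
qed

text \<open>By \<open>AE_Lip_le\<close>, a truncation has almost everywhere gradient at most that of
  \<open>u\<close> where it coincides with \<open>u\<close>; elsewhere its Lipschitz constant is the
  bound.\<close>

lemma Lip_h_le: "AE x in \<mu>. Lip h x powr Q \<le> \<Psi> x"
proof -
  have "AE x in \<mu>. \<forall>i. x \<in> {x. rsharp u x \<le> height i} \<longrightarrow> Lip (v i) x \<le> Lip u x"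
    by (intro AE_allI_nat AE_Lip_le[OF truncation(1) u] closed_rsharp_le[OF u less_imp_le[OF height_pos]]) (auto simp: truncation)
  \<comment> \<open>Comparison with \<open>v 0\<close> supplies the cap 2 H T \<beta> in
    \<open>\<Psi>\<close>. The cap makes this contribution a geometric series in
    \<open>\<beta>\<close> instead of one equal term for each height.\<close>
  moreover have "AE x in \<mu>. \<forall>i. x \<in> {x. rsharp u x \<le> height 0} \<longrightarrow> Lip (v i) x \<le> Lip (v 0) x"
  proof (intro AE_allI_nat AE_Lip_le[OF truncation(1) truncation(1)] closed_rsharp_le[OF u less_imp_le[OF height_pos]])
    fix i x assume "x \<in> {x. rsharp u x \<le> height 0}"
    then have "rsharp u x \<le> height 0" "rsharp u x \<le> height i" using height_mono[of 0 i] by auto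
    then show "v i x = v 0 x" by (simp add: truncation)
  qed
  ultimately show ?thesis
  proof eventually_elim
    case (elim x)
    have "Lip h x \<le> (\<Sum>i<k. Lip (\<lambda>x. (1 / real k) * v i x) x)"
      unfolding h_def[abs_def]
      by (rule Lip_sum_le[where L = "\<lambda>i. (1 / real k) * (2 * H * height i)"])
         (auto intro!: lipschitz_on_cmult_real_nonneg[of _ _ _ "1 / real k", simplified] truncation)
    also have "\<dots> \<le> (\<Sum>i<k. (1 / real k) * Lip (v i) x)"
      using k by (intro sum_mono Lip_cmult_le[OF truncation(1)]) auto
    finally have h: "Lip h x \<le> (\<Sum>i<k. (1 / real k) * Lip (v i) x)" .
    show ?case
    proof (cases "rsharp u x \<le> T * \<beta>")
      case True
      then have x0: "rsharp u x \<le> height 0" by (simp add: height_def)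
      have "Lip (v i) x \<le> min (\<rho> x) (2 * H * (T * \<beta>))" for i
      proof -
        have "rsharp u x \<le> height i" using x0 height_mono[of 0 i] by simp
        then have "Lip (v i) x \<le> Lip u x" "Lip (v i) x \<le> Lip (v 0) x" using elim x0 by auto
        moreover have "Lip (v 0) x \<le> 2 * H * height 0" by (rule Lip_le_lipschitz[OF truncation(1)])
        ultimately show ?thesis using rho(3)[of x] by (simp add: height_def)
      qed
      then have "(\<Sum>i<k. (1 / real k) * Lip (v i) x) \<le> (\<Sum>i<k. (1 / real k) * min (\<rho> x) (2 * H * (T * \<beta>)))"
        by (intro sum_mono mult_left_mono) auto
      also have "\<dots> = min (\<rho> x) (2 * H * (T * \<beta>))" using k by simp
      finally have "Lip h x \<le> min (\<rho> x) (2 * H * (T * \<beta>))" using h by linarith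
      then show ?thesis using True Lip_nonneg[of h x] Q unfolding \<Psi>_def by (auto intro: powr_mono2)
    next
      case False
      let ?S = "rsharp u x"
      let ?b = "if ?S \<le> height k then \<rho> x else 0"
      have "Lip (v i) x \<le> 2 * H * (if T * \<beta> * 2^i < ?S then T * \<beta> * 2^i else 0) + ?b" if i: "i < k" for i
      proof (cases "height i < ?S")
        case True
        have "Lip (v i) x \<le> 2 * H * height i" by (rule Lip_le_lipschitz[OF truncation(1)])
        moreover have "0 \<le> ?b" using rho(1)[of x] by (rule if_nonneg)
        moreover have "2 * H * (if T * \<beta> * 2^i < ?S then T * \<beta> * 2^i else 0) = 2 * H * height i"
          using True by (simp add: height_def)
        ultimately show ?thesis by linarith
      next
        case False
        then have "Lip (v i) x \<le> Lip u x" using elim by auto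
        moreover have "?b = \<rho> x" using False height_mono[of i k] i by simp
        moreover have "(if T * \<beta> * 2^i < ?S then T * \<beta> * 2^i else 0) = 0" using False by (simp add: height_def)
        ultimately show ?thesis using rho(3)[of x] by simp
      qed
      then have "(\<Sum>i<k. (1 / real k) * Lip (v i) x) \<le>
          (\<Sum>i<k. (1 / real k) * (2 * H * (if T * \<beta> * 2^i < ?S then T * \<beta> * 2^i else 0) + ?b))"
        by (intro sum_mono mult_left_mono) auto
      also have "\<dots> = 2 * H / k * (\<Sum>i<k. if T * \<beta> * 2^i < ?S then T * \<beta> * 2^i else 0) + ?b"
        by (rule scaled_sum) (use k in simp)
      also have "\<dots> \<le> 2 * H / k * (2 * min ?S (T * \<beta> * 2^k)) + ?b"
        using sum_dyadic_le[of "T * \<beta>" ?S k] False lam T H_ge1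
        by (intro add_right_mono mult_left_mono) auto
      finally have "Lip h x \<le> 4 * H / k * min ?S (height k) + ?b" using h unfolding height_def by simp
      then have "Lip h x powr Q \<le> (4 * H / k * min ?S (height k) + ?b) powr Q"
        using Lip_nonneg[of h x] Q by (intro powr_mono2) auto
      also have "\<dots> \<le> 2 powr Q * ((4 * H / k * min ?S (height k)) powr Q + ?b powr Q)"
        using H_ge1 height_pos[of k] rho(1) Q by (intro add_powr_le) auto
      finally show ?thesis using False unfolding \<Psi>_def by (simp split: if_splits)
    qed
  qed
qed

definition S1 :: "'a \<Rightarrow> real" where "S1 x = (if T * \<beta> < rsharp u x then rsharp u x else 0)"

lemma S1_integrable: "integrable \<mu> S1"
proof (rule bounded_integrable)
  show "S1 \<in> borel_measurable \<mu>" unfolding S1_def[abs_def] by measurable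
  show "\<bar>S1 x\<bar> \<le> 2 * L" for x
    using rsharp_le[OF u, of x] lipschitz_on_nonneg[OF u] unfolding S1_def by auto
qed

text \<open>When the large part \<open>S1\<close> of the sharp function has a small average,
  \<open>h\<close> keeps half of the oscillation of \<open>u\<close>, and the Poincare inequality
  for \<open>h\<close> forces its gradient to be large on the enlarged ball.\<close>

lemma good_ball:
  assumes r: "0 < r" "r \<le> 2" and osc: "\<beta> * r < mean_osc u z r"
    and good: "avg z r S1 < \<beta> / (32 * H)"
  shows "r powr Q \<le> 2 * K * (2 * CP / \<beta>) powr Q * (LINT x:ball z (\<Lambda> * r)|\<mu>. \<Psi>' x)"
proof -
  \<comment> \<open>Otherwise \<open>S1\<close> is at least \<open>\<beta>\<close> on the whole ball
    and so is its average. The point \<open>y\<close> anchors all truncations, since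
    \<open>v i y = u y\<close> for every \<open>i\<close>.\<close>
  have "\<exists>y\<in>ball z r. rsharp u y \<le> T * \<beta>"
  proof (rule ccontr)
    assume "\<not> ?thesis"
    then have *: "\<And>y. y \<in> ball z r \<Longrightarrow> T * \<beta> < rsharp u y" by force
    have "avg z r (\<lambda>x. \<beta>) \<le> avg z r S1"
    proof (rule avg_mono)
      fix x assume "x \<in> ball z r"
      moreover have "\<beta> \<le> T * \<beta>" using T lam by simp
      ultimately show "\<beta> \<le> S1 x" using *[of x] unfolding S1_def by simp
    qed (use S1_integrable in auto)
    moreover have "\<beta> / (32 * H) \<le> \<beta>" using H_ge1 lam by (simp add: field_simps)
    ultimately show False using good r by (simp add: avg_const)
  qed
  then obtain y where y: "y \<in> ball z r" "rsharp u y \<le> T * \<beta>" by blast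
  \<comment> \<open>Where \<open>v i\<close> differs from \<open>u\<close>, both are compared with
    their common value at \<open>y\<close>. The points are at distance at most 2r, and the sharp
    function at \<open>y\<close> and \<open>height i\<close> are both below the sharp function at
    \<open>x\<close>, so each difference is at most 4 H r times the latter.\<close>
  have vi: "\<bar>u x - v i x\<bar> \<le> 8 * H * r * S1 x" if x: "x \<in> ball z r" for x i
  proof (cases "rsharp u x \<le> height i")
    case True
    moreover have "0 \<le> S1 x" unfolding S1_def by simp
    ultimately show ?thesis using H_ge1 r by (simp add: truncation)
  next
    case False
    have Tl: "T * \<beta> \<le> height i" using height_mono[of 0 i] by (simp add: height_def)
    then have S: "S1 x = rsharp u x" "height i \<le> rsharp u x" "rsharp u y \<le> rsharp u x" "rsharp u y \<le> height i"
      using False y unfolding S1_def by auto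
    have d: "dist x y \<le> 2 * r" using x y(1) dist_triangle[of x y z] by (simp add: dist_commute)
    have "\<bar>u x - u y\<bar> \<le> H * dist x y * (rsharp u x + rsharp u y)" by (rule lipschitz_hajlasz[OF u])
    also have "\<dots> \<le> H * (2 * r) * (rsharp u x + rsharp u x)"
      using d H_ge1 S r by (intro mult_mono add_mono mult_left_mono) auto
    finally have 1: "\<bar>u x - u y\<bar> \<le> 4 * H * r * rsharp u x" by simp
    have "\<bar>v i x - v i y\<bar> \<le> 2 * H * height i * dist x y" by (rule lipschitz_on_abs_real[OF truncation(1)])
    also have "\<dots> \<le> 2 * H * rsharp u x * (2 * r)"
      using d H_ge1 S r height_pos[of i] by (intro mult_mono mult_left_mono) auto
    finally have "\<bar>v i x - v i y\<bar> \<le> 4 * H * r * rsharp u x" by (simp add: ac_simps)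
    moreover have "v i y = u y" using truncation(2) S by simp
    ultimately show ?thesis using 1 S(1) by simp
  qed
  obtain M where M: "M-lipschitz_on UNIV h" using h_lipschitz by blast
  have "avg z r (\<lambda>x. \<bar>u x - h x\<bar>) \<le> avg z r (\<lambda>x. 8 * H * r * S1 x)"
  proof (rule avg_mono)
    fix x assume x: "x \<in> ball z r"
    have "u x - h x = (\<Sum>i<k. (1 / real k) * (u x - v i x))"
      unfolding h_def using k by (simp add: right_diff_distrib sum_subtractf)
    also have "\<bar>\<dots>\<bar> \<le> (\<Sum>i<k. \<bar>(1 / real k) * (u x - v i x)\<bar>)" by (rule sum_abs)
    also have "\<dots> = (\<Sum>i<k. (1 / real k) * \<bar>u x - v i x\<bar>)" by (simp add: abs_mult)
    also have "\<dots> \<le> (\<Sum>i<k. (1 / real k) * (8 * H * r * S1 x))"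
      by (intro sum_mono mult_left_mono vi[OF x]) auto
    also have "\<dots> = 8 * H * r * S1 x" using k by simp
    finally show "\<bar>u x - h x\<bar> \<le> 8 * H * r * S1 x" .
  qed (use S1_integrable lipschitz_integrable[OF u] lipschitz_integrable[OF M] in auto)
  also have "\<dots> = 8 * H * r * avg z r S1" by (rule avg_cmult)
  \<comment> \<open>The threshold \<beta>/(32 H) is made for this line: the result is r \<beta>/4,
    and replacing \<open>u\<close> by \<open>h\<close> in the mean oscillation costs twice
    that.\<close>
  also have "\<dots> \<le> 8 * H * r * (\<beta> / (32 * H))" using good r H_ge1 by (intro mult_left_mono) auto
  also have "\<dots> = r * \<beta> / 4" using H_ge1 by simp
  finally have "avg z r (\<lambda>x. \<bar>u x - h x\<bar>) \<le> r * \<beta> / 4" .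
  then have "\<beta> * r / 2 < mean_osc h z r"
    using mean_osc_diff_le[OF lipschitz_integrable[OF u] lipschitz_integrable[OF M] r(1), of z] osc
    by (simp add: mult.commute[of r])
  also have "mean_osc h z r \<le> CP * r * avg z (\<Lambda> * r) (\<lambda>x. Lip h x powr Q) powr (1 / Q)"
    by (rule poincare[OF M r(1)])
  finally have 1: "\<beta> / (2 * CP) < avg z (\<Lambda> * r) (\<lambda>x. Lip h x powr Q) powr (1 / Q)"
    using r CP by (simp add: field_simps)
  define A where "A = avg z (\<Lambda> * r) (\<lambda>x. Lip h x powr Q)"
  have A0: "0 \<le> A" unfolding A_def by (rule avg_nonneg) simp
  have "(\<beta> / (2 * CP)) powr Q \<le> (A powr (1 / Q)) powr Q"
    using 1 lam CP Q unfolding A_def by (intro powr_mono2) auto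
  also have "\<dots> = A" using A0 Q by (simp add: powr_powr)
  finally have A: "(\<beta> / (2 * CP)) powr Q \<le> A" .
  let ?B = "ball z (\<Lambda> * r)"
  have Lr: "0 < \<Lambda> * r" using r Lam by simp
  have "(\<beta> / (2 * CP)) powr Q * measure \<mu> ?B \<le> A * measure \<mu> ?B" using A by (intro mult_right_mono) auto
  also have "\<dots> = (LINT x:?B|\<mu>. Lip h x powr Q)" unfolding A_def by (rule avg_mult_measure[OF Lr])
  also have "\<dots> \<le> (LINT x:?B|\<mu>. \<Psi>' x + (\<beta> / (4 * CP)) powr Q)"
    unfolding set_lebesgue_integral_def
  proof (rule integral_mono_AE_nonneg)
    show "AE x in \<mu>. indicator ?B x *\<^sub>R Lip h x powr Q \<le> indicator ?B x *\<^sub>R (\<Psi>' x + (\<beta> / (4 * CP)) powr Q)"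
      using Lip_h_le
    proof eventually_elim
      case (elim x)
      have "\<Psi> x \<le> \<Psi>' x + (\<beta> / (4 * CP)) powr Q"
      proof (cases "rsharp u x \<le> T * \<beta> \<and> \<rho> x \<le> \<beta> / (4 * CP)")
        case True
        have "min (\<rho> x) (2 * H * (T * \<beta>)) powr Q \<le> (\<beta> / (4 * CP)) powr Q"
          using True rho(1)[of x] Q H_ge1 T lam by (intro powr_mono2) auto
        then show ?thesis using True unfolding \<Psi>'_def \<Psi>_def by simp
      next
        case False
        then show ?thesis unfolding \<Psi>'_def by auto
      qed
      then show ?case using elim by (auto split: split_indicator)
    qed
    show "AE x in \<mu>. 0 \<le> indicator ?B x *\<^sub>R (\<Psi>' x + (\<beta> / (4 * CP)) powr Q)"
      using Psi_nonneg(2) by (auto intro!: AE_I2 add_nonneg_nonneg)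
    show "integrable \<mu> (\<lambda>x. indicator ?B x *\<^sub>R (\<Psi>' x + (\<beta> / (4 * CP)) powr Q))"
      using Psi_integrable by (intro integrable_mult_indicator) auto
  qed
  also have "\<dots> = (LINT x:?B|\<mu>. \<Psi>' x) + (\<beta> / (4 * CP)) powr Q * measure \<mu> ?B"
    using Psi_integrable by (subst set_integral_add(2)) (auto intro!: sint simp: set_lebesgue_integral_def)
  \<comment> \<open>The discarded points contribute at most half of the lower bound because (1/2)^Q
    \<le> 1/2; the other half remains for \<open>\<Psi>'\<close>.\<close>
  also have "(\<beta> / (4 * CP)) powr Q \<le> 1/2 * (\<beta> / (2 * CP)) powr Q"
  proof -
    have "(\<beta> / (4 * CP)) powr Q = (1/2 * (\<beta> / (2 * CP))) powr Q" by simp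
    also have "\<dots> = (1/2) powr Q * (\<beta> / (2 * CP)) powr Q" using lam CP by (subst powr_mult) auto
    also have "\<dots> \<le> (1/2) powr 1 * (\<beta> / (2 * CP)) powr Q" using Q by (intro mult_right_mono powr_mono') auto
    finally show ?thesis by simp
  qed
  finally have 2: "1/2 * (\<beta> / (2 * CP)) powr Q * measure \<mu> ?B \<le> (LINT x:?B|\<mu>. \<Psi>' x)"
    by (simp add: mult_right_mono)
  have "r powr Q \<le> K * measure \<mu> (ball z r)" using r by (rule lower)
  also have "\<dots> \<le> K * measure \<mu> ?B"
    using K r Lam by (intro mult_left_mono finite_measure_mono subset_ball) auto
  also have "\<dots> = 2 * K * (2 * CP / \<beta>) powr Q * (1/2 * (\<beta> / (2 * CP)) powr Q * measure \<mu> ?B)"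
    using lam CP by (simp add: powr_divide powr_mult)
  also have "\<dots> \<le> 2 * K * (2 * CP / \<beta>) powr Q * (LINT x:?B|\<mu>. \<Psi>' x)"
    using 2 K by (intro mult_left_mono) auto
  finally show ?thesis .
qed

text \<open>Every point of the level set lies in a ball of large oscillation, either bad (large
  average of \<open>S1\<close>) or good. The covering lemma is applied to each family. The factor
  1/\<beta> from the bad balls turns \<beta>^Q into \<beta>^(Q-1), the source of the decay in
  \<open>T\<close>.\<close>

lemma level_estimate:
  "\<beta> powr Q * measure \<mu> {x. \<beta> < rsharp u x} \<le>
    K * 3 powr Q * (32 * H * K) * (LINT x|\<mu>. \<beta> powr (Q - 1) * S1 x) +
    K * (3 * \<Lambda>) powr Q * (2 * K * (2 * CP) powr Q) * (LINT x|\<mu>. \<Psi>' x)"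
proof -
  define B1 where "B1 = {(z, r). 0 < r \<and> r \<le> 2 \<and> \<beta> * r < mean_osc u z r \<and> \<beta> / (32 * H) \<le> avg z r S1}"
  define B2 where "B2 = {(z, r). 0 < r \<and> r \<le> 2 \<and> \<beta> * r < mean_osc u z r \<and> avg z r S1 < \<beta> / (32 * H)}"
  have S1n: "0 \<le> S1 x" for x unfolding S1_def by simp
  have 1: "measure \<mu> (\<Union>(z, r)\<in>B1. ball z r) \<le> K * (3 * 1) powr Q * (LINT x|\<mu>. 32 * H * K / \<beta> * S1 x)"
  proof (rule measure_covering)
    fix z r assume "(z, r) \<in> B1"
    then have zr: "0 < r" "r \<le> 2" "\<beta> / (32 * H) \<le> avg z r S1" by (auto simp: B1_def)
    have "r powr Q \<le> K * measure \<mu> (ball z r)" using zr by (intro lower)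
    also have "\<dots> = 32 * H * K / \<beta> * (\<beta> / (32 * H) * measure \<mu> (ball z r))" using lam H_ge1 by simp
    also have "\<dots> \<le> 32 * H * K / \<beta> * (avg z r S1 * measure \<mu> (ball z r))"
      using zr lam H_ge1 K by (intro mult_left_mono mult_right_mono) auto
    also have "\<dots> = (LINT x:ball z (1 * r)|\<mu>. 32 * H * K / \<beta> * S1 x)"
      using avg_mult_measure[OF zr(1), of z S1] by simp
    finally show "0 < r \<and> r powr Q \<le> (LINT x:ball z (1 * r)|\<mu>. 32 * H * K / \<beta> * S1 x)" using zr by simp
  qed (use S1_integrable S1n lam H_ge1 K in auto)
  have 2: "measure \<mu> (\<Union>(z, r)\<in>B2. ball z r) \<le>
    K * (3 * \<Lambda>) powr Q * (LINT x|\<mu>. 2 * K * (2 * CP / \<beta>) powr Q * \<Psi>' x)"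
  proof (rule measure_covering)
    fix z r assume "(z, r) \<in> B2"
    then have "0 < r" "r \<le> 2" "\<beta> * r < mean_osc u z r" "avg z r S1 < \<beta> / (32 * H)" by (auto simp: B2_def)
    then show "0 < r \<and> r powr Q \<le> (LINT x:ball z (\<Lambda> * r)|\<mu>. 2 * K * (2 * CP / \<beta>) powr Q * \<Psi>' x)"
      using good_ball[of r z] by simp
  qed (use Psi_integrable Psi_nonneg Lam K in auto)
  have "{x. \<beta> < rsharp u x} \<subseteq> (\<Union>(z, r)\<in>B1. ball z r) \<union> (\<Union>(z, r)\<in>B2. ball z r)"
  proof
    fix x assume "x \<in> {x. \<beta> < rsharp u x}"
    then have "ennreal \<beta> < ennreal (rsharp u x)" using lam by (simp add: ennreal_less_iff)
    then have "ennreal \<beta> < sharp u x" using sharp_lipschitz_fin[OF u] by simp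
    then obtain z r where zr: "x \<in> ball z r" "0 < r" "r \<le> 2" "ennreal \<beta> < ennreal (mean_osc u z r / r)"
      by (rule sharp_gt)
    then have "\<beta> * r < mean_osc u z r" using lam by (simp add: ennreal_less_iff field_simps)
    then have "(z, r) \<in> B1 \<union> B2" using zr unfolding B1_def B2_def by auto
    then show "x \<in> (\<Union>(z, r)\<in>B1. ball z r) \<union> (\<Union>(z, r)\<in>B2. ball z r)" using zr(1) by blast
  qed
  moreover have oB: "open (\<Union>(z, r)\<in>B. ball z r)" for B :: "('a \<times> real) set" by auto
  ultimately have "measure \<mu> {x. \<beta> < rsharp u x} \<le> measure \<mu> ((\<Union>(z, r)\<in>B1. ball z r) \<union> (\<Union>(z, r)\<in>B2. ball z r))"
    by (intro finite_measure_mono open_meas open_Un) auto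
  also have "\<dots> \<le> measure \<mu> (\<Union>(z, r)\<in>B1. ball z r) + measure \<mu> (\<Union>(z, r)\<in>B2. ball z r)"
    by (intro measure_Un_le open_meas oB)
  finally have "measure \<mu> {x. \<beta> < rsharp u x} \<le> K * 3 powr Q * (32 * H * K / \<beta>) * (LINT x|\<mu>. S1 x)
      + K * (3 * \<Lambda>) powr Q * (2 * K * (2 * CP / \<beta>) powr Q) * (LINT x|\<mu>. \<Psi>' x)"
    using 1 2 by simp
  then have "\<beta> powr Q * measure \<mu> {x. \<beta> < rsharp u x} \<le> \<beta> powr Q * (K * 3 powr Q * (32 * H * K / \<beta>) * (LINT x|\<mu>. S1 x)
      + K * (3 * \<Lambda>) powr Q * (2 * K * (2 * CP / \<beta>) powr Q) * (LINT x|\<mu>. \<Psi>' x))"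
    by (intro mult_left_mono) auto
  also have "\<dots> = K * 3 powr Q * (32 * H * K) * (LINT x|\<mu>. \<beta> powr (Q - 1) * S1 x) +
    K * (3 * \<Lambda>) powr Q * (2 * K * (2 * CP) powr Q) * (LINT x|\<mu>. \<Psi>' x)"
    using lam CP by (simp add: powr_diff powr_divide algebra_simps)
  finally show ?thesis .
qed

end

section \<open>Summation over dyadic heights and absorption\<close>

lemma sum_affine:
  fixes a b c r s :: real
  shows "(\<Sum>m\<in>I. a * p m + b * (c * (w m * s + q m) + w m * r)) =
    a * sum p I + b * (c * (sum w I * s + sum q I) + sum w I * r)"
  by (simp only: sum.distrib sum_distrib_left[symmetric] sum_distrib_right[symmetric])

definition geom_const :: "real \<Rightarrow> real" where "geom_const q = 2 powr q / (2 powr q - 1)"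

lemma geom_const_nonneg: "0 < q \<Longrightarrow> 0 \<le> geom_const q"
proof -
  assume "0 < q"
  then have "1 < 2 powr q" by simp
  then show ?thesis unfolding geom_const_def by (intro divide_nonneg_nonneg) linarith+
qed

context ahlfors_poincare
begin

definition bad_const :: real where "bad_const = K * 3 powr Q * (32 * H * K)"
definition good_const :: real where "good_const = K * (3 * \<Lambda>) powr Q * (2 * K * (2 * CP) powr Q)"

lemma bad_const_good_const_nonneg: "0 \<le> bad_const" "0 \<le> good_const"
  unfolding bad_const_def good_const_def using K H_ge1 by auto

text \<open>The estimate at one height is inserted into the dyadic layer-cake formula. On the right
  the integral of the sharp function reappears with one coefficient of order T^(1-Q) from bad balls
  and one of order k^(1-Q) from good balls.\<close>

lemma strong_type_scale:
  assumes u: "L-lipschitz_on UNIV u" and rho_meas [measurable]: "\<rho> \<in> borel_measurable \<mu>"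
    and rho: "\<And>x. 0 \<le> \<rho> x" "\<And>x. \<rho> x \<le> R" "\<And>x. Lip u x \<le> \<rho> x"
    and T: "1 \<le> T" and k: "1 \<le> k" and tau: "0 < \<tau>"
  shows "(LINT x|\<mu>. rsharp u x powr Q) \<le> \<tau> powr Q * measure \<mu> UNIV +
    2 powr Q * ((bad_const * geom_const (Q - 1) * T powr (1 - Q) + good_const * (2 powr Q * ((4 * H / real k) powr Q * (real k + geom_const Q)))) *
        (LINT x|\<mu>. rsharp u x powr Q) +
      good_const * ((2 * H * T) powr Q * (geom_const Q * (4 * CP) powr Q) + 2 powr Q * k) * (LINT x|\<mu>. \<rho> x powr Q))"
proof -
  \<comment> \<open>Heights up to \<tau> 2^M exceed the bound 2 L for the sharp function. Neither
    \<open>M\<close> nor \<open>L\<close> enters the final constants.\<close>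
  obtain M :: nat where "2 * L / \<tau> < 2^M" using real_arch_pow[of 2 "2 * L / \<tau>"] by auto
  then have M: "rsharp u x \<le> \<tau> * 2^M" for x using rsharp_le[OF u, of x] tau by (simp add: field_simps)
  define b where "b = (\<lambda>m::nat. \<tau> * 2^m)"
  have b: "0 < b m" for m unfolding b_def using tau by simp
  interpret a: averaged_truncation \<mu> Q K CP \<Lambda> u L \<rho> R "b m" T k for m
    by unfold_locales (use u rho T k b in auto)
  define S where "S = rsharp u"
  have S0: "0 \<le> S x" "S x \<le> 2 * L" for x unfolding S_def using rsharp_le[OF u] by auto
  have [measurable]: "S \<in> borel_measurable \<mu>" unfolding S_def by measurable
  have intS: "integrable \<mu> (\<lambda>x. S x powr Q)"
    using S0 Q by (intro bounded_integrable[where B = "(2 * L) powr Q"]) (auto intro!: powr_mono2)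
  have intR: "integrable \<mu> (\<lambda>x. \<rho> x powr Q)"
    using rho Q by (intro bounded_integrable[where B = "R powr Q"]) (auto intro!: powr_mono2)
  \<comment> \<open>Only heights with T \<beta> below the sharp function count. Since \<beta>^(Q-1)
    = T^(1-Q) (T \<beta>)^(Q-1), the geometric series in T \<beta> leaves the factor
    T^(1-Q).\<close>
  have pt1: "(\<Sum>m<M. b m powr (Q - 1) * a.S1 m x) \<le> geom_const (Q - 1) * T powr (1 - Q) * S x powr Q" for x
  proof -
    have e: "b m powr (Q - 1) * a.S1 m x =
        T powr (1 - Q) * S x * (if (T * \<tau>) * 2^m < S x then ((T * \<tau>) * 2^m) powr (Q - 1) else 0)" for m
    proof -
      have "((T * \<tau>) * 2^m) powr (Q - 1) = T powr (Q - 1) * b m powr (Q - 1)"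
        unfolding b_def using T tau by (simp add: mult.assoc powr_mult)
      moreover have "T powr (1 - Q) * T powr (Q - 1) = 1" using T by (simp flip: powr_add)
      ultimately have e1: "T powr (1 - Q) * S x * ((T * \<tau>) * 2^m) powr (Q - 1) = b m powr (Q - 1) * S x"
        by (simp add: ac_simps)
      have e2: "T * b m = (T * \<tau>) * 2^m" unfolding b_def by simp
      show ?thesis
      proof (cases "(T * \<tau>) * 2^m < S x")
        case True
        then have "a.S1 m x = S x" unfolding a.S1_def e2 S_def by simp
        then show ?thesis unfolding if_P[OF True] e1 by simp
      next
        case False
        then have "a.S1 m x = 0" unfolding a.S1_def e2 S_def by simp
        then show ?thesis using False by simp
      qed
    qed
    have "(\<Sum>m<M. b m powr (Q - 1) * a.S1 m x) =
        T powr (1 - Q) * S x * (\<Sum>m<M. if (T * \<tau>) * 2^m < S x then ((T * \<tau>) * 2^m) powr (Q - 1) else 0)"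
      unfolding e sum_distrib_left ..
    also have "\<dots> \<le> T powr (1 - Q) * S x * (geom_const (Q - 1) * S x powr (Q - 1))"
      using sum_dyadic_powr_le[of "T * \<tau>" "S x" "Q - 1" M] T tau S0 Q
      unfolding geom_const_def by (intro mult_left_mono) auto
    also have "\<dots> = geom_const (Q - 1) * T powr (1 - Q) * S x powr Q"
      using S0(1)[of x] Q by (cases "S x = 0") (auto simp: powr_diff)
    finally show ?thesis .
  qed
  have pt2: "(\<Sum>m<M. a.\<Psi>' m x) \<le> 2 powr Q * ((4 * H / real k) powr Q * (real k + geom_const Q)) * S x powr Q +
      ((2 * H * T) powr Q * (geom_const Q * (4 * CP) powr Q) + 2 powr Q * k) * \<rho> x powr Q" for x
  proof -
    \<comment> \<open>For a fixed point the heights fall into three groups: \<open>p\<close> those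
      below 4 CP \<open>\<rho>\<close>, \<open>w\<close> the at most \<open>k\<close> heights for
      which the sharp function lies in the range of the truncations, and \<open>q\<close> those for
      which it exceeds all of them. With the factor (4 H/k)^Q the last two contribute orders k^(1-Q)
      and k^(-Q).\<close>
    define w where "w = (\<lambda>m. if (T * \<tau>) * 2^m < S x \<and> S x \<le> 2^k * ((T * \<tau>) * 2^m) then 1 else (0::real))"
    define p where "p = (\<lambda>m::nat. if \<tau> * 2^m < 4 * CP * \<rho> x then (\<tau> * 2^m) powr Q else 0)"
    define q where "q = (\<lambda>m::nat. if (2^k * (T * \<tau>)) * 2^m < S x then ((2^k * (T * \<tau>)) * 2^m) powr Q else 0)"
    have pq: "0 \<le> w m" "0 \<le> p m" "0 \<le> q m" for m unfolding w_def p_def q_def by auto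
    have tmk: "a.height m k = 2^k * ((T * \<tau>) * 2^m)" "a.height m k = (2^k * (T * \<tau>)) * 2^m" for m
      unfolding a.height_def unfolding b_def by (simp_all add: ac_simps)
    have Tb: "T * b m = (T * \<tau>) * 2^m" for m unfolding b_def by simp
    have "a.\<Psi>' m x \<le> (2 * H * T) powr Q * p m +
        2 powr Q * ((4 * H / real k) powr Q * (w m * S x powr Q + q m) + w m * \<rho> x powr Q)" for m
    proof (cases "S x \<le> T * b m")
      case True
      have rest: "0 \<le> 2 powr Q * ((4 * H / real k) powr Q * (w m * S x powr Q + q m) + w m * \<rho> x powr Q)"
        using pq by (intro mult_nonneg_nonneg add_nonneg_nonneg) auto
      show ?thesis
      proof (cases "\<rho> x \<le> b m / (4 * CP)")
        case True
        then have "a.\<Psi>' m x = 0" using \<open>S x \<le> T * b m\<close> unfolding a.\<Psi>'_def S_def by simp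
        moreover have "0 \<le> (2 * H * T) powr Q * p m" using pq by (intro mult_nonneg_nonneg) auto
        ultimately show ?thesis using rest by linarith
      next
        case False
        then have pm: "p m = b m powr Q" unfolding p_def b_def using CP by (simp add: field_simps)
        have "a.\<Psi>' m x = min (\<rho> x) (2 * H * (T * b m)) powr Q"
          using False \<open>S x \<le> T * b m\<close> unfolding a.\<Psi>'_def a.\<Psi>_def S_def by simp
        also have "\<dots> \<le> (2 * H * T * b m) powr Q"
          using rho(1)[of x] H_ge1 T b[of m] Q by (intro powr_mono2) (auto simp: ac_simps)
        also have "\<dots> = (2 * H * T) powr Q * p m" unfolding pm using H_ge1 T b[of m] by (subst powr_mult) auto
        finally show ?thesis using rest by linarith
      qed
    next
      case False
      have "a.\<Psi>' m x = 2 powr Q * ((4 * H / k * min (S x) (a.height m k)) powr Q +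
          (if S x \<le> a.height m k then \<rho> x powr Q else 0))"
        using False unfolding a.\<Psi>'_def a.\<Psi>_def S_def by auto
      also have "\<dots> \<le> 2 powr Q * ((4 * H / real k) powr Q * (w m * S x powr Q + q m) + w m * \<rho> x powr Q)"
      proof (intro mult_left_mono add_mono)
        have "(4 * H / k * min (S x) (a.height m k)) powr Q = (4 * H / k) powr Q * min (S x) (a.height m k) powr Q"
          using H_ge1 S0 a.height_pos[of m k] by (subst powr_mult) auto
        also have "\<dots> \<le> (4 * H / real k) powr Q * (w m * S x powr Q + q m)"
        proof (intro mult_left_mono)
          show "min (S x) (a.height m k) powr Q \<le> w m * S x powr Q + q m"
          proof (cases "S x \<le> a.height m k")
            case True
            then have "w m = 1" using False unfolding w_def tmk(1) Tb by simp
            then show ?thesis using True pq[of m] by simp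
          next
            case False
            then have "q m = a.height m k powr Q" unfolding q_def tmk(2) by simp
            then show ?thesis using False pq[of m] by (simp add: min_def)
          qed
        qed simp
        finally show "(4 * H / k * min (S x) (a.height m k)) powr Q \<le> (4 * H / real k) powr Q * (w m * S x powr Q + q m)" .
        show "(if S x \<le> a.height m k then \<rho> x powr Q else 0) \<le> w m * \<rho> x powr Q"
        proof (cases "S x \<le> a.height m k")
          case True
          then have "w m = 1" using False unfolding w_def tmk(1) Tb by simp
          then show ?thesis using True by simp
        next
          case False
          then show ?thesis using pq[of m] by simp
        qed
      qed simp
      moreover have "0 \<le> (2 * H * T) powr Q * p m" using pq by (intro mult_nonneg_nonneg) auto
      ultimately show ?thesis by linarith
    qed
    then have "(\<Sum>m<M. a.\<Psi>' m x) \<le> (\<Sum>m<M. (2 * H * T) powr Q * p m +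
        2 powr Q * ((4 * H / real k) powr Q * (w m * S x powr Q + q m) + w m * \<rho> x powr Q))"
      by (intro sum_mono)
    also have "\<dots> = (2 * H * T) powr Q * sum p {..<M} +
        2 powr Q * ((4 * H / real k) powr Q * (sum w {..<M} * S x powr Q + sum q {..<M}) + sum w {..<M} * \<rho> x powr Q)"
      by (rule sum_affine)
    also have "\<dots> \<le> (2 * H * T) powr Q * (geom_const Q * (4 * CP * \<rho> x) powr Q) +
        2 powr Q * ((4 * H / real k) powr Q * (real k * S x powr Q + geom_const Q * S x powr Q) + real k * \<rho> x powr Q)"
    proof -
      have "sum w {..<M} \<le> real k"
        unfolding w_def using card_dyadic_window_le[of "T * \<tau>" "S x" k M] T tau by simp
      moreover have "sum p {..<M} \<le> geom_const Q * (4 * CP * \<rho> x) powr Q"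
        unfolding p_def geom_const_def using sum_dyadic_powr_le[of \<tau> "4 * CP * \<rho> x" Q M] tau CP rho(1)[of x] Q by simp
      moreover have "sum q {..<M} \<le> geom_const Q * S x powr Q"
        unfolding q_def geom_const_def using sum_dyadic_powr_le[of "2^k * (T * \<tau>)" "S x" Q M] tau T S0(1)[of x] Q by simp
      ultimately show ?thesis
        by (intro add_mono mult_left_mono mult_right_mono) auto
    qed
    also have "(4 * CP * \<rho> x) powr Q = (4 * CP) powr Q * \<rho> x powr Q" using CP rho(1)[of x] by (subst powr_mult) auto
    finally show ?thesis by (simp add: algebra_simps)
  qed
  have Sm: "{x. b m < S x} \<in> sets \<mu>" for m
  proof -
    have "{x \<in> space \<mu>. b m < S x} \<in> sets \<mu>" by measurable
    then show ?thesis by simp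
  qed
  have ind: "integrable \<mu> (\<lambda>x. indicator {x. b m < S x} x :: real)" for m
    using Sm[of m] by (intro integrable_real_indicator) (auto simp: emeasure_eq_measure)
  have "(LINT x|\<mu>. S x powr Q) \<le> (LINT x|\<mu>. \<tau> powr Q + 2 powr Q * (\<Sum>m<M. b m powr Q * indicator {x. b m < S x} x))"
  proof (rule integral_mono)
    fix x
    have "S x powr Q \<le> \<tau> powr Q + 2 powr Q * (\<Sum>m<M. if \<tau> * 2^m < S x then (\<tau> * 2^m) powr Q else 0)"
      using powr_le_sum_dyadic[of \<tau> "S x" Q M] tau S0 Q M[of x] unfolding S_def by simp
    also have "(\<Sum>m<M. if \<tau> * 2^m < S x then (\<tau> * 2^m) powr Q else 0) = (\<Sum>m<M. b m powr Q * indicator {x. b m < S x} x)"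
      unfolding b_def by (intro sum.cong) auto
    finally show "S x powr Q \<le> \<tau> powr Q + 2 powr Q * (\<Sum>m<M. b m powr Q * indicator {x. b m < S x} x)" .
  next
    show "integrable \<mu> (\<lambda>x. \<tau> powr Q + 2 powr Q * (\<Sum>m<M. b m powr Q * indicator {x. b m < S x} x))"
      by (intro Bochner_Integration.integrable_add integrable_const integrable_mult_right
          Bochner_Integration.integrable_sum ind)
  qed (rule intS)
  also have "\<dots> = \<tau> powr Q * measure \<mu> UNIV + 2 powr Q * (\<Sum>m<M. b m powr Q * measure \<mu> {x. b m < S x})"
    using ind Sm by (subst Bochner_Integration.integral_add) (auto simp: Bochner_Integration.integral_sum simp del: sum_mult_indicator)
  also have "(\<Sum>m<M. b m powr Q * measure \<mu> {x. b m < S x}) \<le>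
      (\<Sum>m<M. bad_const * (LINT x|\<mu>. b m powr (Q - 1) * a.S1 m x) + good_const * (LINT x|\<mu>. a.\<Psi>' m x))"
    unfolding S_def bad_const_def good_const_def by (intro sum_mono a.level_estimate)
  also have "\<dots> = bad_const * (LINT x|\<mu>. (\<Sum>m<M. b m powr (Q - 1) * a.S1 m x)) + good_const * (LINT x|\<mu>. (\<Sum>m<M. a.\<Psi>' m x))"
    using a.S1_integrable a.Psi_integrable
    by (simp add: sum.distrib sum_distrib_left Bochner_Integration.integral_sum)
  also have "\<dots> \<le> bad_const * (LINT x|\<mu>. geom_const (Q - 1) * T powr (1 - Q) * S x powr Q) +
     good_const * (LINT x|\<mu>. 2 powr Q * ((4 * H / real k) powr Q * (real k + geom_const Q)) * S x powr Q +
      ((2 * H * T) powr Q * (geom_const Q * (4 * CP) powr Q) + 2 powr Q * k) * \<rho> x powr Q)"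
    using bad_const_good_const_nonneg a.S1_integrable a.Psi_integrable intS intR pt1 pt2
    by (intro add_mono mult_left_mono integral_mono) auto
  also have "\<dots> = bad_const * (geom_const (Q - 1) * T powr (1 - Q) * (LINT x|\<mu>. S x powr Q)) +
     good_const * (2 powr Q * ((4 * H / real k) powr Q * (real k + geom_const Q)) * (LINT x|\<mu>. S x powr Q) +
      ((2 * H * T) powr Q * (geom_const Q * (4 * CP) powr Q) + 2 powr Q * k) * (LINT x|\<mu>. \<rho> x powr Q))"
    using intS intR by (subst Bochner_Integration.integral_add) auto
  finally show ?thesis unfolding S_def by (simp add: algebra_simps)
qed

text \<open>The sharp function of a Lipschitz function is bounded, so the terms with a small coefficient
  may be absorbed.\<close>

lemma strong_type:
  "\<exists>C\<ge>0. \<forall>u L \<rho> R. L-lipschitz_on UNIV u \<longrightarrow> \<rho> \<in> borel_measurable \<mu> \<longrightarrow>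
     (\<forall>x. 0 \<le> \<rho> x \<and> \<rho> x \<le> R \<and> Lip u x \<le> \<rho> x) \<longrightarrow>
     (LINT x|\<mu>. rsharp u x powr Q) \<le> C * (LINT x|\<mu>. \<rho> x powr Q)"
proof -
  \<comment> \<open>The two coefficients to be absorbed depend on \<open>T\<close> alone and on
    \<open>k\<close> alone, so each is brought below 1/4 separately. Both parameters may enlarge the
    coefficient of the integral of \<open>\<rho> powr Q\<close>.\<close>
  have "((\<lambda>T. 2 powr Q * (bad_const * geom_const (Q - 1) * T powr (1 - Q))) \<longlongrightarrow> 2 powr Q * (bad_const * geom_const (Q - 1) * 0)) at_top"
    using Q by (intro tendsto_intros tendsto_neg_powr filterlim_ident) auto
  then have "\<forall>\<^sub>F T in at_top. 2 powr Q * (bad_const * geom_const (Q - 1) * T powr (1 - Q)) < 1/4"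
    by (rule order_tendstoD(2)) simp
  then obtain T :: real where T: "1 \<le> T" "2 powr Q * (bad_const * geom_const (Q - 1) * T powr (1 - Q)) < 1/4"
    unfolding eventually_at_top_linorder by (metis max.cobounded1 max.cobounded2)
  have kq: "(4 * H / real k) powr Q * (real k + geom_const Q) = (4 * H) powr Q * (real k powr (1 - Q) + geom_const Q * real k powr (- Q))"
    if "1 \<le> k" for k :: nat
    using that H_ge1 by (simp add: powr_divide powr_diff powr_minus field_simps)
  have "((\<lambda>k. 2 powr Q * (good_const * (2 powr Q * ((4 * H) powr Q * (real k powr (1 - Q) + geom_const Q * real k powr (- Q))))))
     \<longlongrightarrow> 2 powr Q * (good_const * (2 powr Q * ((4 * H) powr Q * (0 + geom_const Q * 0))))) sequentially"
    using Q by (intro tendsto_intros tendsto_neg_powr filterlim_real_sequentially) auto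
  then have "\<forall>\<^sub>F k in sequentially. 2 powr Q * (good_const * (2 powr Q * ((4 * H) powr Q * (real k powr (1 - Q) + geom_const Q * real k powr (- Q))))) < 1/4"
    by (rule order_tendstoD(2)) simp
  then obtain k :: nat where k: "1 \<le> k"
    "2 powr Q * (good_const * (2 powr Q * ((4 * H) powr Q * (real k powr (1 - Q) + geom_const Q * real k powr (- Q))))) < 1/4"
    unfolding eventually_sequentially by (metis max.cobounded1 max.cobounded2)
  define M where "M = 2 powr Q * (good_const * ((2 * H * T) powr Q * (geom_const Q * (4 * CP) powr Q) + 2 powr Q * k))"
  have M0: "0 \<le> M" unfolding M_def using bad_const_good_const_nonneg geom_const_nonneg[of Q] Q by auto
  show ?thesis
  proof (intro exI[of _ "2 * M"] conjI allI impI)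
    fix u L \<rho> R
    assume u: "L-lipschitz_on UNIV u" "\<rho> \<in> borel_measurable \<mu>" "\<forall>x. 0 \<le> \<rho> x \<and> \<rho> x \<le> R \<and> Lip u x \<le> \<rho> x"
    define A where "A = (LINT x|\<mu>. rsharp u x powr Q)"
    define B where "B = (LINT x|\<mu>. \<rho> x powr Q)"
    have A0: "0 \<le> A" unfolding A_def by simp
    have "A \<le> \<tau> powr Q * measure \<mu> UNIV + 1/2 * A + M * B" if tau: "0 < \<tau>" for \<tau>
    proof -
      have "A \<le> \<tau> powr Q * measure \<mu> UNIV +
        2 powr Q * ((bad_const * geom_const (Q - 1) * T powr (1 - Q) + good_const * (2 powr Q * ((4 * H / real k) powr Q * (real k + geom_const Q)))) *
        A + good_const * ((2 * H * T) powr Q * (geom_const Q * (4 * CP) powr Q) + 2 powr Q * k) * B)"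
        unfolding A_def B_def using u T k tau by (intro strong_type_scale[where L = L and R = R]) auto
      also have "\<dots> = \<tau> powr Q * measure \<mu> UNIV +
        (2 powr Q * (bad_const * geom_const (Q - 1) * T powr (1 - Q)) + 2 powr Q * (good_const * (2 powr Q * ((4 * H / real k) powr Q * (real k + geom_const Q))))) * A + M * B"
        unfolding M_def by (simp add: algebra_simps)
      also have "\<dots> \<le> \<tau> powr Q * measure \<mu> UNIV + (1/4 + 1/4) * A + M * B"
        unfolding kq[OF k(1)]
        by (intro add_mono mult_right_mono less_imp_le[OF T(2)] less_imp_le[OF k(2)] A0 order_refl)
      finally show ?thesis by simp
    qed
    \<comment> \<open>Only the constant term depends on \<open>\<tau>\<close>; it vanishes as
      \<open>\<tau>\<close> tends to 0, and half of the finite quantity \<open>A\<close> is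
      absorbed.\<close>
    then have *: "\<forall>\<^sub>F \<tau> in at_right 0. A \<le> \<tau> powr Q * measure \<mu> UNIV + 1/2 * A + M * B"
      using eventually_at_right_less[of 0] by (auto elim: eventually_mono)
    have "((\<lambda>\<tau>. \<tau> powr Q * measure \<mu> UNIV + 1/2 * A + M * B) \<longlongrightarrow> 0 powr Q * measure \<mu> UNIV + 1/2 * A + M * B) (at_right 0)"
      using Q by (intro tendsto_intros tendsto_powr') (auto simp: eventually_at_right_less less_imp_le eventually_mono[OF eventually_at_right_less])
    from tendsto_lowerbound[OF this *] have "A \<le> 1/2 * A + M * B" by simp
    then show "A \<le> 2 * M * B" by simp
  qed (use M0 in simp)
qed

end

section \<open>Weak Lebesgue sequence spaces\<close>

lemma finite_card_le_of_subsets: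
  assumes "\<And>F. F \<subseteq> A \<Longrightarrow> finite F \<Longrightarrow> real (card F) \<le> B"
  shows "finite A \<and> real (card A) \<le> B"
proof -
  have "finite A"
  proof (rule ccontr)
    assume "infinite A"
    obtain n :: nat where n: "B < real n" using reals_Archimedean2 by blast
    obtain F where "F \<subseteq> A" "finite F" "card F = n" using infinite_arbitrarily_large[OF \<open>infinite A\<close>] by blast
    then show False using assms[of F] n by simp
  qed
  then show ?thesis using assms by blast
qed

lemma sum_inverse_powr_le:
  assumes a: "0 < a" "a < (1::real)"
  shows "(\<Sum>j=1..n. real j powr (- a)) \<le> real n powr (1 - a) / (1 - a)"
proof (induction n)
  case 0
  then show ?case by simp
next
  case (Suc n)
  show ?case
  proof (cases "n = 0")
    case True
    then show ?thesis using a by (simp add: field_simps)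
  next
    case False
    have "\<exists>z>real n. z < real (Suc n) \<and>
        real (Suc n) powr (1 - a) - real n powr (1 - a) = (real (Suc n) - real n) * ((1 - a) * z powr (1 - a - 1))"
    proof (rule MVT2)
      fix x assume "real n \<le> x"
      then show "((\<lambda>x. x powr (1 - a)) has_real_derivative (1 - a) * x powr (1 - a - 1)) (at x)"
        using False by (intro has_real_derivative_powr) linarith
    qed simp
    then obtain z where z: "real n < z" "z < real (Suc n)"
      "real (Suc n) powr (1 - a) - real n powr (1 - a) = (1 - a) * z powr (- a)" by auto
    have "real (Suc n) powr (- a) \<le> z powr (- a)"
      using z a False by (intro powr_mono2') auto
    then have "real (Suc n) powr (- a) \<le> (real (Suc n) powr (1 - a) - real n powr (1 - a)) / (1 - a)"
      using z(3) a by simp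
    then show ?thesis using Suc by (simp add: diff_divide_distrib)
  qed
qed

text \<open>This replaces the decreasing rearrangement: the smallest term of a subfamily is bounded in terms
  of its cardinality only, and one term at a time is removed.\<close>

lemma sum_le_by_removing_min:
  fixes s :: "'b \<Rightarrow> real"
  assumes "finite F"
    and "\<And>G j. G \<subseteq> F \<Longrightarrow> j \<in> G \<Longrightarrow> (\<And>i. i \<in> G \<Longrightarrow> s j \<le> s i) \<Longrightarrow> g (s j) \<le> b (card G)"
  shows "(\<Sum>j\<in>F. g (s j)) \<le> (\<Sum>j=1..card F. b j :: real)"
  using assms
proof (induction "card F" arbitrary: F)
  case 0
  then show ?case by simp
next
  case (Suc n)
  then have "F \<noteq> {}" by auto
  then have "Min (s ` F) \<in> s ` F" using Suc.prems(1) by (intro Min_in) auto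
  then obtain j where "j \<in> F" "s j = Min (s ` F)" by auto
  then have j: "j \<in> F" "\<And>i. i \<in> F \<Longrightarrow> s j \<le> s i" using Suc.prems(1) by auto
  have c: "card (F - {j}) = n" using Suc j by simp
  have "(\<Sum>j\<in>F - {j}. g (s j)) \<le> (\<Sum>j=1..card (F - {j}). b j)"
    by (rule Suc.hyps(1)) (use c Suc.prems in \<open>auto intro: Suc.prems(2)\<close>)
  moreover have "g (s j) \<le> b (card F)" using Suc.prems(2)[of F j] j by auto
  moreover have "(\<Sum>j\<in>F. g (s j)) = g (s j) + (\<Sum>j\<in>F - {j}. g (s j))"
    using Suc.prems(1) j by (simp add: sum.remove)
  moreover have "(\<Sum>j=1..card F. b j) = (\<Sum>j=1..card (F - {j}). b j) + b (card F)"
    using c Suc.hyps(2) by (simp flip: Suc.hyps(2))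
  ultimately show ?case by linarith
qed

text \<open>The n-th largest term is at most S n^(-1/p), and the sum of these powers has order
  n^(1-1/p) because p > 1.\<close>

lemma weak_type_sum_le:
  assumes p: "1 < p" and S: "0 \<le> S"
    and count: "\<And>t. 0 < t \<Longrightarrow> finite {m\<in>M. t < \<bar>s m\<bar>} \<and> real (card {m\<in>M. t < \<bar>s m\<bar>}) \<le> (S / t) powr p"
    and F: "F \<subseteq> M" "finite F"
  shows "(\<Sum>j\<in>F. \<bar>s j\<bar>) \<le> p / (p - 1) * S * real (card F) powr (1 - 1 / p)"
proof -
  have "(\<Sum>j\<in>F. \<bar>s j\<bar>) \<le> (\<Sum>j=1..card F. S * real j powr (- (1 / p)))"
  proof (rule sum_le_by_removing_min[where g = "\<lambda>x. x" and s = "\<lambda>j. \<bar>s j\<bar>", OF F(2)])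
    fix G j assume G: "G \<subseteq> F" "j \<in> G" "\<And>i. i \<in> G \<Longrightarrow> \<bar>s j\<bar> \<le> \<bar>s i\<bar>"
    have fG: "finite G" using G(1) F(2) finite_subset by blast
    then have n: "0 < card G" using G(2) by (simp add: card_gt_0_iff) blast
    show "\<bar>s j\<bar> \<le> S * real (card G) powr (- (1 / p))"
    \<comment> \<open>The counting bound concerns strict superlevel sets, so it is used for every
      \<open>t\<close> below the term and then passed to the limit.\<close>
    proof (rule dense_le)
      fix t assume t: "t < \<bar>s j\<bar>"
      show "t \<le> S * real (card G) powr (- (1 / p))"
      proof (cases "0 < t")
        case True
        have "G \<subseteq> {m\<in>M. t < \<bar>s m\<bar>}" using G t F(1) by force
        then have "real (card G) \<le> real (card {m\<in>M. t < \<bar>s m\<bar>})" using count[OF True] by (simp add: card_mono)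
        also have "\<dots> \<le> (S / t) powr p" using count[OF True] by blast
        finally have "real (card G) powr (1 / p) \<le> ((S / t) powr p) powr (1 / p)"
          using p by (intro powr_mono2) auto
        also have "\<dots> = S / t" using p S True by (simp add: powr_powr)
        finally have "t * real (card G) powr (1 / p) \<le> S" using True by (simp add: field_simps)
        then show ?thesis using n by (simp add: powr_minus field_simps)
      next
        case False
        moreover have "0 \<le> S * real (card G) powr (- (1 / p))" using S by simp
        ultimately show ?thesis by linarith
      qed
    qed
  qed
  also have "\<dots> = S * (\<Sum>j=1..card F. real j powr (- (1 / p)))" by (simp add: sum_distrib_left)
  also have "\<dots> \<le> S * (real (card F) powr (1 - 1 / p) / (1 - 1 / p))"
    using p S by (intro mult_left_mono sum_inverse_powr_le) auto
  also have "\<dots> = p / (p - 1) * S * real (card F) powr (1 - 1 / p)"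
    using p by (simp add: field_simps)
  finally show ?thesis .
qed

lemma weak_type_normalized_sum_le:
  assumes p: "1 < p" and S: "0 \<le> S"
    and count: "\<And>t. 0 < t \<Longrightarrow> finite {m\<in>M. t < \<bar>s m\<bar>} \<and> real (card {m\<in>M. t < \<bar>s m\<bar>}) \<le> (S / t) powr p"
    and F: "F \<subseteq> M" "finite F" "1 \<le> card F"
  shows "real (card F) powr (- 1 + 1 / p) * (\<Sum>j\<in>F. \<bar>s j\<bar>) \<le> p / (p - 1) * S"
proof -
  have "real (card F) powr (- 1 + 1 / p) * (\<Sum>j\<in>F. \<bar>s j\<bar>) \<le>
      real (card F) powr (- 1 + 1 / p) * (p / (p - 1) * S * real (card F) powr (1 - 1 / p))"
    using weak_type_sum_le[OF p S count F(1,2)] by (intro mult_left_mono) auto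
  also have "\<dots> = p / (p - 1) * S * (real (card F) powr (- 1 + 1 / p) * real (card F) powr (1 - 1 / p))" by simp
  also have "real (card F) powr (- 1 + 1 / p) * real (card F) powr (1 - 1 / p) = 1"
    using F(3) by (simp flip: powr_add)
  finally show ?thesis by simp
qed

lemma weak_lp_norm_le:
  assumes p: "1 < p" and S: "0 \<le> S" and M: "M \<noteq> {}"
    and count: "\<And>t. 0 < t \<Longrightarrow> finite {m\<in>M. t < \<bar>s m\<bar>} \<and> real (card {m\<in>M. t < \<bar>s m\<bar>}) \<le> (S / t) powr p"
  shows "weak_lp_norm p M s \<le> p / (p - 1) * S"
  unfolding weak_lp_norm_def
proof (rule cSup_least)
  obtain m where "m \<in> M" using M by blast
  then have "1 \<le> (1::nat) \<and> {m} \<subseteq> M \<and> finite {m} \<and> card {m} = 1" by auto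
  then show "{real n powr (- 1 + 1 / p) * (\<Sum>j\<in>F. \<bar>s j\<bar>) | n F.
            1 \<le> n \<and> F \<subseteq> M \<and> finite F \<and> card F = n} \<noteq> {}" by blast
next
  fix x assume "x \<in> {real n powr (- 1 + 1 / p) * (\<Sum>j\<in>F. \<bar>s j\<bar>) | n F.
            1 \<le> n \<and> F \<subseteq> M \<and> finite F \<and> card F = n}"
  then obtain F where F: "x = real (card F) powr (- 1 + 1 / p) * (\<Sum>j\<in>F. \<bar>s j\<bar>)" "1 \<le> card F" "F \<subseteq> M" "finite F"
    by blast
  show "x \<le> p / (p - 1) * S" unfolding F(1) by (rule weak_type_normalized_sum_le[OF p S count F(3,4,2)])
qed

text \<open>A real supremum dominates its elements only if the set is bounded above; membership in
  \<open>weak_lp\<close> provides this through the normalized sums.\<close>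

lemma weak_lp_norm_bounds:
  assumes p: "1 < p" and s: "s \<in> weak_lp p M" and F: "F \<subseteq> M" "finite F" "F \<noteq> {}"
  shows "(\<Sum>j\<in>F. \<bar>s j\<bar>) \<le> weak_lp_norm p M s * real (card F) powr (1 - 1 / p)"
proof -
  obtain S where S: "0 \<le> S" and
    count: "\<And>t. 0 < t \<Longrightarrow> finite {m\<in>M. t < \<bar>s m\<bar>} \<and> real (card {m\<in>M. t < \<bar>s m\<bar>}) \<le> (S / t) powr p"
    using s unfolding weak_lp_def by blast
  have n: "1 \<le> card F" using F by (simp add: Suc_leI card_gt_0_iff)
  have "real (card F) powr (- 1 + 1 / p) * (\<Sum>j\<in>F. \<bar>s j\<bar>) \<le> weak_lp_norm p M s"
    unfolding weak_lp_norm_def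
  proof (rule cSup_upper)
    show "real (card F) powr (- 1 + 1 / p) * (\<Sum>j\<in>F. \<bar>s j\<bar>) \<in> {real n powr (- 1 + 1 / p) * (\<Sum>j\<in>F. \<bar>s j\<bar>) | n F.
            1 \<le> n \<and> F \<subseteq> M \<and> finite F \<and> card F = n}" using F n by blast
    show "bdd_above {real n powr (- 1 + 1 / p) * (\<Sum>j\<in>F. \<bar>s j\<bar>) | n F.
            1 \<le> n \<and> F \<subseteq> M \<and> finite F \<and> card F = n}"
    proof (rule bdd_aboveI)
      fix x assume "x \<in> {real n powr (- 1 + 1 / p) * (\<Sum>j\<in>F. \<bar>s j\<bar>) | n F.
            1 \<le> n \<and> F \<subseteq> M \<and> finite F \<and> card F = n}"
      then obtain F where F: "x = real (card F) powr (- 1 + 1 / p) * (\<Sum>j\<in>F. \<bar>s j\<bar>)" "1 \<le> card F" "F \<subseteq> M" "finite F"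
        by blast
      show "x \<le> p / (p - 1) * S" unfolding F(1) by (rule weak_type_normalized_sum_le[OF p S count F(3,4,2)])
    qed
  qed
  then have "real (card F) powr (1 - 1 / p) * (real (card F) powr (- 1 + 1 / p) * (\<Sum>j\<in>F. \<bar>s j\<bar>))
      \<le> real (card F) powr (1 - 1 / p) * weak_lp_norm p M s" by (intro mult_left_mono) auto
  moreover have "real (card F) powr (1 - 1 / p) * real (card F) powr (- 1 + 1 / p) = 1"
    using n by (simp flip: powr_add)
  ultimately show ?thesis by (simp only: mult.assoc[symmetric] mult_1_left) (simp only: mult.commute)
qed

lemma weak_lp_norm_nonneg:
  assumes p: "1 < p" and s: "s \<in> weak_lp p M" and M: "M \<noteq> {}"
  shows "0 \<le> weak_lp_norm p M s"
proof -
  obtain m where "m \<in> M" using M by blast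
  then have "\<bar>s m\<bar> \<le> weak_lp_norm p M s" using weak_lp_norm_bounds[OF p s, of "{m}"] by simp
  then show ?thesis by linarith
qed

text \<open>The smallest of n terms is at most their mean, hence at most S n^(-1/p), and its p-th
  power is at most S^p/n. Removing minima one at a time adds these up to a harmonic number, the
  origin of the logarithm.\<close>

lemma sum_powr_le_harm:
  assumes p: "1 < p" and s: "s \<in> weak_lp p M" and F: "F \<subseteq> M" "finite F"
  shows "(\<Sum>j\<in>F. \<bar>s j\<bar> powr p) \<le> weak_lp_norm p M s powr p * harm (card F)"
proof -
  let ?S = "weak_lp_norm p M s"
  have "(\<Sum>j\<in>F. \<bar>s j\<bar> powr p) \<le> (\<Sum>j=1..card F. ?S powr p * inverse (real j))"
  proof (rule sum_le_by_removing_min[where g = "\<lambda>x. x powr p" and s = "\<lambda>j. \<bar>s j\<bar>", OF F(2)])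
    fix G j assume G: "G \<subseteq> F" "j \<in> G" "\<And>i. i \<in> G \<Longrightarrow> \<bar>s j\<bar> \<le> \<bar>s i\<bar>"
    have fG: "finite G" "G \<noteq> {}" "G \<subseteq> M" using G F finite_subset by auto
    then have n: "0 < card G" by (simp add: card_gt_0_iff)
    have S0: "0 \<le> ?S" using weak_lp_norm_nonneg[OF p s] fG by blast
    have "real (card G) * \<bar>s j\<bar> \<le> (\<Sum>i\<in>G. \<bar>s i\<bar>)" using sum_bounded_below[of G "\<bar>s j\<bar>" "\<lambda>i. \<bar>s i\<bar>"] G(3) by simp
    also have "\<dots> \<le> ?S * real (card G) powr (1 - 1 / p)" using fG by (intro weak_lp_norm_bounds p s)
    also have "\<dots> = real (card G) * (?S * real (card G) powr (- (1 / p)))"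
      using n by (simp add: powr_diff powr_minus field_simps)
    finally have "\<bar>s j\<bar> \<le> ?S * real (card G) powr (- (1 / p))" using n by simp
    then have "\<bar>s j\<bar> powr p \<le> (?S * real (card G) powr (- (1 / p))) powr p" using p by (intro powr_mono2) auto
    also have "\<dots> = ?S powr p * (real (card G) powr (- (1 / p))) powr p" using S0 by (subst powr_mult) auto
    also have "(real (card G) powr (- (1 / p))) powr p = inverse (real (card G))"
    proof -
      have "- (1 / p) * p = - 1" using p by simp
      then show ?thesis using n unfolding powr_powr by (simp add: powr_neg_one inverse_eq_divide)
    qed
    finally show "\<bar>s j\<bar> powr p \<le> ?S powr p * inverse (real (card G))" .
  qed
  then show ?thesis by (simp add: harm_def sum_distrib_left)
qed

lemma harm_le_ln: "1 \<le> n \<Longrightarrow> harm n \<le> 1 + ln (real n)"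
  using decseqD[OF decseq_harm_diff_ln, of 0 "n - 1"] by (simp add: harm_def)

section \<open>Density of Lipschitz functions and the geometry of the filling\<close>

context ahlfors
begin

text \<open>Approximability in L1 by Lipschitz functions, kept as a property of single functions so
  that closure under linear combinations and dominated limits feeds the induction over integrable
  functions.\<close>

definition lip_approx :: "('a \<Rightarrow> real) \<Rightarrow> bool" where
  "lip_approx f \<longleftrightarrow> integrable \<mu> f \<and>
     (\<forall>e>0. \<exists>h L. L-lipschitz_on UNIV h \<and> (LINT x|\<mu>. \<bar>f x - h x\<bar>) < e)"

lemma lip_approxE:
  assumes "lip_approx f" "0 < e"
  obtains h L where "L-lipschitz_on UNIV h" "(LINT x|\<mu>. \<bar>f x - h x\<bar>) < e"
  using assms unfolding lip_approx_def by blast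

lemma lip_approx_add:
  assumes f: "lip_approx f" and g: "lip_approx g" shows "lip_approx (\<lambda>x. f x + g x)"
  unfolding lip_approx_def
proof (intro conjI allI impI)
  have i: "integrable \<mu> f" "integrable \<mu> g" using f g by (auto simp: lip_approx_def)
  then show "integrable \<mu> (\<lambda>x. f x + g x)" by simp
  fix e :: real assume e: "0 < e"
  obtain h L where h: "L-lipschitz_on UNIV h" "(LINT x|\<mu>. \<bar>f x - h x\<bar>) < e / 2"
    using lip_approxE[OF f half_gt_zero[OF e]] .
  obtain k M where k: "M-lipschitz_on UNIV k" "(LINT x|\<mu>. \<bar>g x - k x\<bar>) < e / 2"
    using lip_approxE[OF g half_gt_zero[OF e]] .
  have ih: "integrable \<mu> h" "integrable \<mu> k" using h k lipschitz_integrable by auto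
  have "(LINT x|\<mu>. \<bar>f x + g x - (h x + k x)\<bar>) \<le> (LINT x|\<mu>. \<bar>f x - h x\<bar> + \<bar>g x - k x\<bar>)"
    using i ih by (intro integral_mono) auto
  also have "\<dots> = (LINT x|\<mu>. \<bar>f x - h x\<bar>) + (LINT x|\<mu>. \<bar>g x - k x\<bar>)"
    using i ih by (intro Bochner_Integration.integral_add) auto
  also have "\<dots> < e" using h k by simp
  finally show "\<exists>h L. L-lipschitz_on UNIV h \<and> (LINT x|\<mu>. \<bar>f x + g x - h x\<bar>) < e"
    using lipschitz_on_add[OF h(1) k(1)] by blast
qed

lemma lip_approx_lipschitz: "L-lipschitz_on UNIV f \<Longrightarrow> lip_approx f"
  unfolding lip_approx_def using lipschitz_integrable by (auto intro!: exI[of _ f])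

lemma lip_approx_cmult:
  assumes f: "lip_approx f" shows "lip_approx (\<lambda>x. c * f x)"
proof (cases "c = 0")
  case True
  then show ?thesis using lip_approx_lipschitz[OF lipschitz_on_constant, of 0] by simp
next
  case False
  show ?thesis unfolding lip_approx_def
  proof (intro conjI allI impI)
    have i: "integrable \<mu> f" using f by (auto simp: lip_approx_def)
    then show "integrable \<mu> (\<lambda>x. c * f x)" by simp
    fix e :: real assume e: "0 < e"
    obtain h L where h: "L-lipschitz_on UNIV h" "(LINT x|\<mu>. \<bar>f x - h x\<bar>) < e / \<bar>c\<bar>"
      by (rule lip_approxE[OF f, of "e / \<bar>c\<bar>"]) (use e False in auto)
    have "(LINT x|\<mu>. \<bar>c * f x - c * h x\<bar>) = (LINT x|\<mu>. \<bar>c\<bar> * \<bar>f x - h x\<bar>)"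
      by (simp flip: right_diff_distrib abs_mult)
    also have "\<dots> = \<bar>c\<bar> * (LINT x|\<mu>. \<bar>f x - h x\<bar>)" by simp
    also have "\<dots> < e" using h(2) False by (simp add: field_simps)
    finally show "\<exists>h L. L-lipschitz_on UNIV h \<and> (LINT x|\<mu>. \<bar>c * f x - h x\<bar>) < e"
      using lipschitz_on_cmult_real[OF h(1), of c] by blast
  qed
qed

lemma lip_approx_limit:
  assumes s: "\<And>n::nat. lip_approx (s n)" and f: "integrable \<mu> f"
    and lim: "(\<lambda>n. LINT x|\<mu>. \<bar>f x - s n x\<bar>) \<longlonglongrightarrow> 0"
  shows "lip_approx f"
  unfolding lip_approx_def
proof (intro conjI allI impI f)
  fix e :: real assume e: "0 < e"
  have "\<forall>\<^sub>F n in sequentially. (LINT x|\<mu>. \<bar>f x - s n x\<bar>) < e / 2"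
    by (rule order_tendstoD(2)[OF lim half_gt_zero[OF e]])
  then obtain n where n: "(LINT x|\<mu>. \<bar>f x - s n x\<bar>) < e / 2" by (auto simp: eventually_sequentially)
  obtain h L where h: "L-lipschitz_on UNIV h" "(LINT x|\<mu>. \<bar>s n x - h x\<bar>) < e / 2"
    using lip_approxE[OF s[of n] half_gt_zero[OF e]] .
  have i: "integrable \<mu> (s n)" "integrable \<mu> h" using s lipschitz_integrable[OF h(1)] by (auto simp: lip_approx_def)
  have "(LINT x|\<mu>. \<bar>f x - h x\<bar>) \<le> (LINT x|\<mu>. \<bar>f x - s n x\<bar> + \<bar>s n x - h x\<bar>)"
    using i f by (intro integral_mono) auto
  also have "\<dots> = (LINT x|\<mu>. \<bar>f x - s n x\<bar>) + (LINT x|\<mu>. \<bar>s n x - h x\<bar>)"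
    using i f by (intro Bochner_Integration.integral_add) auto
  finally show "\<exists>h L. L-lipschitz_on UNIV h \<and> (LINT x|\<mu>. \<bar>f x - h x\<bar>) < e" using h n by force
qed

lemma lip_approx_dominated:
  assumes s: "\<And>n::nat. lip_approx (s n)" and f: "integrable \<mu> f" and w: "integrable \<mu> w"
    and lim: "\<And>x. (\<lambda>n. s n x) \<longlonglongrightarrow> f x" and dom: "\<And>n x. \<bar>s n x\<bar> \<le> w x"
  shows "lip_approx f"
proof (rule lip_approx_limit[OF s f])
  have i: "integrable \<mu> (s n)" for n using s by (auto simp: lip_approx_def)
  have "(\<lambda>n. LINT x|\<mu>. \<bar>f x - s n x\<bar>) \<longlonglongrightarrow> (LINT x|\<mu>. 0)"
  proof (rule integral_dominated_convergence)
    show "integrable \<mu> (\<lambda>x. \<bar>f x\<bar> + w x)" using f w by auto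
    show "AE x in \<mu>. norm \<bar>f x - s n x\<bar> \<le> \<bar>f x\<bar> + w x" for n
      using dom[of n] by (intro AE_I2) (smt (verit) real_norm_def)
    show "AE x in \<mu>. (\<lambda>n. \<bar>f x - s n x\<bar>) \<longlonglongrightarrow> 0"
    proof (rule AE_I2)
      fix x
      have "(\<lambda>n. \<bar>f x - s n x\<bar>) \<longlonglongrightarrow> \<bar>f x - f x\<bar>" by (intro tendsto_intros lim)
      then show "(\<lambda>n. \<bar>f x - s n x\<bar>) \<longlonglongrightarrow> 0" by simp
    qed
  qed (use i f in \<open>auto intro!: borel_measurable_abs borel_measurable_diff\<close>)
  then show "(\<lambda>n. LINT x|\<mu>. \<bar>f x - s n x\<bar>) \<longlonglongrightarrow> 0" by simp
qed

lemma indicator_integrable: "A \<in> sets \<mu> \<Longrightarrow> integrable \<mu> (indicator A :: 'a \<Rightarrow> real)"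
  by (intro integrable_real_indicator) (auto simp: emeasure_eq_measure)

lemma lip_approx_open:
  assumes U: "open U" shows "lip_approx (indicator U)"
\<comment> \<open>The distance to the empty set is 0 by convention, so the cut-off functions below
  would vanish for the full space.\<close>
proof (cases "U = UNIV")
  case True
  then show ?thesis using lip_approx_lipschitz[OF lipschitz_on_constant, of 1] by (simp add: indicator_def[abs_def])
next
  case False
  then have ne: "- U \<noteq> {}" by auto
  define s where "s = (\<lambda>n x. min 1 (real n * infdist x (- U)))"
  show ?thesis
  proof (rule lip_approx_dominated[where s = s and w = "\<lambda>x. 1"])
    show "lip_approx (s n)" for n
    proof (rule lip_approx_lipschitz[where L = "real n"], rule lipschitz_onI_abs_real)
      fix x y
      have "\<bar>infdist x (- U) - infdist y (- U)\<bar> \<le> dist x y"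
        using infdist_triangle[of x "- U" y] infdist_triangle[of y "- U" x] by (simp add: dist_commute abs_le_iff)
      then have "real n * \<bar>infdist x (- U) - infdist y (- U)\<bar> \<le> real n * dist x y" by (intro mult_left_mono) auto
      then have "\<bar>real n * infdist x (- U) - real n * infdist y (- U)\<bar> \<le> real n * dist x y"
        by (simp flip: right_diff_distrib add: abs_mult)
      then show "\<bar>s n x - s n y\<bar> \<le> real n * dist x y" unfolding s_def by linarith
    qed simp
    fix x
    show "(\<lambda>n. s n x) \<longlonglongrightarrow> indicator U x"
    proof (cases "x \<in> U")
      case True
      have "infdist x (- U) \<noteq> 0"
        using True U ne in_closed_iff_infdist_zero[of "- U" x] by (auto simp: closed_def)
      then have p: "0 < infdist x (- U)" using infdist_nonneg[of x "- U"] by simp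
      obtain m :: nat where m: "1 / infdist x (- U) < real m" using reals_Archimedean2 by blast
      have "s n x = 1" if "m \<le> n" for n
      proof -
        have "1 / infdist x (- U) < real n" using m that by linarith
        then have "1 < real n * infdist x (- U)" using p by (simp add: field_simps)
        then show ?thesis unfolding s_def by simp
      qed
      then have "\<forall>\<^sub>F n in sequentially. s n x = 1" by (auto simp: eventually_sequentially)
      then show ?thesis using True by (simp add: tendsto_eventually)
    next
      case False
      then have "s n x = 0" for n unfolding s_def using infdist_zero[of x "- U"] by simp
      then show ?thesis using False by simp
    qed
    show "\<bar>s n x\<bar> \<le> 1" for n unfolding s_def using infdist_nonneg[of x "- U"] by (simp add: abs_le_iff)
  qed (use U open_meas indicator_integrable in auto)
qed

text \<open>Open sets form an intersection-stable generator, and the property survives complements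
  and disjoint countable unions.\<close>

lemma lip_approx_borel:
  assumes A: "A \<in> sets \<mu>" shows "lip_approx (indicator A)"
proof -
  have "Int_stable {S :: 'a set. open S}" "{S :: 'a set. open S} \<subseteq> Pow UNIV"
    "A \<in> sigma_sets UNIV {S. open S}"
    using A unfolding sets_mu borel_def by (auto simp: Int_stable_def)
  then show ?thesis
  proof (induction rule: sigma_sets_induct_disjoint)
    case (basic A)
    then show ?case using lip_approx_open by simp
  next
    case empty
    show ?case using lip_approx_open[of "{}"] by blast
  next
    case (compl A)
    have "lip_approx (\<lambda>x. 1 + - 1 * indicator A x)"
      using lip_approx_lipschitz[OF lipschitz_on_constant, of 1] compl
      by (intro lip_approx_add lip_approx_cmult) (auto simp: )
    moreover have "(\<lambda>x. 1 + - 1 * indicator A x) = (indicator (UNIV - A) :: 'a \<Rightarrow> real)"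
      by (auto simp: indicator_def)
    ultimately show ?case by simp
  next
    case (union A)
    have Am: "A i \<in> sets \<mu>" for i using union(2) unfolding sets_mu borel_def by auto
    have fin: "lip_approx (indicator (\<Union>i<n. A i))" for n
    proof (induction n)
      case 0
      have e: "(\<Union>i<0. A i) = {}" by simp
      show ?case unfolding e by (rule lip_approx_open[OF open_empty])
    next
      case (Suc n)
      have "A n \<inter> A i = {}" if "i < n" for i
        using disjoint_family_onD[OF union(1), of n i] that by simp
      then have disj: "A n \<inter> (\<Union>i<n. A i) = {}" by blast
      have "(indicator (\<Union>i<Suc n. A i) :: 'a \<Rightarrow> real) = (\<lambda>x. indicator (A n) x + indicator (\<Union>i<n. A i) x)"
        unfolding indicator_add[OF disj] by (simp add: lessThan_Suc)
      then show ?case using lip_approx_add[OF union(3)[of n] Suc] by simp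
    qed
    show ?case
    proof (rule lip_approx_dominated[OF fin, where w = "\<lambda>x. 1"])
      fix x
      show "(\<lambda>n. indicator (\<Union>i<n. A i) x) \<longlonglongrightarrow> (indicator (\<Union>i. A i) x :: real)"
        by (rule LIMSEQ_indicator_UN)
      show "integrable \<mu> (indicator (\<Union>i. A i) :: 'a \<Rightarrow> real)" using Am by (intro indicator_integrable) auto
    qed (auto split: split_indicator)
  qed
qed

lemma lip_approx_integrable:
  assumes "integrable \<mu> f" shows "lip_approx f"
  using assms
proof (induction rule: integrable_induct)
  case (base A c)
  then show ?case using lip_approx_cmult[OF lip_approx_borel, of A c] by (simp add: mult.commute)
next
  case (add f g)
  then show ?case by (intro lip_approx_add)
next
  case (lim f s)
  then show ?case by (intro lip_approx_dominated[of s f "\<lambda>x. 2 * \<bar>f x\<bar>"]) auto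
qed

end

section \<open>Nets, vertices and edges\<close>

locale ahlfors_filling = ahlfors \<mu> Q K for \<mu> :: "'a::metric_space measure" and Q K +
  fixes N :: "nat \<Rightarrow> 'a set" and ini ter :: "'a vertex set \<Rightarrow> 'a vertex"
  assumes maxsep: "\<And>n. n \<ge> 1 \<Longrightarrow> maximal_separated (2 powr (- real n)) (N n)"
    and ends: "\<And>e. e \<in> filling_edges N \<Longrightarrow> e = {ini e, ter e}"
begin

lemma powr_half: "2 powr (- real n) = (1/2)^n" "2 powr (1 - real n) = 2 * (1/2)^n"
  by (simp_all add: powr_minus powr_diff powr_realpow power_one_over inverse_eq_divide)

lemma net_separated: "1 \<le> n \<Longrightarrow> z \<in> N n \<Longrightarrow> w \<in> N n \<Longrightarrow> z \<noteq> w \<Longrightarrow> (1/2)^n \<le> dist z w"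
  using maxsep[of n] unfolding maximal_separated_def separated_def powr_half by blast

lemma net_cover:
  assumes n: "1 \<le> n" obtains z where "z \<in> N n" "dist x z < (1/2)^n"
proof -
  have "\<exists>z\<in>N n. dist x z < (1/2)^n"
  proof (rule ccontr)
    assume "\<not> ?thesis"
    then have far: "\<And>z. z \<in> N n \<Longrightarrow> (1/2)^n \<le> dist x z" by force
    then have "separated (2 powr (- real n)) (insert x (N n))"
      using net_separated[OF n] unfolding separated_def powr_half by (auto simp: dist_commute)
    then have "insert x (N n) = N n" using maxsep[OF n] unfolding maximal_separated_def by blast
    then have "x \<in> N n" by blast
    then have "(1/2::real)^n \<le> 0" using far[of x] by simp
    moreover have "0 < (1/2::real)^n" by simp
    ultimately show False by linarith
  qed
  then show thesis using that by blast
qed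

definition net_bound :: "real \<Rightarrow> real" where "net_bound R = K\<^sup>2 * (2 * (R + 1)) powr Q"

lemma net_bound_pos: "0 < R \<Longrightarrow> 0 < net_bound R"
  unfolding net_bound_def using K by simp

text \<open>Packing: half-radius balls about net points are disjoint and lie in a ball of radius (R
  + 1)(1/2)^n. The bound is the ratio of the upper volume of that ball to the lower volume of one
  small ball.\<close>

lemma net_count:
  assumes n: "1 \<le> n" and R: "0 < R"
  shows "finite {z\<in>N n. dist x z < R * (1/2)^n} \<and> real (card {z\<in>N n. dist x z < R * (1/2)^n}) \<le> net_bound R"
proof (rule finite_card_le_of_subsets)
  fix F assume F: "F \<subseteq> {z\<in>N n. dist x z < R * (1/2)^n}" "finite F"
  let ?s = "(1/2::real)^n"
  have s: "0 < ?s" "?s \<le> 1" by (auto simp: power_le_one)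
  have disj: "disjoint_family_on (\<lambda>z. ball z (?s / 2)) F"
  proof (unfold disjoint_family_on_def, intro ballI impI, rule ccontr)
    fix z w assume zw: "z \<in> F" "w \<in> F" "z \<noteq> w" "ball z (?s / 2) \<inter> ball w (?s / 2) \<noteq> {}"
    then obtain y where "dist z y < ?s / 2" "dist w y < ?s / 2" by auto
    then have "dist z w < ?s" using dist_triangle_half_l[of z y ?s w] by (simp add: dist_commute)
    moreover have "?s \<le> dist z w" using zw F n by (intro net_separated) auto
    ultimately show False by simp
  qed
  have "real (card F) * ((?s / 2) powr Q / K) = (\<Sum>z\<in>F. (?s / 2) powr Q / K)" by simp
  also have "\<dots> \<le> (\<Sum>z\<in>F. measure \<mu> (ball z (?s / 2)))"
  proof (rule sum_mono)
    fix z
    have "(?s / 2) powr Q \<le> K * measure \<mu> (ball z (?s / 2))" by (rule lower) (use s in linarith)+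
    then show "(?s / 2) powr Q / K \<le> measure \<mu> (ball z (?s / 2))" using K by (simp add: divide_le_eq mult.commute)
  qed
  also have "\<dots> = measure \<mu> (\<Union>z\<in>F. ball z (?s / 2))"
    using disj F by (intro finite_measure_finite_Union[symmetric]) auto
  also have "\<dots> \<le> measure \<mu> (ball x ((R + 1) * ?s))"
  proof (intro finite_measure_mono)
    show "(\<Union>z\<in>F. ball z (?s / 2)) \<subseteq> ball x ((R + 1) * ?s)"
    proof
      fix y assume "y \<in> (\<Union>z\<in>F. ball z (?s / 2))"
      then obtain z where z: "z \<in> F" "dist z y < ?s / 2" by auto
      then have "dist x z < R * ?s" using F by auto
      then have "dist x y < R * ?s + ?s" using z(2) dist_triangle[of x y z] s by linarith
      then show "y \<in> ball x ((R + 1) * ?s)" by (simp add: algebra_simps)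
    qed
  qed simp
  also have "\<dots> \<le> K * ((R + 1) * ?s) powr Q" using s R by (intro upper) auto
  also have "(R + 1) * ?s = 2 * (R + 1) * (?s / 2)" by (simp add: field_simps)
  also have "(2 * (R + 1) * (?s / 2)) powr Q = (2 * (R + 1)) powr Q * (?s / 2) powr Q"
    by (rule powr_mult)
  finally have "real (card F) * ((?s / 2) powr Q / K) \<le> K * ((2 * (R + 1)) powr Q * (?s / 2) powr Q)" .
  moreover have "0 < (?s / 2) powr Q" using s by simp
  ultimately show "real (card F) \<le> net_bound R"
    unfolding net_bound_def using K by (simp add: field_simps power2_eq_square)
qed

lemma net_finite: assumes n: "1 \<le> n" shows "finite (N n)" "real (card (N n)) \<le> K\<^sup>2 * 6 powr Q * (2 powr Q)^n"
proof -
  fix x0 :: 'a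
  \<comment> \<open>At this radius the count concerns a ball of radius 2, hence the entire
    net.\<close>
  let ?R = "2 * 2^n :: real"
  have R: "?R * (1/2)^n = 2" by (simp add: power_one_over)
  have "{z\<in>N n. dist x0 z < ?R * (1/2)^n} = N n"
    unfolding R using order_le_less_trans[OF dist_le, of 2 x0] by auto
  then have 1: "finite (N n)" "real (card (N n)) \<le> net_bound ?R" using net_count[OF n, of ?R x0] by auto
  show "finite (N n)" by (rule 1)
  have "(1::real) \<le> 2^n" by simp
  then have "(2 * (?R + 1)) powr Q \<le> (6 * 2^n) powr Q" using Q by (intro powr_mono2) auto
  also have "\<dots> = 6 powr Q * (2 powr Q)^n" by (simp add: powr_mult powr_power[symmetric] powr_realpow[symmetric] powr_powr mult.commute)
  finally show "real (card (N n)) \<le> K\<^sup>2 * 6 powr Q * (2 powr Q)^n"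
    using 1(2) K unfolding net_bound_def by (smt (verit) mult.assoc mult_left_mono zero_le_power2)
qed

text \<open>The root is a ball of radius 2 about any point, since distances are at most 1; all
  levels then share one radius formula.\<close>

lemma vball_eq: "v \<in> filling_vertices N \<Longrightarrow> \<exists>z. vball v = ball z (2 * (1/2)^level v)"
proof (cases v)
  case Root
  have "ball z 2 = (UNIV :: 'a set)" for z using order_le_less_trans[OF dist_le, of 2 z] by auto
  then show ?thesis using Root by simp
next
  case (Vertex n z)
  then show ?thesis by (auto simp: powr_half)
qed

lemma edgesE:
  assumes "e \<in> filling_edges N"
  obtains v w where "e = {v, w}" "ini e = v" "ter e = w" "v \<in> filling_vertices N" "w \<in> filling_vertices N"
    "v \<noteq> w" "level v \<le> level w + 1" "level w \<le> level v + 1" "vball v \<inter> vball w \<noteq> {}"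
proof -
  obtain v w where vw: "e = {v, w}" "v \<in> filling_vertices N" "w \<in> filling_vertices N" "v \<noteq> w"
    "level v \<le> level w + 1" "level w \<le> level v + 1" "vball v \<inter> vball w \<noteq> {}"
    using assms unfolding filling_edges_def by blast
  have "{v, w} = {ini e, ter e}" using ends[OF assms] vw(1) by simp
  then have "(v = ini e \<and> w = ter e) \<or> (v = ter e \<and> w = ini e)" by (simp add: doubleton_eq_iff)
  then show thesis using that[of v w] that[of w v] vw by (auto simp: insert_commute Int_commute)
qed

lemma edge_diff_pair:
  assumes "{v, w} \<in> filling_edges N" shows "\<bar>edge_diff ini ter u {v, w}\<bar> = \<bar>u v - u w\<bar>"
proof -
  have "{v, w} = {ini {v, w}, ter {v, w}}" using ends[OF assms] .
  then have "(v = ini {v, w} \<and> w = ter {v, w}) \<or> (v = ter {v, w} \<and> w = ini {v, w})"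
    by (simp only: doubleton_eq_iff)
  then show ?thesis unfolding edge_diff_def by (metis abs_minus_commute)
qed

lemma edges_nonempty: "filling_edges N \<noteq> {}"
proof -
  fix x0 :: 'a
  obtain z where z: "z \<in> N 1" using net_cover[of 1 x0] by auto
  have "Vertex 1 z \<in> filling_vertices N" "Root \<in> filling_vertices N"
    unfolding filling_vertices_def using z by auto
  moreover have "z \<in> vball Root \<inter> vball (Vertex 1 z)" by simp
  ultimately have "{Root, Vertex 1 z} \<in> filling_edges N"
    unfolding filling_edges_def by (intro CollectI exI[of _ Root] exI[of _ "Vertex 1 z"]) auto
  then show ?thesis by blast
qed

end

section \<open>From Hajlasz gradients to the Poisson extension\<close>

context ahlfors
begin

text \<open>The inequality is averaged over \<open>y\<close> in one ball for fixed \<open>x\<close>,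
  and then over \<open>x\<close> in the other; the null set disappears in both averages.\<close>

lemma avg_hajlasz:
  assumes f: "integrable \<mu> f" and g: "integrable \<mu> g" and N0: "N0 \<in> null_sets \<mu>" and rs: "0 < r" "0 < s"
    and haj: "\<And>x y. x \<notin> N0 \<Longrightarrow> y \<notin> N0 \<Longrightarrow> \<bar>f x - f y\<bar> \<le> dist x y * (g x + g y)"
    and g0: "\<And>x. 0 \<le> g x"
    and D: "\<And>x y. x \<in> ball z r \<Longrightarrow> y \<in> ball w s \<Longrightarrow> dist x y \<le> D"
  shows "\<bar>avg z r f - avg w s f\<bar> \<le> D * (avg z r g + avg w s g)"
proof -
  have AE0: "AE x in \<mu>. x \<notin> N0" by (rule AE_not_in[OF N0])
  have pt: "\<bar>f x - f y\<bar> \<le> D * g x + D * g y" if "x \<in> ball z r" "y \<in> ball w s" "x \<notin> N0" "y \<notin> N0" for x y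
  proof -
    have "\<bar>f x - f y\<bar> \<le> dist x y * (g x + g y)" using haj that by blast
    also have "\<dots> \<le> D * (g x + g y)" using D that g0 by (intro mult_right_mono add_nonneg_nonneg) auto
    finally show ?thesis by (simp add: distrib_left)
  qed
  have one: "\<bar>f x - avg w s f\<bar> \<le> D * g x + D * avg w s g" if x: "x \<in> ball z r" "x \<notin> N0" for x
  proof -
    have "\<bar>f x - avg w s f\<bar> \<le> avg w s (\<lambda>y. \<bar>f y - f x\<bar>)"
      using avg_diff_const[OF f rs(2), of w "f x"] by (simp add: abs_minus_commute)
    also have "\<dots> \<le> avg w s (\<lambda>y. D * g x + D * g y)"
    proof (rule avg_mono_AE)
      show "AE y in \<mu>. y \<in> ball w s \<longrightarrow> \<bar>f y - f x\<bar> \<le> D * g x + D * g y"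
        using AE0
      proof eventually_elim
        case (elim y)
        then show ?case using pt[of x y] x by (auto simp: abs_minus_commute)
      qed
    qed (use f g in auto)
    also have "\<dots> = D * g x + D * avg w s g" using g rs by (simp add: avg_add avg_const avg_cmult)
    finally show ?thesis .
  qed
  have "\<bar>avg z r f - avg w s f\<bar> \<le> avg z r (\<lambda>x. \<bar>f x - avg w s f\<bar>)"
    by (rule avg_diff_const[OF f rs(1)])
  also have "\<dots> \<le> avg z r (\<lambda>x. D * g x + D * avg w s g)"
  proof (rule avg_mono_AE)
    show "AE x in \<mu>. x \<in> ball z r \<longrightarrow> \<bar>f x - avg w s f\<bar> \<le> D * g x + D * avg w s g"
      using AE0 by eventually_elim (use one in blast)
  qed (use f g in auto)
  also have "\<dots> = D * avg z r g + D * avg w s g" using g rs by (simp add: avg_add avg_const avg_cmult)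
  finally show ?thesis by (simp add: distrib_left)
qed

lemma integrable_of_powr:
  assumes [measurable]: "g \<in> borel_measurable \<mu>" and g: "\<And>x. 0 \<le> g x" "integrable \<mu> (\<lambda>x. g x powr Q)"
  shows "integrable \<mu> g"
proof (rule Bochner_Integration.integrable_bound)
  show "integrable \<mu> (\<lambda>x. 1 + g x powr Q)" using g by auto
  show "AE x in \<mu>. norm (g x) \<le> norm (1 + g x powr Q)"
  proof (rule AE_I2)
    fix x
    have "g x \<le> 1 + g x powr Q"
    proof (cases "g x \<le> 1")
      case True
      then show ?thesis using powr_ge_zero[of "g x" Q] by linarith
    next
      case False
      then have "g x powr 1 \<le> g x powr Q" using Q by (intro powr_mono) auto
      then show ?thesis using False by simp
    qed
    then show "norm (g x) \<le> norm (1 + g x powr Q)" using g(1)[of x] by simp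
  qed
qed measurable

end

section \<open>Counting vertices and edges with a large gradient\<close>

context ahlfors_filling
begin

definition nbr :: "'a vertex \<Rightarrow> 'a vertex set" where
  "nbr v = {w\<in>filling_vertices N. level v \<le> level w + 1 \<and> level w \<le> level v + 1 \<and> vball v \<inter> vball w \<noteq> {}}"

lemma nbr_count:
  assumes v: "v \<in> filling_vertices N"
  shows "finite (nbr v) \<and> real (card (nbr v)) \<le> 1 + 3 * net_bound 6"
proof -
  obtain c where c: "vball v = ball c (2 * (1/2)^level v)" using vball_eq[OF v] by blast
  define A where "A = (\<lambda>m. {z\<in>N m. dist c z < 6 * (1/2)^m})"
  define J where "J = {m\<in>{level v - 1..level v + 1}. 1 \<le> m}"
  have fJ: "finite J" unfolding J_def by simp
  have "card J \<le> card {level v - 1..level v + 1}" unfolding J_def by (intro card_mono) auto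
  also have "\<dots> \<le> 3" by simp
  finally have cJ: "card J \<le> 3" .
  have A: "finite (A m)" "real (card (A m)) \<le> net_bound 6" if "m \<in> J" for m
    using net_count[of m 6 c] that unfolding A_def J_def by auto
  have sub: "nbr v \<subseteq> insert Root (\<Union>m\<in>J. Vertex m ` A m)"
  proof
    fix w assume w: "w \<in> nbr v"
    show "w \<in> insert Root (\<Union>m\<in>J. Vertex m ` A m)"
    proof (cases w)
      case (Vertex m z)
      then have m: "1 \<le> m" "z \<in> N m" "level v \<le> m + 1" "m \<le> level v + 1"
        using w unfolding nbr_def filling_vertices_def by auto
      obtain p where "p \<in> vball v" "p \<in> vball w" using w unfolding nbr_def by blast
      then have p: "dist c p < 2 * (1/2)^level v" "dist z p < 2 * (1/2)^m"
        using c Vertex by (auto simp: powr_half)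
      \<comment> \<open>As the levels differ by at most one, the ball of \<open>v\<close> has radius
        at most 4 (1/2)^m; with the radius 2 (1/2)^m of \<open>w\<close> this gives the 6.\<close>
      have "(1/2::real)^Suc (level v) \<le> (1/2)^m" using m by (intro power_decreasing) auto
      then have "dist c z < 6 * (1/2)^m"
        using p dist_triangle[of c z p] by (simp add: dist_commute)
      then have "z \<in> A m" using m unfolding A_def by simp
      moreover have "m \<in> J" using m unfolding J_def by auto
      ultimately show ?thesis using Vertex by blast
    qed simp
  qed
  have fin: "finite (insert Root (\<Union>m\<in>J. Vertex m ` A m))" using fJ A by auto
  have "card (nbr v) \<le> card (insert Root (\<Union>m\<in>J. Vertex m ` A m))" by (rule card_mono[OF fin sub])
  also have "\<dots> \<le> Suc (card (\<Union>m\<in>J. Vertex m ` A m))" by (rule card_insert_le_m1) auto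
  also have "card (\<Union>m\<in>J. Vertex m ` A m) \<le> (\<Sum>m\<in>J. card (Vertex m ` A m))" by (rule card_UN_le[OF fJ])
  also have "\<dots> \<le> (\<Sum>m\<in>J. card (A m))" by (intro sum_mono card_image_le A)
  finally have "real (card (nbr v)) \<le> real (Suc (\<Sum>m\<in>J. card (A m)))" by (simp only: of_nat_le_iff)
  then have "real (card (nbr v)) \<le> 1 + (\<Sum>m\<in>J. real (card (A m)))" by simp
  also have "(\<Sum>m\<in>J. real (card (A m))) \<le> (\<Sum>m\<in>J. net_bound 6)" by (intro sum_mono A)
  also have "\<dots> \<le> 3 * net_bound 6" using cJ net_bound_pos[of 6] by simp
  finally show ?thesis using finite_subset[OF sub fin] by simp
qed

lemma level_overlap:
  assumes W: "W \<subseteq> filling_vertices N" "finite W"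
  shows "real (card {v\<in>W. level v = n \<and> x \<in> vball v}) \<le> 1 + net_bound 2"
proof (cases "n = 0")
  case True
  have "{v\<in>W. level v = n \<and> x \<in> vball v} \<subseteq> {Root}"
    using W(1) True unfolding filling_vertices_def by auto
  from card_mono[OF _ this] have "card {v\<in>W. level v = n \<and> x \<in> vball v} \<le> card {Root :: 'a vertex}" by simp
  then show ?thesis using net_bound_pos[of 2] by simp
next
  case False
  have nc: "finite {z\<in>N n. dist x z < 2 * (1/2)^n}" "real (card {z\<in>N n. dist x z < 2 * (1/2)^n}) \<le> net_bound 2"
    using net_count[of n 2 x] False by auto
  have "{v\<in>W. level v = n \<and> x \<in> vball v} \<subseteq> Vertex n ` {z\<in>N n. dist x z < 2 * (1/2)^n}"
    using W(1) False unfolding filling_vertices_def by (auto simp: powr_half dist_commute)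
  then have "card {v\<in>W. level v = n \<and> x \<in> vball v} \<le> card (Vertex n ` {z\<in>N n. dist x z < 2 * (1/2)^n})"
    using nc by (intro card_mono) auto
  also have "\<dots> \<le> card {z\<in>N n. dist x z < 2 * (1/2)^n}" by (rule card_image_le[OF nc(1)])
  finally show ?thesis using nc by linarith
qed

text \<open>The part of \<open>g\<close> below half of the relevant average is discarded, which replaces the maximal
  theorem in the weak-type bound.\<close>

lemma vertex_count:
  assumes g_meas [measurable]: "g \<in> borel_measurable \<mu>" and g: "\<And>x. 0 \<le> g x" "integrable \<mu> (\<lambda>x. g x powr Q)"
    and t: "0 < t"
    and W: "W \<subseteq> {v\<in>filling_vertices N. t < 24 * (1/2)^level v * average \<mu> (vball v) g}" "finite W"
  shows "real (card W) \<le> 48 powr Q * K * (1 + net_bound 2) * geom_const (Q - 1) * (LINT x|\<mu>. g x powr Q) / t powr Q"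
proof -
  have ig: "integrable \<mu> g" by (rule integrable_of_powr[OF g_meas g])
  \<comment> \<open>A weight with two opposite properties: the integral of \<open>g * F v\<close> is
    at least t/(48 K) for each counted vertex, while at a point the weights of all vertices sum to a
    geometric series in the level of size (48 g/t)^(Q-1). Multiplication by \<open>g\<close> yields
    the power Q.\<close>
  define F where "F = (\<lambda>v x. if x \<in> vball v \<and> 2^level v < 48 * g x / t then (2^level v) powr (Q - 1) else (0::real))"
  have vm: "vball v \<in> sets \<mu>" if "v \<in> W" for v
  proof -
    have "v \<in> filling_vertices N" using that W by blast
    then obtain z where "vball v = ball z (2 * (1/2)^level v)" using vball_eq by blast
    then show ?thesis by simp
  qed
  have Fm: "(\<lambda>x. g x * F v x) \<in> borel_measurable \<mu>" if "v \<in> W" for v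
    unfolding F_def using vm[OF that] by measurable
  have iF: "integrable \<mu> (\<lambda>x. g x * F v x)" if v: "v \<in> W" for v
  proof (rule Bochner_Integration.integrable_bound[OF _ Fm[OF v]])
    show "integrable \<mu> (\<lambda>x. (2^level v) powr (Q - 1) * g x)" using ig by simp
    show "AE x in \<mu>. norm (g x * F v x) \<le> norm ((2^level v) powr (Q - 1) * g x)"
      using g(1) by (intro AE_I2) (auto simp: F_def)
  qed
  have one: "1 \<le> 48 * K / t * (LINT x|\<mu>. g x * F v x)" if v: "v \<in> W" for v
  proof -
    have vV: "v \<in> filling_vertices N" and tv: "t < 24 * (1/2)^level v * average \<mu> (vball v) g" using v W by auto
    obtain z where z: "vball v = ball z (2 * (1/2)^level v)" using vball_eq[OF vV] by blast
    let ?p = "2^level v :: real"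
    let ?r = "2 * (1/2)^level v :: real"
    \<comment> \<open>Half of the lower bound for the average of \<open>g\<close>. Values of
      \<open>g\<close> below it contribute at most \<open>\<tau>\<close>, so the truncated function
      \<open>g1\<close> still has average at least \<open>\<tau>\<close>.\<close>
    define \<tau> where "\<tau> = t * ?p / 48"
    have p: "(1/2)^level v = 1 / ?p" "0 < ?p" "1 \<le> ?p" by (auto simp: power_one_over)
    define g1 where "g1 = (\<lambda>x. if ?p < 48 * g x / t then g x else 0)"
    have g1m: "g1 \<in> borel_measurable \<mu>" unfolding g1_def by measurable
    have ig1: "integrable \<mu> g1"
      by (rule Bochner_Integration.integrable_bound[OF ig g1m]) (auto simp: g1_def g(1))
    have "2 * \<tau> < avg z ?r g" using tv unfolding z \<tau>_def p(1) using p(2) by (simp add: field_simps)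
    also have "\<dots> \<le> avg z ?r (\<lambda>x. \<tau> + g1 x)"
      using ig ig1 t g(1) unfolding g1_def \<tau>_def by (intro avg_mono) (auto simp: field_simps not_less)
    also have "\<dots> = \<tau> + avg z ?r g1" using ig1 by (simp add: avg_add avg_const)
    finally have \<tau>: "\<tau> \<le> avg z ?r g1" by simp
    have g1n: "0 \<le> avg z ?r g1" by (rule avg_nonneg) (simp add: g1_def g(1))
    have "1 / ?p \<le> ?r" unfolding p(1)[symmetric] by simp
    then have "(1 / ?p) powr Q \<le> ?r powr Q" using Q p(2) by (intro powr_mono2) auto
    also have "\<dots> \<le> K * measure \<mu> (ball z ?r)" by (intro lower) (auto simp: power_le_one)
    finally have m: "(1 / ?p) powr Q \<le> K * measure \<mu> (ball z ?r)" .
    have "1 = 48 / t * (?p powr (Q - 1) * (\<tau> * (1 / ?p) powr Q))"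
      unfolding \<tau>_def using p(2) t by (simp add: powr_diff powr_divide)
    also have "\<dots> \<le> 48 / t * (?p powr (Q - 1) * (avg z ?r g1 * (K * measure \<mu> (ball z ?r))))"
      using m \<tau> t g1n by (intro mult_left_mono mult_mono) auto
    also have "\<dots> = 48 * K / t * (?p powr (Q - 1) * (avg z ?r g1 * measure \<mu> (ball z ?r)))" by simp
    also have "avg z ?r g1 * measure \<mu> (ball z ?r) = (LINT x:ball z ?r|\<mu>. g1 x)" by (rule avg_mult_measure) simp
    also have "?p powr (Q - 1) * (LINT x:ball z ?r|\<mu>. g1 x) = (LINT x|\<mu>. g x * F v x)"
      unfolding set_lebesgue_integral_def integral_mult_right_zero[symmetric] F_def z g1_def
      by (intro Bochner_Integration.integral_cong) (auto split: split_indicator)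
    finally show ?thesis .
  qed
  define M where "M = Suc (Max (level ` W))"
  have lM: "level ` W \<subseteq> {..<M}" unfolding M_def using W(2) by (auto simp: less_Suc_eq_le)
  have pt: "(\<Sum>v\<in>W. F v x) \<le> (1 + net_bound 2) * (geom_const (Q - 1) * (48 * g x / t) powr (Q - 1))" for x
  proof -
    have "(\<Sum>v\<in>W. F v x) = (\<Sum>n<M. \<Sum>v\<in>{v\<in>W. level v = n}. F v x)"
      by (rule sum.group[symmetric]) (use W lM in auto)
    also have "\<dots> \<le> (\<Sum>n<M. (1 + net_bound 2) * (if 1 * 2^n < 48 * g x / t then (1 * 2^n) powr (Q - 1) else 0))"
    proof (rule sum_mono)
      fix n
      let ?c = "if 1 * 2^n < 48 * g x / t then (1 * 2^n) powr (Q - 1) else (0::real)"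
      have "(\<Sum>v\<in>{v\<in>W. level v = n}. F v x) = (\<Sum>v\<in>{v\<in>W. level v = n}. if x \<in> vball v then ?c else 0)"
        unfolding F_def by (intro sum.cong) auto
      also have "\<dots> = (\<Sum>v\<in>{v\<in>W. level v = n \<and> x \<in> vball v}. ?c)"
        using W(2) by (subst sum.inter_filter[symmetric]) (auto intro!: sum.cong)
      also have "\<dots> = real (card {v\<in>W. level v = n \<and> x \<in> vball v}) * ?c" by simp
      also have "\<dots> \<le> (1 + net_bound 2) * ?c"
        using W by (intro mult_right_mono level_overlap) auto
      finally show "(\<Sum>v\<in>{v\<in>W. level v = n}. F v x) \<le> (1 + net_bound 2) * ?c" .
    qed
    also have "\<dots> = (1 + net_bound 2) * (\<Sum>n<M. if 1 * 2^n < 48 * g x / t then (1 * 2^n) powr (Q - 1) else 0)"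
      by (simp only: sum_distrib_left)
    also have "\<dots> \<le> (1 + net_bound 2) * (geom_const (Q - 1) * (48 * g x / t) powr (Q - 1))"
      unfolding geom_const_def using g(1)[of x] t Q net_bound_pos[of 2] by (intro mult_left_mono sum_dyadic_powr_le) auto
    finally show ?thesis .
  qed
  have "real (card W) = (\<Sum>v\<in>W. 1)" by simp
  also have "\<dots> \<le> (\<Sum>v\<in>W. 48 * K / t * (LINT x|\<mu>. g x * F v x))" by (intro sum_mono one)
  also have "\<dots> = 48 * K / t * (LINT x|\<mu>. (\<Sum>v\<in>W. g x * F v x))"
    using iF by (simp add: sum_distrib_left Bochner_Integration.integral_sum)
  also have "(LINT x|\<mu>. (\<Sum>v\<in>W. g x * F v x)) \<le>
      (LINT x|\<mu>. (1 + net_bound 2) * geom_const (Q - 1) * (48 / t) powr (Q - 1) * g x powr Q)"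
  proof (rule integral_mono)
    fix x
    have "(\<Sum>v\<in>W. g x * F v x) = g x * (\<Sum>v\<in>W. F v x)" by (simp add: sum_distrib_left)
    also have "\<dots> \<le> g x * ((1 + net_bound 2) * (geom_const (Q - 1) * (48 * g x / t) powr (Q - 1)))"
      by (intro mult_left_mono pt g)
    also have "(48 * g x / t) powr (Q - 1) = (48 / t) powr (Q - 1) * g x powr (Q - 1)"
      using g(1)[of x] t by (subst powr_mult[symmetric]) auto
    also have "g x * ((1 + net_bound 2) * (geom_const (Q - 1) * ((48 / t) powr (Q - 1) * g x powr (Q - 1)))) =
        (1 + net_bound 2) * geom_const (Q - 1) * (48 / t) powr (Q - 1) * g x powr Q"
      using g(1)[of x] Q by (cases "g x = 0") (auto simp: powr_diff)
    finally show "(\<Sum>v\<in>W. g x * F v x) \<le> (1 + net_bound 2) * geom_const (Q - 1) * (48 / t) powr (Q - 1) * g x powr Q" .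
  qed (use iF g in auto)
  also have "48 * K / t * (LINT x|\<mu>. (1 + net_bound 2) * geom_const (Q - 1) * (48 / t) powr (Q - 1) * g x powr Q) =
      48 powr Q * K * (1 + net_bound 2) * geom_const (Q - 1) * (LINT x|\<mu>. g x powr Q) / t powr Q"
  proof -
    define I where "I = (LINT x|\<mu>. g x powr Q)"
    have "48 * K / t * ((1 + net_bound 2) * geom_const (Q - 1) * (48 / t) powr (Q - 1) * I) =
      48 powr Q * K * (1 + net_bound 2) * geom_const (Q - 1) * I / t powr Q"
      using t by (simp add: powr_diff powr_divide)
    then show ?thesis unfolding I_def by (simp only: integral_mult_right_zero)
  qed
  finally show ?thesis using t K by (simp add: divide_right_mono mult_left_mono)
qed

definition edge_const :: real where
  "edge_const = (1 + 3 * net_bound 6) * (48 powr Q * K * (1 + net_bound 2) * geom_const (Q - 1))"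

lemma edge_const_nonneg: "0 \<le> edge_const"
  unfolding edge_const_def using K geom_const_nonneg[of "Q - 1"] Q net_bound_pos[of 6] net_bound_pos[of 2]
  by (intro mult_nonneg_nonneg add_nonneg_nonneg) auto

text \<open>An edge with a large difference has an endpoint where the average of \<open>g\<close> is
  large. Such vertices are counted by \<open>vertex_count\<close>, and each has boundedly many
  neighbours.\<close>

lemma edge_count:
  assumes f: "integrable \<mu> f" and g: "g \<in> hajlasz_gradients \<mu> 1 f \<inter> Lp_space \<mu> Q" and t: "0 < t"
  defines "E \<equiv> {e\<in>filling_edges N. t < \<bar>edge_diff ini ter (poisson_ext \<mu> f) e\<bar>}"
  shows "finite E \<and> real (card E) \<le> (edge_const powr (1 / Q) * Lp_norm \<mu> Q g / t) powr Q"
proof -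
  have gm: "g \<in> borel_measurable \<mu>" and g0: "\<And>x. 0 \<le> g x" and gQ: "integrable \<mu> (\<lambda>x. g x powr Q)"
    using g unfolding hajlasz_gradients_def Lp_space_def by auto
  obtain N0 where N0: "N0 \<in> null_sets \<mu>"
    "\<And>x y. x \<notin> N0 \<Longrightarrow> y \<notin> N0 \<Longrightarrow> \<bar>f x - f y\<bar> \<le> dist x y * (g x + g y)"
    using g unfolding hajlasz_gradients_def by auto
  have ig: "integrable \<mu> g" by (rule integrable_of_powr[OF gm g0 gQ])
  define V where "V = {v\<in>filling_vertices N. t < 24 * (1/2)^level v * average \<mu> (vball v) g}"
  have V: "finite V \<and> real (card V) \<le> 48 powr Q * K * (1 + net_bound 2) * geom_const (Q - 1) * (LINT x|\<mu>. g x powr Q) / t powr Q"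
    by (rule finite_card_le_of_subsets, rule vertex_count[OF gm g0 gQ t]) (auto simp: V_def)
  have sub: "E \<subseteq> (\<Union>v\<in>V. (\<lambda>w. {v, w}) ` nbr v)"
  proof
    fix e assume "e \<in> E"
    then have e: "e \<in> filling_edges N" "t < \<bar>edge_diff ini ter (poisson_ext \<mu> f) e\<bar>" unfolding E_def by auto
    obtain v w where vw: "e = {v, w}" "ini e = v" "ter e = w" "v \<in> filling_vertices N" "w \<in> filling_vertices N"
    "v \<noteq> w" "level v \<le> level w + 1" "level w \<le> level v + 1" "vball v \<inter> vball w \<noteq> {}" by (rule edgesE[OF e(1)])
    obtain a where a: "vball v = ball a (2 * (1/2)^level v)" using vball_eq vw by blast
    obtain b where b: "vball w = ball b (2 * (1/2)^level w)" using vball_eq vw by blast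
    obtain p where p: "dist a p < 2 * (1/2)^level v" "dist b p < 2 * (1/2)^level w" using vw(9) a b by auto
    \<comment> \<open>Points of two intersecting balls are at most the sum of the diameters apart.
      Adjacent levels give 4 + 8 = 12 times either scale. A sum of two terms exceeding
      \<open>t\<close> has a term exceeding t/2, hence the 24 in \<open>V\<close>.\<close>
    define D where "D = 4 * (1/2::real)^level v + 4 * (1/2)^level w"
    have "(1/2::real)^Suc (level v) \<le> (1/2)^level w" using vw by (intro power_decreasing) auto
    moreover have "(1/2::real)^Suc (level w) \<le> (1/2)^level v" using vw by (intro power_decreasing) auto
    ultimately have D: "D \<le> 12 * (1/2)^level v" "D \<le> 12 * (1/2)^level w" unfolding D_def by auto
    have "\<bar>avg a (2 * (1/2)^level v) f - avg b (2 * (1/2)^level w) f\<bar> \<le>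
        D * (avg a (2 * (1/2)^level v) g + avg b (2 * (1/2)^level w) g)"
    proof (rule avg_hajlasz[OF f ig N0(1) _ _ N0(2) g0])
      fix x y assume "x \<in> ball a (2 * (1/2)^level v)" "y \<in> ball b (2 * (1/2)^level w)"
      then have "dist a x < 2 * (1/2)^level v" "dist b y < 2 * (1/2)^level w" by auto
      then show "dist x y \<le> D"
        using p dist_triangle[of x y p] dist_triangle[of x p a] dist_triangle[of p y b]
        unfolding D_def by (simp add: dist_commute)
    qed auto
    then have "\<bar>poisson_ext \<mu> f v - poisson_ext \<mu> f w\<bar> \<le> D * average \<mu> (vball v) g + D * average \<mu> (vball w) g"
      unfolding poisson_ext_def a b by (simp add: distrib_left)
    also have "\<dots> \<le> 12 * (1/2)^level v * average \<mu> (vball v) g + 12 * (1/2)^level w * average \<mu> (vball w) g"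
      using D avg_nonneg[of a _ g] avg_nonneg[of b _ g] g0 unfolding a b
      by (intro add_mono mult_right_mono) auto
    finally have "t < 12 * (1/2)^level v * average \<mu> (vball v) g + 12 * (1/2)^level w * average \<mu> (vball w) g"
      using e(2) vw(2,3) unfolding edge_diff_def by (simp add: abs_minus_commute)
    then have "v \<in> V \<or> w \<in> V" unfolding V_def using vw(4,5) by auto
    moreover have "w \<in> nbr v" "v \<in> nbr w" using vw unfolding nbr_def by auto
    ultimately show "e \<in> (\<Union>v\<in>V. (\<lambda>w. {v, w}) ` nbr v)" using vw(1) by (auto simp: insert_commute)
  qed
  have nb: "finite (nbr v)" "real (card (nbr v)) \<le> 1 + 3 * net_bound 6" if "v \<in> V" for v
    using nbr_count[of v] that unfolding V_def by auto
  have fin: "finite (\<Union>v\<in>V. (\<lambda>w. {v, w}) ` nbr v)" using V nb by auto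
  have "card E \<le> card (\<Union>v\<in>V. (\<lambda>w. {v, w}) ` nbr v)" by (rule card_mono[OF fin sub])
  also have "\<dots> \<le> (\<Sum>v\<in>V. card ((\<lambda>w. {v, w}) ` nbr v))" using V by (intro card_UN_le) auto
  also have "\<dots> \<le> (\<Sum>v\<in>V. card (nbr v))" by (intro sum_mono card_image_le nb)
  finally have "real (card E) \<le> (\<Sum>v\<in>V. real (card (nbr v)))" by (metis of_nat_le_iff of_nat_sum)
  also have "\<dots> \<le> (\<Sum>v\<in>V. 1 + 3 * net_bound 6)" by (intro sum_mono nb)
  also have "\<dots> = (1 + 3 * net_bound 6) * real (card V)" by simp
  also have "\<dots> \<le> (1 + 3 * net_bound 6) * (48 powr Q * K * (1 + net_bound 2) * geom_const (Q - 1) * (LINT x|\<mu>. g x powr Q) / t powr Q)"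
    using V net_bound_pos[of 6] by (intro mult_left_mono) auto
  also have "\<dots> = edge_const * (LINT x|\<mu>. g x powr Q) / t powr Q" unfolding edge_const_def by simp
  also have "\<dots> = (edge_const powr (1 / Q) * Lp_norm \<mu> Q g / t) powr Q"
  proof -
    have "Lp_norm \<mu> Q g powr Q = (LINT x|\<mu>. g x powr Q)"
      unfolding Lp_norm_def using g0 Q by (simp add: powr_powr)
    moreover have "(edge_const powr (1 / Q)) powr Q = edge_const" using edge_const_nonneg Q by (simp add: powr_powr)
    ultimately show ?thesis using t by (simp add: powr_divide powr_mult Lp_norm_def)
  qed
  finally show ?thesis using finite_subset[OF sub fin] by blast
qed

lemma M_space_imp_A_space:
  assumes f: "f \<in> M_space \<mu> 1 Q"
  shows "f \<in> A_space \<mu> N ini ter Q"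
    "A_seminorm \<mu> N ini ter Q f \<le> Q / (Q - 1) * edge_const powr (1 / Q) * M_seminorm \<mu> 1 Q f"
proof -
  have fi: "integrable \<mu> f" and ne: "hajlasz_gradients \<mu> 1 f \<inter> Lp_space \<mu> Q \<noteq> {}"
    using f unfolding M_space_def by auto
  have ec: "finite {e\<in>filling_edges N. t < \<bar>edge_diff ini ter (poisson_ext \<mu> f) e\<bar>} \<and>
    real (card {e\<in>filling_edges N. t < \<bar>edge_diff ini ter (poisson_ext \<mu> f) e\<bar>}) \<le> (edge_const powr (1 / Q) * Lp_norm \<mu> Q g / t) powr Q"
    if "g \<in> hajlasz_gradients \<mu> 1 f \<inter> Lp_space \<mu> Q" "0 < t" for g t
    using edge_count[OF fi that] .
  have S0: "0 \<le> edge_const powr (1 / Q) * Lp_norm \<mu> Q g" for g unfolding Lp_norm_def by simp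
  obtain g where g: "g \<in> hajlasz_gradients \<mu> 1 f \<inter> Lp_space \<mu> Q" using ne by blast
  have "edge_diff ini ter (poisson_ext \<mu> f) \<in> weak_lp Q (filling_edges N)"
    unfolding weak_lp_def using ec[OF g] S0[of g] by blast
  then show "f \<in> A_space \<mu> N ini ter Q" unfolding A_space_def using fi by simp
  have le: "A_seminorm \<mu> N ini ter Q f \<le> Q / (Q - 1) * (edge_const powr (1 / Q) * Lp_norm \<mu> Q g)"
    if g: "g \<in> hajlasz_gradients \<mu> 1 f \<inter> Lp_space \<mu> Q" for g
    unfolding A_seminorm_def by (rule weak_lp_norm_le[OF Q S0 edges_nonempty ec[OF g]])
  define c where "c = Q / (Q - 1) * edge_const powr (1 / Q)"
  have c0: "0 \<le> c" unfolding c_def using Q by simp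
  show "A_seminorm \<mu> N ini ter Q f \<le> Q / (Q - 1) * edge_const powr (1 / Q) * M_seminorm \<mu> 1 Q f"
    unfolding c_def[symmetric]
  proof (cases "c = 0")
    case True
    have "A_seminorm \<mu> N ini ter Q f \<le> c * Lp_norm \<mu> Q g" using le[OF g] unfolding c_def by (simp only: mult.assoc)
    then show "A_seminorm \<mu> N ini ter Q f \<le> c * M_seminorm \<mu> 1 Q f" using True by simp
  next
    case False
    have "A_seminorm \<mu> N ini ter Q f / c \<le> M_seminorm \<mu> 1 Q f"
      unfolding M_seminorm_def
    proof (rule cINF_greatest[OF ne])
      fix g assume "g \<in> hajlasz_gradients \<mu> 1 f \<inter> Lp_space \<mu> Q"
      then show "A_seminorm \<mu> N ini ter Q f / c \<le> Lp_norm \<mu> Q g"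
        using le[of g] False c0 unfolding c_def[symmetric] mult.assoc[symmetric] by (simp add: field_simps)
    qed
    then show "A_seminorm \<mu> N ini ter Q f \<le> c * M_seminorm \<mu> 1 Q f" using False c0 by (simp add: field_simps)
  qed
qed

end

section \<open>Discretization at a level of the filling\<close>

lemma sum_powr_le_card:
  fixes a :: "'i \<Rightarrow> real"
  assumes "finite J" "\<And>j. j \<in> J \<Longrightarrow> 0 \<le> a j" "0 < q" "real (card J) \<le> c"
  shows "(\<Sum>j\<in>J. a j) powr q \<le> c powr q * (\<Sum>j\<in>J. a j powr q)"
proof (cases "J = {}")
  case False
  then have "Max (a ` J) \<in> a ` J" using assms(1) by (intro Max_in) auto
  then obtain i where i: "i \<in> J" "a i = Max (a ` J)" by auto
  then have max: "\<And>j. j \<in> J \<Longrightarrow> a j \<le> a i" using assms(1) by auto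
  have "(\<Sum>j\<in>J. a j) \<le> real (card J) * a i" using sum_bounded_above[of J a "a i"] max by simp
  also have "\<dots> \<le> c * a i" using assms(2)[OF i(1)] assms(4) by (intro mult_right_mono)
  finally have "(\<Sum>j\<in>J. a j) powr q \<le> (c * a i) powr q"
    using assms by (intro powr_mono2) (auto intro: sum_nonneg)
  also have "\<dots> = c powr q * a i powr q" by (rule powr_mult)
  also have "\<dots> \<le> c powr q * (\<Sum>j\<in>J. a j powr q)"
    using assms i by (intro mult_left_mono member_le_sum) auto
  finally show ?thesis .
qed simp

context ahlfors_filling
begin

definition active :: "nat \<Rightarrow> 'a \<Rightarrow> 'a set" where "active n x = {z\<in>N n. dist x z < 2 * (1/2)^n}"

text \<open>A tent of height 2 and slope 2^n supported in the ball of the vertex. It is at least 1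
  on the concentric half-ball, and those cover the space by maximality of the net, so the
  normalizing sum is at least 1.\<close>

definition psi :: "nat \<Rightarrow> 'a \<Rightarrow> 'a \<Rightarrow> real" where "psi n z x = max 0 (2 - 2^n * dist x z)"

definition psi_sum :: "nat \<Rightarrow> 'a \<Rightarrow> real" where "psi_sum n x = (\<Sum>z\<in>N n. psi n z x)"

definition phi :: "nat \<Rightarrow> 'a \<Rightarrow> 'a \<Rightarrow> real" where "phi n z x = psi n z x / psi_sum n x"

definition disc :: "nat \<Rightarrow> ('a \<Rightarrow> real) \<Rightarrow> 'a \<Rightarrow> real" where
  "disc n f x = (\<Sum>z\<in>N n. avg z (2 * (1/2)^n) f * phi n z x)"

definition part_const :: real where "part_const = 1 + 2 * net_bound 2"

lemma part_const_pos: "0 < part_const" unfolding part_const_def using net_bound_pos[of 2] by simp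

lemma active_count: "1 \<le> n \<Longrightarrow> finite (active n x) \<and> real (card (active n x)) \<le> net_bound 2"
  unfolding active_def by (rule net_count) auto

lemma psi_nonneg: "0 \<le> psi n z x" unfolding psi_def by simp

lemma psi_zero: "z \<in> N n \<Longrightarrow> z \<notin> active n x \<Longrightarrow> psi n z x = 0"
  unfolding active_def psi_def by (simp add: power_one_over field_simps)

lemma psi_lipschitz: "\<bar>psi n z x - psi n z y\<bar> \<le> 2^n * dist x y"
proof -
  have "2^n * dist x z \<le> 2^n * (dist x y + dist y z)" by (intro mult_left_mono dist_triangle) auto
  moreover have "2^n * dist y z \<le> 2^n * (dist x y + dist x z)"
    using dist_triangle[of y z x] by (intro mult_left_mono) (auto simp: dist_commute)
  ultimately have "\<bar>2^n * dist x z - 2^n * dist y z\<bar> \<le> 2^n * dist x y" by (simp add: algebra_simps abs_le_iff)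
  then show ?thesis unfolding psi_def by (auto simp: max_def abs_le_iff)
qed

lemma psi_sum_ge1:
  assumes n: "1 \<le> n" shows "1 \<le> psi_sum n x"
proof -
  obtain z where z: "z \<in> N n" "dist x z < (1/2)^n" by (rule net_cover[OF n])
  have "2^n * dist x z \<le> 2^n * (1/2)^n" using z by (intro mult_left_mono) auto
  also have "\<dots> = 1" by (simp add: power_one_over)
  finally have "1 \<le> psi n z x" unfolding psi_def by simp
  also have "\<dots> \<le> psi_sum n x" unfolding psi_sum_def
    using z net_finite[OF n] psi_nonneg by (intro member_le_sum) auto
  finally show ?thesis .
qed

lemma psi_sum_lipschitz:
  assumes n: "1 \<le> n" shows "\<bar>psi_sum n x - psi_sum n y\<bar> \<le> 2 * net_bound 2 * (2^n * dist x y)"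
proof -
  have "psi_sum n x - psi_sum n y = (\<Sum>z\<in>N n. psi n z x - psi n z y)"
    unfolding psi_sum_def by (simp add: sum_subtractf)
  also have "\<dots> = (\<Sum>z\<in>active n x \<union> active n y. psi n z x - psi n z y)"
    using net_finite[OF n] psi_zero by (intro sum.mono_neutral_right) (auto simp: active_def)
  also have "\<bar>\<dots>\<bar> \<le> (\<Sum>z\<in>active n x \<union> active n y. \<bar>psi n z x - psi n z y\<bar>)" by (rule sum_abs)
  also have "\<dots> \<le> (\<Sum>z\<in>active n x \<union> active n y. 2^n * dist x y)" by (intro sum_mono psi_lipschitz)
  also have "\<dots> = real (card (active n x \<union> active n y)) * (2^n * dist x y)" by simp
  also have "\<dots> \<le> 2 * net_bound 2 * (2^n * dist x y)"
  proof (rule mult_right_mono)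
    have "card (active n x \<union> active n y) \<le> card (active n x) + card (active n y)" by (rule card_Un_le)
    then have "real (card (active n x \<union> active n y)) \<le> real (card (active n x)) + real (card (active n y))" by linarith
    then show "real (card (active n x \<union> active n y)) \<le> 2 * net_bound 2" using active_count[OF n, of x] active_count[OF n, of y] by linarith
  qed simp
  finally show ?thesis .
qed

lemma phi_nonneg: "1 \<le> n \<Longrightarrow> 0 \<le> phi n z x"
  unfolding phi_def using psi_nonneg[of n z x] psi_sum_ge1[of n x] by simp

lemma phi_zero: "z \<in> N n \<Longrightarrow> z \<notin> active n x \<Longrightarrow> phi n z x = 0"
  unfolding phi_def by (simp add: psi_zero)

lemma phi_sum: "1 \<le> n \<Longrightarrow> (\<Sum>z\<in>N n. phi n z x) = 1"
  unfolding phi_def sum_divide_distrib[symmetric] psi_sum_def[symmetric]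
  using psi_sum_ge1[of n x] by simp

lemma phi_le1:
  assumes n: "1 \<le> n" "z \<in> N n" shows "phi n z x \<le> 1"
  using member_le_sum[of z "N n" "\<lambda>z. phi n z x"] phi_sum[OF n(1), of x] phi_nonneg[OF n(1)] net_finite[OF n(1)] n(2) by simp

lemma phi_lipschitz:
  assumes n: "1 \<le> n" and z: "z \<in> N n" shows "\<bar>phi n z x - phi n z y\<bar> \<le> part_const * 2^n * dist x y"
proof -
  let ?a = "psi n z x" and ?b = "psi n z y" and ?s = "psi_sum n x" and ?t = "psi_sum n y"
  have s: "1 \<le> ?s" "1 \<le> ?t" using psi_sum_ge1[OF n] by auto
  have bt: "0 \<le> ?b" "?b \<le> ?t" unfolding psi_sum_def
    using psi_nonneg net_finite[OF n] z by (auto intro: member_le_sum)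
  \<comment> \<open>A quotient rule in which ?b/?t is kept together: it is at most 1, so the
    variation of the normalizing sum enters only linearly.\<close>
  have "?a / ?s - ?b / ?t = (?a - ?b) / ?s + (?b / ?t) * ((?t - ?s) / ?s)"
    using s by (simp add: field_simps)
  then have "\<bar>?a / ?s - ?b / ?t\<bar> \<le> \<bar>(?a - ?b) / ?s\<bar> + \<bar>(?b / ?t) * ((?t - ?s) / ?s)\<bar>" by linarith
  also have "\<bar>(?a - ?b) / ?s\<bar> \<le> \<bar>?a - ?b\<bar>" using s by (simp add: abs_divide divide_le_eq mult_le_cancel_left1)
  also have "\<bar>(?b / ?t) * ((?t - ?s) / ?s)\<bar> \<le> 1 * \<bar>?t - ?s\<bar>"
    unfolding abs_mult
  proof (rule mult_mono)
    show "\<bar>?b / ?t\<bar> \<le> 1" using bt s by simp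
    show "\<bar>(?t - ?s) / ?s\<bar> \<le> \<bar>?t - ?s\<bar>" using s by (simp add: abs_divide divide_le_eq mult_le_cancel_left1)
  qed auto
  finally have "\<bar>phi n z x - phi n z y\<bar> \<le> \<bar>?a - ?b\<bar> + \<bar>?t - ?s\<bar>" unfolding phi_def by simp
  also have "\<dots> \<le> 2^n * dist x y + 2 * net_bound 2 * (2^n * dist x y)"
    using psi_lipschitz[of n z x y] psi_sum_lipschitz[OF n, of x y] by (simp add: abs_minus_commute)
  finally show ?thesis unfolding part_const_def by (simp add: algebra_simps)
qed

lemma disc_lipschitz:
  assumes n: "1 \<le> n" shows "\<exists>L. L-lipschitz_on UNIV (disc n f)"
proof -
  have "(\<Sum>z\<in>N n. \<bar>avg z (2 * (1/2)^n) f\<bar> * (part_const * 2^n))-lipschitz_on UNIV (\<lambda>x. \<Sum>z\<in>N n. avg z (2 * (1/2)^n) f * phi n z x)"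
  proof (intro lipschitz_on_sum lipschitz_on_cmult_real)
    fix z assume "z \<in> N n"
    then show "(part_const * 2^n)-lipschitz_on UNIV (phi n z)"
      using phi_lipschitz[OF n] part_const_pos by (intro lipschitz_onI_abs_real) auto
  qed
  then show ?thesis unfolding disc_def[abs_def] by blast
qed

text \<open>Ordered pairs, so that all neighbours of a fixed first component can be collected; each
  unoriented edge then occurs twice, which costs the factor 2 in \<open>jump_sum_le\<close>.\<close>

definition adj_pairs :: "nat \<Rightarrow> ('a \<times> 'a) set" where
  "adj_pairs n = {(w, z). w \<in> N n \<and> z \<in> N n \<and> w \<noteq> z \<and> ball w (2 * (1/2)^n) \<inter> ball z (2 * (1/2)^n) \<noteq> {}}"

definition jump :: "nat \<Rightarrow> ('a \<Rightarrow> real) \<Rightarrow> 'a \<times> 'a \<Rightarrow> real" where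
  "jump n f p = \<bar>avg (fst p) (2 * (1/2)^n) f - avg (snd p) (2 * (1/2)^n) f\<bar>"

text \<open>A measurable, bounded majorant of \<open>Lip (disc n f)\<close>, of the kind required by
  \<open>strong_type\<close>: near a net point it adds up the jumps to its neighbours, scaled by the
  slope 2^n.\<close>

definition rho :: "nat \<Rightarrow> ('a \<Rightarrow> real) \<Rightarrow> 'a \<Rightarrow> real" where
  "rho n f x = part_const * 2^n * (\<Sum>p\<in>adj_pairs n. indicator (ball (fst p) ((1/2)^n)) x * jump n f p)"

lemma adj_pairs_finite: "1 \<le> n \<Longrightarrow> finite (adj_pairs n)"
  using finite_subset[of "adj_pairs n" "N n \<times> N n"] net_finite[of n] by (auto simp: adj_pairs_def)

lemma adj_pairs_dist: "(w, z) \<in> adj_pairs n \<Longrightarrow> dist w z < 4 * (1/2)^n"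
  unfolding adj_pairs_def using dist_triangle_half_l[of w _ "4 * (1/2)^n" z] by (auto simp: dist_commute)

lemma jump_nonneg: "0 \<le> jump n f p" unfolding jump_def by simp

lemma rho_measurable: "rho n f \<in> borel_measurable \<mu>"
  unfolding rho_def[abs_def] by measurable

lemma rho_bounds:
  "0 \<le> rho n f x" "rho n f x \<le> part_const * 2^n * (\<Sum>p\<in>adj_pairs n. jump n f p)"
  unfolding rho_def using part_const_pos jump_nonneg
  by (auto intro!: mult_nonneg_nonneg sum_nonneg mult_left_mono sum_mono split: split_indicator)

lemma Lip_disc_le:
  assumes n: "1 \<le> n" shows "Lip (disc n f) x \<le> rho n f x"
proof (rule Lip_le[where s = "(1/2)^n"])
  fix y assume y: "dist x y < (1/2)^n"
  obtain w where w: "w \<in> N n" "dist x w < (1/2)^n" by (rule net_cover[OF n])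
  let ?r = "2 * (1/2::real)^n"
  \<comment> \<open>The partition functions sum to 1, so the average at a net point \<open>w\<close>
    near \<open>x\<close> may be subtracted. The ball of \<open>w\<close> contains \<open>x\<close>
    and \<open>y\<close>, hence only net points adjacent to \<open>w\<close> contribute.\<close>
  have e: "disc n f v = (\<Sum>z\<in>N n. (avg z ?r f - avg w ?r f) * phi n z v) + avg w ?r f" for v
    unfolding disc_def left_diff_distrib sum_subtractf
    using phi_sum[OF n, of v] by (simp flip: sum_distrib_left)
  have "disc n f y - disc n f x = (\<Sum>z\<in>N n. (avg z ?r f - avg w ?r f) * (phi n z y - phi n z x))"
    unfolding e[of x] e[of y] by (simp add: right_diff_distrib sum_subtractf)
  also have "\<dots> = (\<Sum>z\<in>{z. (w, z) \<in> adj_pairs n}. (avg z ?r f - avg w ?r f) * (phi n z y - phi n z x))"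
  proof (rule sum.mono_neutral_right)
    show "finite (N n)" using net_finite n by blast
    show "{z. (w, z) \<in> adj_pairs n} \<subseteq> N n" by (auto simp: adj_pairs_def)
    show "\<forall>z\<in>N n - {z. (w, z) \<in> adj_pairs n}. (avg z ?r f - avg w ?r f) * (phi n z y - phi n z x) = 0"
    proof
      fix z assume z: "z \<in> N n - {z. (w, z) \<in> adj_pairs n}"
      show "(avg z ?r f - avg w ?r f) * (phi n z y - phi n z x) = 0"
      proof (cases "z = w")
        case False
        then have disj: "ball w ?r \<inter> ball z ?r = {}" using z w by (auto simp: adj_pairs_def)
        have "dist w x < (1/2)^n" "0 < (1/2::real)^n" using w(2) by (simp_all add: dist_commute)
        then have "dist w x < ?r" "dist w y < ?r" using y dist_triangle[of w y x] by linarith+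
        then have "x \<in> ball w ?r" "y \<in> ball w ?r" by simp_all
        then have "x \<notin> ball z ?r" "y \<notin> ball z ?r" using disj by (meson disjoint_iff)+
        then have "z \<notin> active n x" "z \<notin> active n y" unfolding active_def by (simp_all add: dist_commute)
        then have "phi n z x = 0" "phi n z y = 0" using z by (simp_all only: phi_zero Diff_iff not_False_eq_True)
        then show ?thesis by simp
      qed simp
    qed
  qed
  finally have diff: "disc n f y - disc n f x = (\<Sum>z\<in>{z. (w, z) \<in> adj_pairs n}. (avg z ?r f - avg w ?r f) * (phi n z y - phi n z x))" .
  have "\<bar>disc n f y - disc n f x\<bar> \<le> (\<Sum>z\<in>{z. (w, z) \<in> adj_pairs n}. \<bar>(avg z ?r f - avg w ?r f) * (phi n z y - phi n z x)\<bar>)"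
    unfolding diff by (rule sum_abs)
  also have "\<dots> \<le> (\<Sum>z\<in>{z. (w, z) \<in> adj_pairs n}. jump n f (w, z) * (part_const * 2^n * dist x y))"
  proof (rule sum_mono)
    fix z assume "z \<in> {z. (w, z) \<in> adj_pairs n}"
    then have "\<bar>phi n z y - phi n z x\<bar> \<le> part_const * 2^n * dist x y"
      using phi_lipschitz[OF n, of z x y] by (simp add: adj_pairs_def abs_minus_commute)
    then show "\<bar>(avg z ?r f - avg w ?r f) * (phi n z y - phi n z x)\<bar> \<le> jump n f (w, z) * (part_const * 2^n * dist x y)"
      unfolding abs_mult jump_def by (intro mult_mono) (auto simp: abs_minus_commute)
  qed
  also have "\<dots> = part_const * 2^n * dist x y * (\<Sum>z\<in>{z. (w, z) \<in> adj_pairs n}. jump n f (w, z))"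
    by (simp add: sum_distrib_left mult.commute)
  also have "(\<Sum>z\<in>{z. (w, z) \<in> adj_pairs n}. jump n f (w, z)) = (\<Sum>p\<in>Pair w ` {z. (w, z) \<in> adj_pairs n}. jump n f p)"
    by (subst sum.reindex) (auto simp: inj_on_def)
  also have "\<dots> = (\<Sum>p\<in>Pair w ` {z. (w, z) \<in> adj_pairs n}. indicator (ball (fst p) ((1/2)^n)) x * jump n f p)"
    using w by (intro sum.cong) (auto simp: dist_commute)
  also have "\<dots> \<le> (\<Sum>p\<in>adj_pairs n. indicator (ball (fst p) ((1/2)^n)) x * jump n f p)"
    using adj_pairs_finite[OF n] jump_nonneg by (intro sum_mono2) auto
  finally show "\<bar>disc n f y - disc n f x\<bar> \<le> rho n f x * dist x y"
    unfolding rho_def using part_const_pos by (simp add: mult_left_mono mult_right_mono ac_simps)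
qed (use rho_bounds in auto)

definition energy_const :: real where "energy_const = (part_const * (net_bound 2 * net_bound 5)) powr Q * K"

lemma energy_const_nonneg: "0 \<le> energy_const" unfolding energy_const_def using K by simp

text \<open>Bounded overlap moves the power Q inside the sum. The factor 2^(nQ) from the slopes
  cancels the measure of the balls, and the constant does not depend on the level: here the exponent
  equals the dimension.\<close>

lemma rho_integral:
  assumes n: "1 \<le> n"
  shows "(LINT x|\<mu>. rho n f x powr Q) \<le> energy_const * (\<Sum>p\<in>adj_pairs n. jump n f p powr Q)"
proof -
  let ?b = "\<lambda>p. ball (fst p) ((1/2)^n)"
  let ?c = "part_const * (net_bound 2 * net_bound 5) * 2^n"
  have pt: "rho n f x powr Q \<le> ?c powr Q * (\<Sum>p\<in>adj_pairs n. indicator (?b p) x * jump n f p powr Q)" for x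
  proof -
    define J where "J = {p\<in>adj_pairs n. x \<in> ?b p}"
    have fJ: "finite J" unfolding J_def using adj_pairs_finite[OF n] by simp
    have ind: "(\<Sum>p\<in>adj_pairs n. indicator (?b p) x * h p) = (\<Sum>p\<in>J. h p)" for h :: "'a \<times> 'a \<Rightarrow> real"
    proof -
      have "(\<Sum>p\<in>J. h p) = (\<Sum>p\<in>adj_pairs n. if x \<in> ?b p then h p else 0)"
        unfolding J_def by (rule sum.inter_filter[OF adj_pairs_finite[OF n]])
      also have "\<dots> = (\<Sum>p\<in>adj_pairs n. indicator (?b p) x * h p)" by (intro sum.cong) (auto simp: indicator_def)
      finally show ?thesis ..
    qed
    \<comment> \<open>A neighbour of a net point within (1/2)^n of \<open>x\<close> is less than 1 +
      4 = 5 units of (1/2)^n away from \<open>x\<close>.\<close>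
    have n5: "finite {z\<in>N n. dist x z < 5 * (1/2)^n}" "real (card {z\<in>N n. dist x z < 5 * (1/2)^n}) \<le> net_bound 5"
      using net_count[OF n, of 5 x] by auto
    have sub: "J \<subseteq> active n x \<times> {z\<in>N n. dist x z < 5 * (1/2)^n}"
    proof
      fix p assume p: "p \<in> J"
      obtain w z where wz: "p = (w, z)" by (cases p)
      then have "(w, z) \<in> adj_pairs n" "dist w x < (1/2)^n" using p unfolding J_def by auto
      then have "w \<in> N n" "z \<in> N n" "dist w z < 4 * (1/2)^n" "dist x w < (1/2)^n"
        using adj_pairs_dist by (auto simp: adj_pairs_def dist_commute)
      moreover have "0 < (1/2::real)^n" by simp
      ultimately have "w \<in> N n" "z \<in> N n" "dist x w < 2 * (1/2)^n" "dist x z < 5 * (1/2)^n"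
        using dist_triangle[of x z w] by linarith+
      then show "p \<in> active n x \<times> {z\<in>N n. dist x z < 5 * (1/2)^n}"
        using wz unfolding active_def by simp
    qed
    have "card J \<le> card (active n x \<times> {z\<in>N n. dist x z < 5 * (1/2)^n})"
      using sub n5 active_count[OF n, of x] by (intro card_mono) auto
    then have "real (card J) \<le> real (card (active n x)) * real (card {z\<in>N n. dist x z < 5 * (1/2)^n})"
      unfolding card_cartesian_product by (metis of_nat_le_iff of_nat_mult)
    also have "\<dots> \<le> net_bound 2 * net_bound 5" using n5 active_count[OF n, of x] net_bound_pos[of 2] by (intro mult_mono) auto
    finally have cJ: "real (card J) \<le> net_bound 2 * net_bound 5" .
    have "rho n f x powr Q = (part_const * 2^n) powr Q * (\<Sum>p\<in>J. jump n f p) powr Q"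
      unfolding rho_def ind by (rule powr_mult)
    also have "\<dots> \<le> (part_const * 2^n) powr Q * ((net_bound 2 * net_bound 5) powr Q * (\<Sum>p\<in>J. jump n f p powr Q))"
      using Q by (intro mult_left_mono sum_powr_le_card fJ cJ jump_nonneg) auto
    also have "\<dots> = ((part_const * 2^n) * (net_bound 2 * net_bound 5)) powr Q * (\<Sum>p\<in>J. jump n f p powr Q)"
      unfolding powr_mult[of "part_const * 2^n"] by simp
    also have "(part_const * 2^n) * (net_bound 2 * net_bound 5) = ?c" by simp
    finally show ?thesis unfolding ind .
  qed
  have ib: "integrable \<mu> (\<lambda>x. indicator (?b p) x * jump n f p powr Q)" for p
    by (intro integrable_mult_left indicator_integrable) simp
  have "(LINT x|\<mu>. rho n f x powr Q) \<le> (LINT x|\<mu>. ?c powr Q * (\<Sum>p\<in>adj_pairs n. indicator (?b p) x * jump n f p powr Q))"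
    using ib pt by (intro integral_mono_AE_nonneg) (auto intro!: AE_I2 order_trans[OF powr_ge_zero pt] Bochner_Integration.integrable_sum simp del: sum_indicator_mult)
  also have "\<dots> = ?c powr Q * (\<Sum>p\<in>adj_pairs n. measure \<mu> (?b p) * jump n f p powr Q)"
    using ib by (simp add: Bochner_Integration.integral_sum del: sum_indicator_mult)
  also have "\<dots> \<le> ?c powr Q * (\<Sum>p\<in>adj_pairs n. K * ((1/2)^n) powr Q * jump n f p powr Q)"
    by (intro mult_left_mono sum_mono mult_right_mono upper) auto
  also have "\<dots> = (?c powr Q * ((1/2)^n) powr Q) * K * (\<Sum>p\<in>adj_pairs n. jump n f p powr Q)"
    by (simp add: sum_distrib_left ac_simps)
  also have "?c powr Q * ((1/2)^n) powr Q = (part_const * (net_bound 2 * net_bound 5)) powr Q"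
    unfolding powr_mult[symmetric] by (simp add: power_one_over)
  finally show ?thesis unfolding energy_const_def .
qed

section \<open>Energy of the edges within a level and good levels\<close>

definition level_edge :: "nat \<Rightarrow> 'a \<times> 'a \<Rightarrow> 'a vertex set" where
  "level_edge n p = {Vertex n (fst p), Vertex n (snd p)}"

lemma level_edge_edge: "1 \<le> n \<Longrightarrow> p \<in> adj_pairs n \<Longrightarrow> level_edge n p \<in> filling_edges N"
  unfolding filling_edges_def level_edge_def
  by (intro CollectI exI[of _ "Vertex n (fst p)"] exI[of _ "Vertex n (snd p)"])
     (auto simp: adj_pairs_def filling_vertices_def powr_half)

lemma jump_edge:
  assumes "1 \<le> n" "p \<in> adj_pairs n"
  shows "jump n f p = \<bar>edge_diff ini ter (poisson_ext \<mu> f) (level_edge n p)\<bar>"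
  using edge_diff_pair[OF level_edge_edge[OF assms, unfolded level_edge_def], of "poisson_ext \<mu> f"]
  unfolding level_edge_def jump_def poisson_ext_def by (simp add: powr_half)

lemma jump_sum_le:
  assumes n: "1 \<le> n"
  shows "(\<Sum>p\<in>adj_pairs n. jump n f p powr Q) \<le>
    2 * (\<Sum>e\<in>level_edge n ` adj_pairs n. \<bar>edge_diff ini ter (poisson_ext \<mu> f) e\<bar> powr Q)"
proof -
  let ?h = "\<lambda>e. \<bar>edge_diff ini ter (poisson_ext \<mu> f) e\<bar> powr Q"
  have "(\<Sum>p\<in>adj_pairs n. jump n f p powr Q) = (\<Sum>p\<in>adj_pairs n. ?h (level_edge n p))"
    by (intro sum.cong) (auto simp: jump_edge[OF n])
  also have "\<dots> = (\<Sum>e\<in>level_edge n ` adj_pairs n. \<Sum>p\<in>{p\<in>adj_pairs n. level_edge n p = e}. ?h (level_edge n p))"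
    by (rule sum.image_gen[OF adj_pairs_finite[OF n]])
  also have "\<dots> = (\<Sum>e\<in>level_edge n ` adj_pairs n. real (card {p\<in>adj_pairs n. level_edge n p = e}) * ?h e)"
    by (intro sum.cong refl) simp
  also have "\<dots> \<le> (\<Sum>e\<in>level_edge n ` adj_pairs n. 2 * ?h e)"
  proof (intro sum_mono mult_right_mono)
    fix e assume "e \<in> level_edge n ` adj_pairs n"
    then obtain a b where e: "e = {Vertex n a, Vertex n b}" by (auto simp: level_edge_def)
    have "{p\<in>adj_pairs n. level_edge n p = e} \<subseteq> {(a, b), (b, a)}"
      unfolding e level_edge_def by (auto simp: doubleton_eq_iff)
    also have "{(a, b), (b, a)} = set [(a, b), (b, a)]" by simp
    finally have "card {p\<in>adj_pairs n. level_edge n p = e} \<le> card (set [(a, b), (b, a)])"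
      by (rule card_mono[rotated]) (rule finite_set)
    also have "\<dots> \<le> length [(a, b), (b, a)]" by (rule card_length)
    finally show "real (card {p\<in>adj_pairs n. level_edge n p = e}) \<le> 2" by simp
  qed simp
  finally show ?thesis by (simp add: sum_distrib_left)
qed

lemma card_level_edge:
  assumes n: "1 \<le> n" shows "real (card (level_edge n ` adj_pairs n)) \<le> net_bound 4 * (K\<^sup>2 * 6 powr Q) * (2 powr Q)^n"
proof -
  let ?A = "\<lambda>w. {z\<in>N n. dist w z < 4 * (1/2)^n}"
  have fA: "finite (?A w)" "real (card (?A w)) \<le> net_bound 4" for w using net_count[OF n, of 4 w] by auto
  have "card (level_edge n ` adj_pairs n) \<le> card (adj_pairs n)" by (rule card_image_le[OF adj_pairs_finite[OF n]])
  also have "\<dots> \<le> card (Sigma (N n) ?A)"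
  proof (rule card_mono)
    show "finite (Sigma (N n) ?A)" by (intro finite_SigmaI net_finite(1)[OF n] fA(1))
    show "adj_pairs n \<subseteq> Sigma (N n) ?A"
    proof
      fix p assume "p \<in> adj_pairs n"
      then show "p \<in> Sigma (N n) ?A" using adj_pairs_dist[of "fst p" "snd p" n] by (auto simp: adj_pairs_def)
    qed
  qed
  also have "\<dots> = (\<Sum>w\<in>N n. card (?A w))" by (rule card_SigmaI[OF net_finite(1)[OF n]]) (simp add: fA(1))
  finally have "real (card (level_edge n ` adj_pairs n)) \<le> (\<Sum>w\<in>N n. real (card (?A w)))"
    unfolding of_nat_sum[symmetric] of_nat_le_iff .
  also have "\<dots> \<le> (\<Sum>w\<in>N n. net_bound 4)" by (intro sum_mono fA)
  also have "\<dots> = net_bound 4 * real (card (N n))" by simp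
  also have "\<dots> \<le> net_bound 4 * (K\<^sup>2 * 6 powr Q * (2 powr Q)^n)"
    using net_finite[OF n] net_bound_pos[of 4] by (intro mult_left_mono) auto
  finally show ?thesis by (simp add: mult.assoc)
qed

definition log_const :: real where "log_const = 1 + ln (max 1 (net_bound 4 * (K\<^sup>2 * 6 powr Q))) + (Q + 1) * ln 2"

lemma log_const_nonneg: "0 \<le> log_const"
  unfolding log_const_def using Q by (intro add_nonneg_nonneg mult_nonneg_nonneg ln_ge_zero) auto

text \<open>Edges of different levels are different sets, so all levels form one family. Its
  cardinality is exponential in \<open>M\<close>, and the harmonic bound turns this into a linear
  one.\<close>

lemma energy_sum_le:
  assumes s: "s \<in> weak_lp Q (filling_edges N)" and M: "1 \<le> M"
  shows "(\<Sum>n\<in>{1..M}. \<Sum>e\<in>level_edge n ` adj_pairs n. \<bar>s e\<bar> powr Q) \<le>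
    log_const * real M * weak_lp_norm Q (filling_edges N) s powr Q"
proof -
  define U where "U = (\<Union>n\<in>{1..M}. level_edge n ` adj_pairs n)"
  have fin: "finite (level_edge n ` adj_pairs n)" if "n \<in> {1..M}" for n using adj_pairs_finite that by auto
  have fU: "finite U" unfolding U_def using fin by auto
  have sub: "U \<subseteq> filling_edges N" unfolding U_def using level_edge_edge by auto
  have "(\<Sum>n\<in>{1..M}. \<Sum>e\<in>level_edge n ` adj_pairs n. \<bar>s e\<bar> powr Q) = (\<Sum>e\<in>U. \<bar>s e\<bar> powr Q)"
    unfolding U_def using fin
    by (intro sum.UNION_disjoint[symmetric]) (auto simp: level_edge_def doubleton_eq_iff)
  also have "\<dots> \<le> weak_lp_norm Q (filling_edges N) s powr Q * harm (card U)"
    by (rule sum_powr_le_harm[OF Q s sub fU])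
  also have "\<dots> \<le> weak_lp_norm Q (filling_edges N) s powr Q * (log_const * real M)"
  proof (intro mult_left_mono)
    let ?D = "max 1 (net_bound 4 * (K\<^sup>2 * 6 powr Q))"
    show "harm (card U) \<le> log_const * real M"
    proof (cases "card U = 0")
      case True
      then show ?thesis using log_const_nonneg by (simp add: harm_def)
    next
      case False
      have "card U \<le> (\<Sum>n\<in>{1..M}. card (level_edge n ` adj_pairs n))" unfolding U_def by (intro card_UN_le) auto
      then have "real (card U) \<le> (\<Sum>n\<in>{1..M}. real (card (level_edge n ` adj_pairs n)))"
        unfolding of_nat_sum[symmetric] of_nat_le_iff .
      also have "\<dots> \<le> (\<Sum>n\<in>{1..M}. ?D * (2 powr Q)^M)"
      proof (rule sum_mono)
        fix n assume n: "n \<in> {1..M}"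
        have "real (card (level_edge n ` adj_pairs n)) \<le> net_bound 4 * (K\<^sup>2 * 6 powr Q) * (2 powr Q)^n" using n by (intro card_level_edge) auto
        also have "\<dots> \<le> ?D * (2 powr Q)^M"
          using n Q by (intro mult_mono power_increasing) (auto simp: ge_one_powr_ge_zero)
        finally show "real (card (level_edge n ` adj_pairs n)) \<le> ?D * (2 powr Q)^M" .
      qed
      also have "\<dots> = real M * (?D * (2 powr Q)^M)" by simp
      \<comment> \<open>Estimating the number of levels by 2^M keeps the bound geometric; this is
        the Q + 1 in \<open>log_const\<close>.\<close>
      also have "\<dots> \<le> 2^M * (?D * (2 powr Q)^M)"
        using of_nat_less_two_power[of M, where 'a = real] by (intro mult_right_mono) auto
      also have "\<dots> = ?D * (2 powr (Q + 1))^M" by (simp add: powr_add power_mult_distrib)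
      finally have le: "real (card U) \<le> ?D * (2 powr (Q + 1))^M" .
      have "harm (card U) \<le> 1 + ln (real (card U))" using False by (intro harm_le_ln) auto
      also have "ln (real (card U)) \<le> ln (?D * (2 powr (Q + 1))^M)" using le False by (intro ln_mono) auto
      also have "\<dots> = ln ?D + real M * ((Q + 1) * ln 2)" by (subst ln_mult) (auto simp: ln_realpow ln_powr)
      also have "1 + \<dots> \<le> real M * 1 + (real M * ln ?D + real M * ((Q + 1) * ln 2))"
        using M mult_right_mono[of 1 "real M" "ln ?D"] by (intro add_mono) auto
      finally show ?thesis unfolding log_const_def by (simp add: algebra_simps)
    qed
  qed simp
  finally show ?thesis by (simp add: mult.commute)
qed

text \<open>Otherwise some block k+1, ..., 2k consists of bad levels. Its k levels, each above twice
  the mean bound, would exceed the bound available for all 2k levels.\<close>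

lemma infinitely_many_good_levels:
  assumes s: "s \<in> weak_lp Q (filling_edges N)"
  shows "infinite {n. 1 \<le> n \<and> (\<Sum>e\<in>level_edge n ` adj_pairs n. \<bar>s e\<bar> powr Q) \<le> 2 * log_const * weak_lp_norm Q (filling_edges N) s powr Q}"
    (is "infinite ?G")
proof
  assume "finite ?G"
  define B where "B = log_const * weak_lp_norm Q (filling_edges N) s powr Q"
  define a where "a = (\<lambda>n. \<Sum>e\<in>level_edge n ` adj_pairs n. \<bar>s e\<bar> powr Q)"
  obtain m where m: "\<And>n. n \<in> ?G \<Longrightarrow> n \<le> m" using \<open>finite ?G\<close> finite_nat_set_iff_bounded_le by auto
  define k where "k = Suc m"
  have k: "1 \<le> k" "k \<le> 2 * k" by (auto simp: k_def)
  have big: "2 * B < a n" if "n \<in> {k+1..2*k}" for n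
  proof (rule ccontr)
    assume "\<not> ?thesis"
    then have "n \<in> ?G" using that unfolding a_def B_def by auto
    then show False using m[of n] that unfolding k_def by simp
  qed
  have "real k * (2 * B) = (\<Sum>n\<in>{k+1..2*k}. 2 * B)" by simp
  also have "\<dots> < (\<Sum>n\<in>{k+1..2*k}. a n)" using k by (intro sum_strict_mono big) auto
  also have "\<dots> \<le> (\<Sum>n\<in>{1..2*k}. a n)" unfolding a_def by (intro sum_mono2) (auto intro: sum_nonneg)
  also have "\<dots> \<le> log_const * real (2 * k) * weak_lp_norm Q (filling_edges N) s powr Q"
    unfolding a_def using k by (intro energy_sum_le s) auto
  also have "\<dots> = real k * (2 * B)" unfolding B_def by simp
  finally show False by simp
qed

section \<open>Convergence of the discretizations\<close>

lemma disc_integrable: "1 \<le> n \<Longrightarrow> integrable \<mu> (disc n f)"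
  using disc_lipschitz[of n f] lipschitz_integrable by blast

lemma disc_L1_bound:
  assumes n: "1 \<le> n" and f: "integrable \<mu> f"
  shows "(LINT x|\<mu>. \<bar>disc n f x\<bar>) \<le> net_bound 2 * (LINT x|\<mu>. \<bar>f x\<bar>)"
proof -
  let ?B = "\<lambda>z. ball z (2 * (1/2)^n)"
  let ?a = "\<lambda>z. avg z (2 * (1/2)^n) (\<lambda>x. \<bar>f x\<bar>)"
  have a0: "0 \<le> ?a z" for z by (rule avg_nonneg) simp
  have ii: "integrable \<mu> (\<lambda>x. indicator (?B z) x * \<bar>f x\<bar>)" for z
    using integrable_mult_indicator[OF ball_meas, of "\<lambda>x. \<bar>f x\<bar>" z] f by simp
  have "(LINT x|\<mu>. \<bar>disc n f x\<bar>) \<le> (LINT x|\<mu>. (\<Sum>z\<in>N n. ?a z * indicator (?B z) x))"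
  proof (rule integral_mono)
    fix x
    have "\<bar>disc n f x\<bar> \<le> (\<Sum>z\<in>N n. \<bar>avg z (2 * (1/2)^n) f * phi n z x\<bar>)" unfolding disc_def by (rule sum_abs)
    also have "\<dots> \<le> (\<Sum>z\<in>N n. ?a z * indicator (?B z) x)"
    proof (rule sum_mono)
      fix z assume z: "z \<in> N n"
      have "phi n z x \<le> indicator (?B z) x"
        using phi_le1[OF n z] phi_zero[OF z, of x] z by (auto simp: active_def indicator_def dist_commute)
      then show "\<bar>avg z (2 * (1/2)^n) f * phi n z x\<bar> \<le> ?a z * indicator (?B z) x"
        unfolding abs_mult using avg_abs[OF f, of z] a0 phi_nonneg[OF n, of z x] by (intro mult_mono) auto
    qed
    finally show "\<bar>disc n f x\<bar> \<le> (\<Sum>z\<in>N n. ?a z * indicator (?B z) x)" .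
  next
    show "integrable \<mu> (\<lambda>x. \<Sum>z\<in>N n. ?a z * indicator (?B z) x)"
      by (intro Bochner_Integration.integrable_sum integrable_mult_right indicator_integrable) simp
  qed (use disc_integrable[OF n] in auto)
  also have "\<dots> = (\<Sum>z\<in>N n. ?a z * measure \<mu> (?B z))"
    by (subst Bochner_Integration.integral_sum) (auto intro!: integrable_mult_right indicator_integrable)
  also have "\<dots> = (\<Sum>z\<in>N n. (LINT x:?B z|\<mu>. \<bar>f x\<bar>))"
    by (intro sum.cong refl avg_mult_measure) simp
  also have "\<dots> = (LINT x|\<mu>. (\<Sum>z\<in>N n. indicator (?B z) x * \<bar>f x\<bar>))"
    unfolding set_lebesgue_integral_def real_scaleR_def
    by (rule Bochner_Integration.integral_sum[symmetric]) (rule ii)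
  also have "\<dots> \<le> (LINT x|\<mu>. net_bound 2 * \<bar>f x\<bar>)"
  proof (rule integral_mono_AE_nonneg)
    show "AE x in \<mu>. (\<Sum>z\<in>N n. indicator (?B z) x * \<bar>f x\<bar>) \<le> net_bound 2 * \<bar>f x\<bar>"
    proof (rule AE_I2)
      fix x
      have "(\<Sum>z\<in>N n. indicator (?B z) x * \<bar>f x\<bar>) = (\<Sum>z\<in>N n. if dist x z < 2 * (1/2)^n then \<bar>f x\<bar> else 0)"
        by (intro sum.cong) (auto simp: dist_commute indicator_def)
      also have "\<dots> = (\<Sum>z\<in>active n x. \<bar>f x\<bar>)"
        unfolding active_def by (rule sum.inter_filter[symmetric, OF net_finite(1)[OF n]])
      also have "\<dots> \<le> net_bound 2 * \<bar>f x\<bar>" using active_count[OF n, of x] by (simp add: mult_right_mono)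
      finally show "(\<Sum>z\<in>N n. indicator (?B z) x * \<bar>f x\<bar>) \<le> net_bound 2 * \<bar>f x\<bar>" .
    qed
  qed (use f net_bound_pos[of 2] in auto)
  finally show ?thesis by simp
qed

lemma disc_lipschitz_close:
  assumes n: "1 \<le> n" and h: "L-lipschitz_on UNIV h"
  shows "\<bar>h x - disc n h x\<bar> \<le> 4 * L * (1/2)^n"
proof -
  have L: "0 \<le> L" by (rule lipschitz_on_nonneg[OF h])
  have "h x - disc n h x = (\<Sum>z\<in>N n. (h x - avg z (2 * (1/2)^n) h) * phi n z x)"
    unfolding disc_def left_diff_distrib sum_subtractf sum_distrib_left[symmetric] phi_sum[OF n] by simp
  also have "\<bar>\<dots>\<bar> \<le> (\<Sum>z\<in>N n. \<bar>(h x - avg z (2 * (1/2)^n) h) * phi n z x\<bar>)" by (rule sum_abs)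
  also have "\<dots> \<le> (\<Sum>z\<in>N n. 4 * L * (1/2)^n * phi n z x)"
  proof (rule sum_mono)
    fix z assume z: "z \<in> N n"
    show "\<bar>(h x - avg z (2 * (1/2)^n) h) * phi n z x\<bar> \<le> 4 * L * (1/2)^n * phi n z x"
    proof (cases "z \<in> active n x")
      case True
      have "\<bar>avg z (2 * (1/2)^n) h - h x\<bar> \<le> avg z (2 * (1/2)^n) (\<lambda>y. \<bar>h y - h x\<bar>)"
        by (intro avg_diff_const lipschitz_integrable[OF h]) simp
      also have "\<dots> \<le> avg z (2 * (1/2)^n) (\<lambda>y. 4 * L * (1/2)^n)"
      proof (rule avg_mono)
        fix y assume "y \<in> ball z (2 * (1/2)^n)"
        then have "dist y x \<le> 4 * (1/2)^n"
          using True dist_triangle[of y x z] unfolding active_def by (simp add: dist_commute)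
        then have "L * dist y x \<le> L * (4 * (1/2)^n)" using L by (intro mult_left_mono)
        then show "\<bar>h y - h x\<bar> \<le> 4 * L * (1/2)^n" using lipschitz_on_abs_real[OF h, of y x] by simp
      qed (use lipschitz_integrable[OF h] in auto)
      also have "\<dots> = 4 * L * (1/2)^n" by (rule avg_const) simp
      finally show ?thesis unfolding abs_mult using phi_nonneg[OF n, of z x]
        by (intro mult_mono) (auto simp: abs_minus_commute)
    qed (simp add: phi_zero[OF z])
  qed
  also have "\<dots> = 4 * L * (1/2)^n" unfolding sum_distrib_left[symmetric] phi_sum[OF n] by simp
  finally show ?thesis .
qed

lemma disc_diff:
  "integrable \<mu> f \<Longrightarrow> integrable \<mu> g \<Longrightarrow> disc n (\<lambda>x. f x - g x) x = disc n f x - disc n g x"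
  unfolding disc_def by (simp add: avg_diff left_diff_distrib sum_subtractf)

text \<open>The operators are linear, bounded in L1 uniformly in the level, and converge uniformly
  on Lipschitz functions; density gives the rest.\<close>

lemma disc_tendsto_L1:
  assumes f: "integrable \<mu> f" and \<nu>: "filterlim \<nu> at_top sequentially" "\<And>j. 1 \<le> \<nu> j"
  shows "(\<lambda>j. LINT x|\<mu>. \<bar>disc (\<nu> j) f x - f x\<bar>) \<longlonglongrightarrow> 0"
proof (rule LIMSEQ_I)
  fix e :: real assume e: "0 < e"
  have c: "0 < 1 + net_bound 2" using net_bound_pos[of 2] by simp
  define e' where "e' = e / (2 * (1 + net_bound 2))"
  have "y * (e / (2 * y)) = e / 2" if "0 < y" for y :: real using that by simp
  then have e': "0 < e'" "(1 + net_bound 2) * e' = e / 2" unfolding e'_def using e c by (simp, blast)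
  obtain h L where h: "L-lipschitz_on UNIV h" "(LINT x|\<mu>. \<bar>f x - h x\<bar>) < e'"
    by (rule lip_approxE[OF lip_approx_integrable[OF f] e'(1)])
  have ih: "integrable \<mu> h" by (rule lipschitz_integrable[OF h(1)])
  define m where "m = measure \<mu> UNIV"
  have "(\<lambda>n. 4 * L * (1/2)^n * m) \<longlonglongrightarrow> 4 * L * 0 * m" by (intro tendsto_intros LIMSEQ_power_zero) auto
  then have "(\<lambda>j. 4 * L * (1/2)^(\<nu> j) * m) \<longlonglongrightarrow> 4 * L * 0 * m" using \<nu>(1) by (rule filterlim_compose)
  then have "\<forall>\<^sub>F j in sequentially. 4 * L * (1/2)^(\<nu> j) * m < e / 2"
    by (rule order_tendstoD(2)) (use e in simp)
  then obtain J where J: "\<And>j. J \<le> j \<Longrightarrow> 4 * L * (1/2)^(\<nu> j) * m < e / 2" by (auto simp: eventually_sequentially)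
  show "\<exists>J. \<forall>j\<ge>J. norm ((LINT x|\<mu>. \<bar>disc (\<nu> j) f x - f x\<bar>) - 0) < e"
  proof (intro exI[of _ J] allI impI)
    fix j assume j: "J \<le> j"
    have i: "integrable \<mu> (disc (\<nu> j) g)" for g using disc_integrable \<nu>(2) by blast
    have "(LINT x|\<mu>. \<bar>disc (\<nu> j) f x - f x\<bar>) \<le>
        (LINT x|\<mu>. \<bar>disc (\<nu> j) (\<lambda>x. f x - h x) x\<bar> + (4 * L * (1/2)^(\<nu> j) + \<bar>f x - h x\<bar>))"
    proof (rule integral_mono)
      fix x
      show "\<bar>disc (\<nu> j) f x - f x\<bar> \<le> \<bar>disc (\<nu> j) (\<lambda>x. f x - h x) x\<bar> + (4 * L * (1/2)^(\<nu> j) + \<bar>f x - h x\<bar>)"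
        using disc_lipschitz_close[OF \<nu>(2) h(1), of x j] unfolding disc_diff[OF f ih] by linarith
    qed (use i f ih in auto)
    also have "\<dots> = (LINT x|\<mu>. \<bar>disc (\<nu> j) (\<lambda>x. f x - h x) x\<bar>) + (4 * L * (1/2)^(\<nu> j) * m + (LINT x|\<mu>. \<bar>f x - h x\<bar>))"
      using i f ih by (subst Bochner_Integration.integral_add; simp)+ (simp add: m_def)
    also have "\<dots> \<le> net_bound 2 * (LINT x|\<mu>. \<bar>f x - h x\<bar>) + (4 * L * (1/2)^(\<nu> j) * m + (LINT x|\<mu>. \<bar>f x - h x\<bar>))"
      using disc_L1_bound[OF \<nu>(2), of "\<lambda>x. f x - h x" j] f ih by simp
    also have "\<dots> = (1 + net_bound 2) * (LINT x|\<mu>. \<bar>f x - h x\<bar>) + 4 * L * (1/2)^(\<nu> j) * m" by (simp add: algebra_simps)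
    also have "\<dots> < (1 + net_bound 2) * e' + e / 2" using h(2) c J[OF j] by (intro add_strict_mono mult_strict_left_mono)
    also have "\<dots> = e" using e'(2) by simp
    finally show "norm ((LINT x|\<mu>. \<bar>disc (\<nu> j) f x - f x\<bar>) - 0) < e" by simp
  qed
qed

text \<open>The discretization is a convex combination of averages over balls contained in the ball
  of twice the radius about \<open>x\<close>, whence the level n - 1. Where the sharp function is
  finite, averages at these levels converge as soon as the discretizations do.\<close>

lemma disc_near_avg:
  assumes n: "1 \<le> n" and f: "integrable \<mu> f" and x: "sharp f x < top"
  shows "\<bar>disc n f x - avg x (2 * (1/2)^(n - 1)) f\<bar> \<le> H0 * (2 * (1/2)^(n - 1)) * rsharp f x"
proof -
  let ?r = "2 * (1/2::real)^n" and ?R = "2 * (1/2::real)^(n - 1)"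
  have R: "?R = 2 * ?r" using n by (cases n) auto
  have r1: "?r \<le> 1" using n power_decreasing[of 1 n "1/2::real"] by simp
  have diff: "disc n f x - avg x ?R f = (\<Sum>z\<in>N n. (avg z ?r f - avg x ?R f) * phi n z x)"
    unfolding disc_def left_diff_distrib sum_subtractf sum_distrib_left[symmetric] phi_sum[OF n] by simp
  have "\<bar>disc n f x - avg x ?R f\<bar> \<le> (\<Sum>z\<in>N n. \<bar>(avg z ?r f - avg x ?R f) * phi n z x\<bar>)"
    unfolding diff by (rule sum_abs)
  also have "\<dots> \<le> (\<Sum>z\<in>N n. H0 * ?R * rsharp f x * phi n z x)"
  proof (rule sum_mono)
    fix z assume z: "z \<in> N n"
    show "\<bar>(avg z ?r f - avg x ?R f) * phi n z x\<bar> \<le> H0 * ?R * rsharp f x * phi n z x"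
    proof (cases "z \<in> active n x")
      case True
      have sub: "ball z ?r \<subseteq> ball x ?R"
      proof
        fix y assume "y \<in> ball z ?r"
        then show "y \<in> ball x ?R" using True dist_triangle[of x y z] unfolding R active_def by simp
      qed
      have "\<bar>avg z ?r f - avg x ?R f\<bar> \<le> H0 * ?R * rsharp f x"
        by (rule avg_nested[OF f _ _ _ _ sub _ x]) (use r1 R in auto)
      moreover have "0 \<le> H0 * ?R * rsharp f x" using H0_ge1 by (intro mult_nonneg_nonneg) auto
      ultimately show ?thesis unfolding abs_mult using phi_nonneg[OF n, of z x]
        by (intro mult_mono) auto
    qed (simp add: phi_zero[OF z])
  qed
  also have "\<dots> = H0 * ?R * rsharp f x" unfolding sum_distrib_left[symmetric] phi_sum[OF n] by simp
  finally show ?thesis .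
qed

end

section \<open>From the Poisson extension to Hajlasz gradients\<close>

context ahlfors
begin

lemma mean_osc_tendsto:
  assumes f: "integrable \<mu> f" and u: "\<And>j. integrable \<mu> (u j)" and r: "0 < r"
    and lim: "(\<lambda>j. LINT x|\<mu>. \<bar>u j x - f x\<bar>) \<longlonglongrightarrow> 0"
  shows "(\<lambda>j. mean_osc (u j) z r) \<longlonglongrightarrow> mean_osc f z r"
proof (rule LIM_zero_cancel, rule Lim_null_comparison)
  let ?m = "measure \<mu> (ball z r)"
  have m: "0 < ?m" by (rule ball_pos[OF r])
  have "\<bar>mean_osc (u j) z r - mean_osc f z r\<bar> \<le> 2 / ?m * (LINT x|\<mu>. \<bar>u j x - f x\<bar>)" for j
  proof -
    have "avg z r (\<lambda>x. \<bar>u j x - f x\<bar>) \<le> (LINT x|\<mu>. \<bar>u j x - f x\<bar>) / ?m"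
      unfolding average_def set_lebesgue_integral_def using u f
      by (intro divide_right_mono integral_mono_AE_nonneg) (auto intro!: AE_I2 split: split_indicator)
    moreover have "avg z r (\<lambda>x. \<bar>f x - u j x\<bar>) = avg z r (\<lambda>x. \<bar>u j x - f x\<bar>)" by (simp add: abs_minus_commute)
    ultimately show ?thesis using mean_osc_diff_le[OF u f r, of j z] mean_osc_diff_le[OF f u r, of z j] by simp
  qed
  then show "\<forall>\<^sub>F j in sequentially. norm (mean_osc (u j) z r - mean_osc f z r) \<le> 2 / ?m * (LINT x|\<mu>. \<bar>u j x - f x\<bar>)" by simp
  have "(\<lambda>j. 2 / ?m * (LINT x|\<mu>. \<bar>u j x - f x\<bar>)) \<longlonglongrightarrow> 2 / ?m * 0" by (intro tendsto_intros lim)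
  then show "(\<lambda>j. 2 / ?m * (LINT x|\<mu>. \<bar>u j x - f x\<bar>)) \<longlonglongrightarrow> 0" by simp
qed

text \<open>A ball witnessing that the sharp function of \<open>f\<close> exceeds \<open>t\<close>
  eventually does so for \<open>u j\<close>, because the mean oscillation over a fixed ball is
  continuous in L1.\<close>

lemma sharp_liminf:
  assumes f: "integrable \<mu> f" and u: "\<And>j. integrable \<mu> (u j)" "\<And>j. sharp (u j) x < top"
    and lim: "(\<lambda>j. LINT x|\<mu>. \<bar>u j x - f x\<bar>) \<longlonglongrightarrow> 0" and t: "0 \<le> t" "ennreal t < sharp f x"
  shows "ennreal (t powr Q) \<le> liminf (\<lambda>j. ennreal (rsharp (u j) x powr Q))"
proof (rule Liminf_bounded)
  obtain z r where zr: "x \<in> ball z r" "0 < r" "r \<le> 2" "ennreal t < ennreal (mean_osc f z r / r)"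
    by (rule sharp_gt[OF t(2)])
  have "t * r < mean_osc f z r" using zr t by (simp add: ennreal_less_iff field_simps)
  then have "\<forall>\<^sub>F j in sequentially. t * r < mean_osc (u j) z r"
    by (rule order_tendstoD(1)[OF mean_osc_tendsto[OF f u(1) zr(2) lim]])
  then show "\<forall>\<^sub>F j in sequentially. ennreal (t powr Q) \<le> ennreal (rsharp (u j) x powr Q)"
  proof eventually_elim
    case (elim j)
    then have "r * t < r * rsharp (u j) x"
      using mean_osc_le_rsharp[OF u(2)[of j] zr(1-3)] by (simp add: mult.commute)
    then have "t \<le> rsharp (u j) x" using zr(2) by simp
    then show ?case using t Q by (intro ennreal_leI powr_mono2) auto
  qed
qed

text \<open>The power is taken of real levels below the sharp function. They are bounded by the Q-th
  root of the finite \<open>G\<close>, which gives finiteness and the estimate together.\<close>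

lemma sharp_powr_le:
  assumes G: "G < top" and t: "\<And>t. 0 \<le> t \<Longrightarrow> ennreal t < sharp f x \<Longrightarrow> ennreal (t powr Q) \<le> G"
  shows "sharp f x < top \<and> ennreal (rsharp f x powr Q) \<le> G"
proof -
  obtain b where b: "G = ennreal b" "0 \<le> b" using G by (cases G) auto
  have le: "t \<le> b powr (1 / Q)" if "0 \<le> t" "ennreal t < sharp f x" for t
  proof -
    have "t powr Q \<le> b" using t[OF that] b by simp
    then have "(t powr Q) powr (1 / Q) \<le> b powr (1 / Q)" using Q by (intro powr_mono2) auto
    then show ?thesis using that Q by (simp add: powr_powr)
  qed
  have fin: "sharp f x < top"
  proof (rule ccontr)
    assume "\<not> ?thesis"
    then have "sharp f x = top" using top.not_eq_extremum by blast
    then have "ennreal (b powr (1 / Q) + 1) < sharp f x" by simp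
    then have "b powr (1 / Q) + 1 \<le> b powr (1 / Q)" by (rule le[rotated]) simp
    then show False by simp
  qed
  have "rsharp f x \<le> b powr (1 / Q)"
  proof (rule dense_le)
    fix t assume "t < rsharp f x"
    show "t \<le> b powr (1 / Q)"
    proof (cases "0 \<le> t")
      case True
      have "ennreal t < ennreal (rsharp f x)" using \<open>t < rsharp f x\<close> True by (simp add: ennreal_less_iff)
      then have "ennreal t < sharp f x" using fin by simp
      then show ?thesis by (rule le[OF True])
    next
      case False
      then show ?thesis by (smt (verit) powr_ge_zero)
    qed
  qed
  then have "rsharp f x powr Q \<le> (b powr (1 / Q)) powr Q" using Q by (intro powr_mono2) auto
  also have "\<dots> = b" using Q b by (simp add: powr_powr)
  finally show ?thesis using fin b by (simp add: ennreal_leI)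
qed

end

section \<open>Construction of the gradient and comparison of semi-norms\<close>

locale poincare_filling = ahlfors_poincare \<mu> Q K CP \<Lambda> + ahlfors_filling \<mu> Q K N ini ter
  for \<mu> :: "'a::metric_space measure" and Q K CP \<Lambda> N ini ter
begin

lemma A_space_imp_gradient:
  assumes Cs: "0 \<le> Cs" "\<And>u L \<rho> R. L-lipschitz_on UNIV u \<Longrightarrow> \<rho> \<in> borel_measurable \<mu> \<Longrightarrow>
     (\<And>x. 0 \<le> \<rho> x \<and> \<rho> x \<le> R \<and> Lip u x \<le> \<rho> x) \<Longrightarrow>
     (LINT x|\<mu>. rsharp u x powr Q) \<le> Cs * (LINT x|\<mu>. \<rho> x powr Q)"
    and fA: "f \<in> A_space \<mu> N ini ter Q"
  shows "\<exists>g\<in>hajlasz_gradients \<mu> 1 f \<inter> Lp_space \<mu> Q.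
     Lp_norm \<mu> Q g \<le> H * (Cs * energy_const * 4 * log_const) powr (1 / Q) * A_seminorm \<mu> N ini ter Q f"
proof -
  define s where "s = edge_diff ini ter (poisson_ext \<mu> f)"
  define S where "S = A_seminorm \<mu> N ini ter Q f"
  have f: "integrable \<mu> f" and s: "s \<in> weak_lp Q (filling_edges N)"
    using fA unfolding A_space_def s_def by auto
  have S: "S = weak_lp_norm Q (filling_edges N) s" unfolding S_def A_seminorm_def s_def ..
  have S0: "0 \<le> S" unfolding S by (rule weak_lp_norm_nonneg[OF Q s edges_nonempty])
  define G where "G = {n. 1 \<le> n \<and> (\<Sum>e\<in>level_edge n ` adj_pairs n. \<bar>s e\<bar> powr Q) \<le> 2 * log_const * S powr Q}"
  have iG: "infinite G" unfolding G_def S by (rule infinitely_many_good_levels[OF s])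
  define \<nu> where "\<nu> = enumerate G"
  have \<nu>G: "\<nu> j \<in> G" for j unfolding \<nu>_def by (rule enumerate_in_set[OF iG])
  have \<nu>mono: "strict_mono \<nu>" unfolding \<nu>_def by (rule strict_mono_enumerate[OF iG])
  have \<nu>1: "1 \<le> \<nu> j" for j using \<nu>G[of j] unfolding G_def by simp
  have L1: "(\<lambda>j. LINT x|\<mu>. norm (disc (\<nu> j) f x - f x)) \<longlonglongrightarrow> 0"
    using disc_tendsto_L1[OF f filterlim_subseq[OF \<nu>mono] \<nu>1] by simp
  \<comment> \<open>A second extraction, now among the good levels, upgrades L1 convergence to
    almost everywhere convergence.\<close>
  have "\<exists>r::nat\<Rightarrow>nat. strict_mono r \<and> (AE x in \<mu>. (\<lambda>n. disc (\<nu> (r n)) f x - f x) \<longlonglongrightarrow> 0)"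
    by (rule tendsto_L1_AE_subseq[OF _ L1]) (use f disc_integrable \<nu>1 in auto)
  then obtain r :: "nat \<Rightarrow> nat" where r: "strict_mono r" "AE x in \<mu>. (\<lambda>n. disc (\<nu> (r n)) f x - f x) \<longlonglongrightarrow> 0" by blast
  define \<sigma> where "\<sigma> = (\<lambda>j. \<nu> (r j))"
  define u where "u = (\<lambda>j. disc (\<sigma> j) f)"
  have \<sigma>G: "\<sigma> j \<in> G" for j unfolding \<sigma>_def by (rule \<nu>G)
  have \<sigma>1: "1 \<le> \<sigma> j" for j unfolding \<sigma>_def by (rule \<nu>1)
  have \<sigma>mono: "strict_mono \<sigma>" unfolding \<sigma>_def using \<nu>mono r(1) by (simp add: strict_mono_def)
  have uL: "\<exists>L. L-lipschitz_on UNIV (u j)" for j unfolding u_def by (rule disc_lipschitz[OF \<sigma>1])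
  have ui: "integrable \<mu> (u j)" for j unfolding u_def by (rule disc_integrable[OF \<sigma>1])
  have ufin: "sharp (u j) x < top" for j x using uL[of j] sharp_lipschitz_fin by blast
  have uL1: "(\<lambda>j. LINT x|\<mu>. \<bar>u j x - f x\<bar>) \<longlonglongrightarrow> 0"
    unfolding u_def \<sigma>_def using LIMSEQ_subseq_LIMSEQ[OF L1 r(1)] by (simp add: o_def)
  \<comment> \<open>The 4 is 2 for the two orders of each pair times 2 from the choice of good
    levels.\<close>
  define B where "B = Cs * energy_const * 4 * log_const * S powr Q"
  have B0: "0 \<le> B" unfolding B_def using Cs(1) energy_const_nonneg log_const_nonneg by simp
  have energy: "(LINT x|\<mu>. rsharp (u j) x powr Q) \<le> B" for j
  proof -
    obtain L where L: "L-lipschitz_on UNIV (u j)" using uL by blast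
    have "(LINT x|\<mu>. rsharp (u j) x powr Q) \<le> Cs * (LINT x|\<mu>. rho (\<sigma> j) f x powr Q)"
    proof (rule Cs(2)[OF L rho_measurable])
      fix x
      show "0 \<le> rho (\<sigma> j) f x \<and> rho (\<sigma> j) f x \<le> part_const * 2^(\<sigma> j) * (\<Sum>p\<in>adj_pairs (\<sigma> j). jump (\<sigma> j) f p) \<and> Lip (u j) x \<le> rho (\<sigma> j) f x"
        unfolding u_def using rho_bounds Lip_disc_le[OF \<sigma>1] by blast
    qed
    also have "\<dots> \<le> Cs * (energy_const * (\<Sum>p\<in>adj_pairs (\<sigma> j). jump (\<sigma> j) f p powr Q))"
      by (intro mult_left_mono rho_integral \<sigma>1 Cs(1))
    also have "\<dots> \<le> Cs * (energy_const * (2 * (\<Sum>e\<in>level_edge (\<sigma> j) ` adj_pairs (\<sigma> j). \<bar>s e\<bar> powr Q)))"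
      unfolding s_def by (intro mult_left_mono jump_sum_le \<sigma>1 Cs(1) energy_const_nonneg)
    also have "\<dots> \<le> Cs * (energy_const * (2 * (2 * log_const * S powr Q)))"
      using \<sigma>G[of j] unfolding G_def
      by (intro mult_left_mono Cs(1) energy_const_nonneg) auto
    finally show ?thesis unfolding B_def by (simp add: ac_simps)
  qed
  \<comment> \<open>By Fatou this lower limit is integrable, so it is finite almost everywhere, and
    there it dominates the Q-th power of the sharp function of \<open>f\<close>.\<close>
  define W where "W = (\<lambda>x. liminf (\<lambda>j. ennreal (rsharp (u j) x powr Q)))"
  have Wm [measurable]: "W \<in> borel_measurable \<mu>" unfolding W_def by measurable
  have "(\<integral>\<^sup>+x. W x \<partial>\<mu>) \<le> liminf (\<lambda>j. \<integral>\<^sup>+x. ennreal (rsharp (u j) x powr Q) \<partial>\<mu>)"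
    unfolding W_def by (rule nn_integral_liminf) measurable
  also have "\<dots> \<le> ennreal B"
  proof (rule Liminf_le)
    have "(\<integral>\<^sup>+x. ennreal (rsharp (u j) x powr Q) \<partial>\<mu>) \<le> ennreal B" for j
    proof -
      obtain L where L: "L-lipschitz_on UNIV (u j)" using uL by blast
      have "integrable \<mu> (\<lambda>x. rsharp (u j) x powr Q)"
        using rsharp_le[OF L] Q by (intro bounded_integrable[where B = "(2 * L) powr Q"]) (auto intro!: powr_mono2)
      then have "(\<integral>\<^sup>+x. ennreal (rsharp (u j) x powr Q) \<partial>\<mu>) = ennreal (LINT x|\<mu>. rsharp (u j) x powr Q)"
        by (intro nn_integral_eq_integral) auto
      then show ?thesis using energy[of j] by (simp add: ennreal_leI)
    qed
    then show "\<forall>\<^sub>F j in sequentially. (\<integral>\<^sup>+x. ennreal (rsharp (u j) x powr Q) \<partial>\<mu>) \<le> ennreal B" by simp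
  qed simp
  finally have WB: "(\<integral>\<^sup>+x. W x \<partial>\<mu>) \<le> ennreal B" .
  then have "(\<integral>\<^sup>+x. W x \<partial>\<mu>) \<noteq> \<infinity>" using neq_top_trans[OF ennreal_neq_top] by simp
  then have "AE x in \<mu>. W x \<noteq> \<infinity>" by (intro nn_integral_PInf_AE) auto
  then have AEs: "AE x in \<mu>. sharp f x < top \<and> ennreal (rsharp f x powr Q) \<le> W x"
  proof eventually_elim
    case (elim x)
    then have "W x < top" by (simp add: less_top)
    then show ?case
      by (rule sharp_powr_le) (auto simp: W_def intro!: sharp_liminf[OF f ui ufin uL1])
  qed
  have "AE x in \<mu>. sharp f x < top \<and> (\<lambda>n. disc (\<nu> (r n)) f x - f x) \<longlonglongrightarrow> 0"
    using AEs r(2) by eventually_elim auto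
  then obtain N0 where N0: "{x \<in> space \<mu>. \<not> (sharp f x < top \<and> (\<lambda>n. disc (\<nu> (r n)) f x - f x) \<longlonglongrightarrow> 0)} \<subseteq> N0"
    "N0 \<in> null_sets \<mu>" by (elim AE_E) (auto intro: null_setsI)
  \<comment> \<open>Outside \<open>N0\<close> the two inputs of \<open>rsharp_hajlasz\<close> hold
    for the scales \<open>\<sigma> j - 1\<close>, the shift being that of
    \<open>disc_near_avg\<close>.\<close>
  have good: "sharp f x < top" "(\<lambda>j. avg x (2 * (1/2)^(\<sigma> j - 1)) f) \<longlonglongrightarrow> f x" if x: "x \<notin> N0" for x
  proof -
    show fin: "sharp f x < top" using x N0(1) by auto
    have "(\<lambda>n. disc (\<nu> (r n)) f x - f x) \<longlonglongrightarrow> 0" using x N0(1) by auto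
    then have ux: "(\<lambda>j. u j x) \<longlonglongrightarrow> f x" unfolding u_def \<sigma>_def by (rule LIM_zero_cancel)
    have \<sigma>inf: "filterlim (\<lambda>j. \<sigma> j - 1) sequentially sequentially"
      using filterlim_subseq[OF \<sigma>mono] unfolding filterlim_at_top eventually_sequentially
      by (metis le_diff_conv2 \<sigma>1)
    have "(\<lambda>n. H0 * (2 * (1/2)^n) * rsharp f x) \<longlonglongrightarrow> H0 * (2 * 0) * rsharp f x"
      by (intro tendsto_intros LIMSEQ_power_zero) auto
    then have z: "(\<lambda>j. H0 * (2 * (1/2)^(\<sigma> j - 1)) * rsharp f x) \<longlonglongrightarrow> H0 * (2 * 0) * rsharp f x"
      using \<sigma>inf by (rule filterlim_compose)
    have "(\<lambda>j. u j x - avg x (2 * (1/2)^(\<sigma> j - 1)) f) \<longlonglongrightarrow> 0"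
    proof (rule Lim_null_comparison)
      show "\<forall>\<^sub>F j in sequentially. norm (u j x - avg x (2 * (1/2)^(\<sigma> j - 1)) f) \<le> H0 * (2 * (1/2)^(\<sigma> j - 1)) * rsharp f x"
        unfolding u_def using disc_near_avg[OF \<sigma>1 f fin] by simp
      show "(\<lambda>j. H0 * (2 * (1/2)^(\<sigma> j - 1)) * rsharp f x) \<longlonglongrightarrow> 0" using z by simp
    qed
    from tendsto_diff[OF ux this] show "(\<lambda>j. avg x (2 * (1/2)^(\<sigma> j - 1)) f) \<longlonglongrightarrow> f x" by simp
  qed
  have \<sigma>inf: "filterlim (\<lambda>j. \<sigma> j - 1) sequentially sequentially"
    using filterlim_subseq[OF \<sigma>mono] unfolding filterlim_at_top eventually_sequentially
    by (metis le_diff_conv2 \<sigma>1)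
  define g where "g = (\<lambda>x. H * rsharp f x)"
  have gm: "g \<in> borel_measurable \<mu>" unfolding g_def by measurable
  have g0: "0 \<le> g x" for x unfolding g_def using H_ge1 by simp
  have "\<bar>f x - f y\<bar> \<le> dist x y powr 1 * (g x + g y)" if "x \<in> UNIV - N0" "y \<in> UNIV - N0" for x y
  proof -
    have "\<bar>f x - f y\<bar> \<le> H * dist x y * (rsharp f x + rsharp f y)"
      by (rule rsharp_hajlasz[where \<sigma> = "\<lambda>j. \<sigma> j - 1"]) (use that good f \<sigma>inf in auto)
    then show ?thesis unfolding g_def by (simp add: algebra_simps)
  qed
  then have gh: "g \<in> hajlasz_gradients \<mu> 1 f"
    unfolding hajlasz_gradients_def using gm g0 N0(2) by blast
  have gW: "AE x in \<mu>. ennreal (g x powr Q) \<le> ennreal (H powr Q) * W x"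
    using AEs
  proof eventually_elim
    case (elim x)
    have "ennreal (g x powr Q) = ennreal (H powr Q) * ennreal (rsharp f x powr Q)"
      unfolding g_def by (simp add: powr_mult ennreal_mult)
    also have "\<dots> \<le> ennreal (H powr Q) * W x" using elim by (intro mult_left_mono) auto
    finally show ?case .
  qed
  have "(\<integral>\<^sup>+x. ennreal (g x powr Q) \<partial>\<mu>) \<le> (\<integral>\<^sup>+x. ennreal (H powr Q) * W x \<partial>\<mu>)"
    by (rule nn_integral_mono_AE[OF gW])
  also have "\<dots> = ennreal (H powr Q) * (\<integral>\<^sup>+x. W x \<partial>\<mu>)" by (rule nn_integral_cmult) measurable
  also have "\<dots> \<le> ennreal (H powr Q) * ennreal B" using WB by (intro mult_left_mono) auto
  also have "\<dots> = ennreal (H powr Q * B)" using B0 by (simp add: ennreal_mult)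
  finally have gB: "(\<integral>\<^sup>+x. ennreal (g x powr Q) \<partial>\<mu>) \<le> ennreal (H powr Q * B)" .
  have gi: "integrable \<mu> (\<lambda>x. g x powr Q)"
    using gm gB by (intro integrableI_bounded) (auto simp: order.strict_trans1)
  then have "ennreal (LINT x|\<mu>. g x powr Q) \<le> ennreal (H powr Q * B)"
    using gB by (subst nn_integral_eq_integral[symmetric]) auto
  then have gB2: "(LINT x|\<mu>. g x powr Q) \<le> H powr Q * B" using B0 by (simp add: ennreal_le_iff)
  have gL: "g \<in> Lp_space \<mu> Q" unfolding Lp_space_def using gm gi g0 by simp
  have "Lp_norm \<mu> Q g \<le> (H powr Q * B) powr (1 / Q)"
    unfolding Lp_norm_def using gB2 g0 Q by (intro powr_mono2) auto
  also have "\<dots> = H * (Cs * energy_const * 4 * log_const) powr (1 / Q) * S"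
    unfolding B_def powr_mult using H_ge1 S0 Q by (simp add: powr_powr)
  finally show ?thesis using gh gL unfolding S_def by blast
qed

lemma A_space_M_space:
  "A_space \<mu> N ini ter Q = M_space \<mu> 1 Q \<and>
    (\<exists>C\<ge>1. \<forall>f\<in>A_space \<mu> N ini ter Q.
        inverse C * M_seminorm \<mu> 1 Q f \<le> A_seminorm \<mu> N ini ter Q f \<and>
        A_seminorm \<mu> N ini ter Q f \<le> C * M_seminorm \<mu> 1 Q f)"
proof -
  obtain Cs where Cs: "0 \<le> Cs" "\<And>u L \<rho> R. L-lipschitz_on UNIV u \<Longrightarrow> \<rho> \<in> borel_measurable \<mu> \<Longrightarrow>
     (\<And>x. 0 \<le> \<rho> x \<and> \<rho> x \<le> R \<and> Lip u x \<le> \<rho> x) \<Longrightarrow>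
     (LINT x|\<mu>. rsharp u x powr Q) \<le> Cs * (LINT x|\<mu>. \<rho> x powr Q)"
    using strong_type by blast
  define c1 where "c1 = H * (Cs * energy_const * 4 * log_const) powr (1 / Q)"
  define c2 where "c2 = Q / (Q - 1) * edge_const powr (1 / Q)"
  define C where "C = max 1 (max c1 c2)"
  have C: "1 \<le> C" "c1 \<le> C" "c2 \<le> C" unfolding C_def by auto
  have grad: "\<exists>g\<in>hajlasz_gradients \<mu> 1 f \<inter> Lp_space \<mu> Q. Lp_norm \<mu> Q g \<le> c1 * A_seminorm \<mu> N ini ter Q f"
    if "f \<in> A_space \<mu> N ini ter Q" for f
    unfolding c1_def by (rule A_space_imp_gradient[OF Cs that])
  have eq: "A_space \<mu> N ini ter Q = M_space \<mu> 1 Q"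
  proof
    show "A_space \<mu> N ini ter Q \<subseteq> M_space \<mu> 1 Q"
    proof
      fix f assume f: "f \<in> A_space \<mu> N ini ter Q"
      then have "hajlasz_gradients \<mu> 1 f \<inter> Lp_space \<mu> Q \<noteq> {}" "integrable \<mu> f"
        using grad[OF f] by (auto simp: A_space_def)
      then show "f \<in> M_space \<mu> 1 Q" unfolding M_space_def by blast
    qed
    show "M_space \<mu> 1 Q \<subseteq> A_space \<mu> N ini ter Q" using M_space_imp_A_space(1) by blast
  qed
  have Lp0: "0 \<le> Lp_norm \<mu> Q g" for g unfolding Lp_norm_def by simp
  have "inverse C * M_seminorm \<mu> 1 Q f \<le> A_seminorm \<mu> N ini ter Q f \<and>
        A_seminorm \<mu> N ini ter Q f \<le> C * M_seminorm \<mu> 1 Q f"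
    if f: "f \<in> A_space \<mu> N ini ter Q" for f
  proof
    have fM: "f \<in> M_space \<mu> 1 Q" using f eq by blast
    then have ne: "hajlasz_gradients \<mu> 1 f \<inter> Lp_space \<mu> Q \<noteq> {}" unfolding M_space_def by blast
    have A0: "0 \<le> A_seminorm \<mu> N ini ter Q f"
      unfolding A_seminorm_def using f edges_nonempty by (intro weak_lp_norm_nonneg Q) (auto simp: A_space_def)
    have M0: "0 \<le> M_seminorm \<mu> 1 Q f"
      unfolding M_seminorm_def by (rule cINF_greatest[OF ne]) (rule Lp0)
    obtain g where g: "g \<in> hajlasz_gradients \<mu> 1 f \<inter> Lp_space \<mu> Q" "Lp_norm \<mu> Q g \<le> c1 * A_seminorm \<mu> N ini ter Q f"
      using grad[OF f] by blast
    have "M_seminorm \<mu> 1 Q f \<le> Lp_norm \<mu> Q g"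
      unfolding M_seminorm_def using Lp0 by (intro cINF_lower[OF _ g(1)] bdd_belowI2[where m = 0])
    also have "\<dots> \<le> C * A_seminorm \<mu> N ini ter Q f"
      using g(2) mult_right_mono[OF C(2) A0] by linarith
    finally show "inverse C * M_seminorm \<mu> 1 Q f \<le> A_seminorm \<mu> N ini ter Q f"
      using C(1) by (simp add: field_simps)
    show "A_seminorm \<mu> N ini ter Q f \<le> C * M_seminorm \<mu> 1 Q f"
      using M_space_imp_A_space(2)[OF fM] mult_right_mono[OF C(3) M0] unfolding c2_def by linarith
  qed
  then show ?thesis using eq C(1) by blast
qed

end

section \<open>Uniform constants from Ahlfors regularity\<close>

lemma ahlforsI:
  fixes \<mu> :: "'a::metric_space measure"
  assumes Q: "Q > 1" and cpt: "compact (UNIV :: 'a set)" and diam: "diameter (UNIV :: 'a set) = 1"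
    and sets: "sets \<mu> = sets borel" and reg: "ahlfors_regular \<mu> Q"
  shows "\<exists>K. ahlfors \<mu> Q K"
proof -
  obtain c where c: "1 \<le> c" and bounds: "\<And>z r. 0 < r \<Longrightarrow> r \<le> 1 \<Longrightarrow>
      ennreal (inverse c * r powr Q) \<le> emeasure \<mu> (ball z r) \<and> emeasure \<mu> (ball z r) \<le> ennreal (c * r powr Q)"
    using reg unfolding ahlfors_regular_def by blast
  have sp: "space \<mu> = UNIV" using sets_eq_imp_space_eq[OF sets] by simp
  have om: "open S \<Longrightarrow> S \<in> sets \<mu>" for S using sets by simp
  have dist: "dist x y \<le> 1" for x y :: 'a
    using diameter_bounded_bound[OF compact_imp_bounded[OF cpt], of x y] diam by simp
  \<comment> \<open>An open ball of radius 1 can miss points of a space of diameter 1, and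
    regularity controls radii up to 1 only; finitely many unit balls cover by compactness.\<close>
  have "emeasure \<mu> UNIV < \<infinity>"
  proof -
    have cov: "(UNIV :: 'a set) \<subseteq> (\<Union>z\<in>UNIV. ball z 1)"
    proof
      show "x \<in> (\<Union>z\<in>UNIV. ball z 1)" for x :: 'a by (rule UN_I[of x]) auto
    qed
    obtain F where F: "finite F" "(UNIV :: 'a set) \<subseteq> (\<Union>z\<in>F. ball z 1)"
      by (rule compactE_image[OF cpt _ cov]) auto
    have "emeasure \<mu> UNIV \<le> emeasure \<mu> (\<Union>z\<in>F. ball z 1)"
      by (rule emeasure_mono[OF F(2) om]) auto
    also have "\<dots> \<le> (\<Sum>z\<in>F. emeasure \<mu> (ball z 1))"
      by (rule emeasure_subadditive_finite[OF F(1)]) (auto intro: om)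
    also have "\<dots> \<le> (\<Sum>z\<in>F. ennreal (c * 1 powr Q))" using bounds[of 1] by (intro sum_mono) simp
    also have "\<dots> < \<infinity>" using c by (subst sum_ennreal) (auto simp del: sum_constant)
    finally show ?thesis .
  qed
  then interpret finite_measure \<mu> by (intro finite_measureI) (simp add: sp)
  have up: "measure \<mu> (ball z r) \<le> c * r powr Q" if "0 < r" "r \<le> 1" for z r
    using bounds[OF that, of z] c by (simp add: emeasure_eq_measure)
  have lo: "r powr Q \<le> c * measure \<mu> (ball z r)" if "0 < r" "r \<le> 1" for z r
    using bounds[OF that, of z] c by (simp add: emeasure_eq_measure field_simps)
  \<comment> \<open>The factor 2^Q extends the lower bound to radii up to 2 through the ball of half
    the radius; the total mass serves as the upper bound for radii above 1.\<close>
  define K where "K = max (c * 2 powr Q) (measure \<mu> UNIV)"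
  have "1 * 1 \<le> c * 2 powr Q" using c Q by (intro mult_mono) (auto simp: ge_one_powr_ge_zero)
  then have K: "1 \<le> K" "c * 2 powr Q \<le> K" "measure \<mu> UNIV \<le> K" unfolding K_def by auto
  have "c * 1 \<le> c * 2 powr Q" using c Q by (intro mult_left_mono) (auto simp: ge_one_powr_ge_zero)
  then have cK: "c \<le> K" using K by linarith
  have "ahlfors \<mu> Q K"
  proof (unfold_locales)
    show "Q > 1" "K \<ge> 1" "compact (UNIV :: 'a set)" "sets \<mu> = sets borel" by (fact Q K cpt sets)+
    show "dist x y \<le> 1" for x y :: 'a by (fact dist)
  next
    fix z :: 'a and r :: real assume r: "0 < r" "r \<le> 2"
    have "r powr Q = 2 powr Q * (r / 2) powr Q" by (subst powr_mult[symmetric]) simp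
    also have "\<dots> \<le> 2 powr Q * (c * measure \<mu> (ball z (r / 2)))" using r by (intro mult_left_mono lo) auto
    also have "\<dots> \<le> 2 powr Q * (c * measure \<mu> (ball z r))"
      using c r sets by (intro mult_left_mono finite_measure_mono subset_ball) auto
    also have "\<dots> = (c * 2 powr Q) * measure \<mu> (ball z r)" by simp
    also have "\<dots> \<le> K * measure \<mu> (ball z r)" using K by (intro mult_right_mono) auto
    finally show "r powr Q \<le> K * measure \<mu> (ball z r)" .
  next
    fix z :: 'a and r :: real assume r: "0 < r"
    show "measure \<mu> (ball z r) \<le> K * r powr Q"
    proof (cases "r \<le> 1")
      case True
      have "measure \<mu> (ball z r) \<le> c * r powr Q" using r True by (rule up)
      also have "\<dots> \<le> K * r powr Q" using cK by (intro mult_right_mono) auto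
      finally show ?thesis .
    next
      case False
      have "measure \<mu> (ball z r) \<le> measure \<mu> UNIV" using sets by (intro finite_measure_mono) auto
      also have "\<dots> \<le> K * 1" using K by simp
      also have "\<dots> \<le> K * r powr Q" using False Q K by (intro mult_left_mono) (auto simp: ge_one_powr_ge_zero)
      finally show ?thesis .
    qed
  qed
  then show ?thesis by blast
qed

theorem theorem1p4:
  fixes \<mu> :: "'a::metric_space measure"
    and Q :: real
    and N :: "nat \<Rightarrow> 'a set"
    and ini ter :: "'a vertex set \<Rightarrow> 'a vertex"
  assumes "Q > 1"
    and "compact (UNIV :: 'a set)"
    and "diameter (UNIV :: 'a set) = 1"
    and "sets \<mu> = sets borel"
    and "ahlfors_regular \<mu> Q"
    and "supports_poincare \<mu> Q"
    and "\<And>n. n \<ge> 1 \<Longrightarrow> maximal_separated (2 powr (- real n)) (N n)"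
    and "\<And>e. e \<in> filling_edges N \<Longrightarrow> e = {ini e, ter e}"
  shows "A_space \<mu> N ini ter Q = M_space \<mu> 1 Q \<and>
    (\<exists>C\<ge>1. \<forall>f\<in>A_space \<mu> N ini ter Q.
        inverse C * M_seminorm \<mu> 1 Q f \<le> A_seminorm \<mu> N ini ter Q f \<and>
        A_seminorm \<mu> N ini ter Q f \<le> C * M_seminorm \<mu> 1 Q f)"
proof -
  obtain K where "ahlfors \<mu> Q K" using ahlforsI[OF assms(1-5)] by blast
  then interpret ahlfors \<mu> Q K .
  obtain C \<Lambda> where C: "0 \<le> C" "1 \<le> \<Lambda>" and
    P: "\<And>f L z R. L-lipschitz_on UNIV f \<Longrightarrow> 0 < R \<Longrightarrow>
        average \<mu> (ball z R) (\<lambda>x. \<bar>f x - average \<mu> (ball z R) f\<bar>)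
          \<le> C * R * average \<mu> (ball z (\<Lambda> * R)) (\<lambda>x. Lip f x powr Q) powr (1 / Q)"
    using assms(6) unfolding supports_poincare_def by blast
  \<comment> \<open>The maximum with 1 makes the Poincare constant positive.\<close>
  interpret poincare_filling \<mu> Q K "max C 1" \<Lambda> N ini ter
  proof unfold_locales
    fix f :: "'a \<Rightarrow> real" and L z and r :: real
    assume f: "L-lipschitz_on UNIV f" and r: "0 < r"
    have "mean_osc f z r \<le> C * r * avg z (\<Lambda> * r) (\<lambda>x. Lip f x powr Q) powr (1 / Q)"
      unfolding mean_osc_def by (rule P[OF f r])
    also have "\<dots> \<le> max C 1 * r * avg z (\<Lambda> * r) (\<lambda>x. Lip f x powr Q) powr (1 / Q)"
      using r by (intro mult_right_mono) auto
    finally show "mean_osc f z r \<le> max C 1 * r * avg z (\<Lambda> * r) (\<lambda>x. Lip f x powr Q) powr (1 / Q)" .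
  qed (use assms(7,8) C in auto)
  show ?thesis by (rule A_space_M_space)
qed

end
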